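(* Let $\phi:A\to B$ be an isomorphism of abelian subgroups of a CSA$^\ast$-group $G$, with $A$ maximal abelian in $G$. Then the corresponding HNN-extension $G^\ast=\langle G,t\mid t^{-1}at=\phi(a),\ a\in A\rangle$ is a CSA$^\ast$-group if and only if it is a separated HNN-extension or there exists $s\in G$ such that $B=A^s$ and $\phi(a)=a^s$ for all $a\in A$.
   Context: Notation: $a^s=s^{-1}as$ and $A^s=s^{-1}As$. A subgroup $H$ of a group $G$ is malnormal if $H\cap H^x=1$ for all $x\in G\setminus H$. A group is a CSA-group if all its maximal abelian subgroups are malnormal. A CSA$^\ast$-group is a CSA-group without elements of order 2. The HNN-extension $G^\ast$ is separated if $A\cap g^{-1}Bg=1$ for all $g\in G$. *)

theory Defs
  imports "HOL-Algebra.Multiplicative_Group"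
begin

definition commutative_subgroup :: "'a set \<Rightarrow> ('a, 'b) monoid_scheme \<Rightarrow> bool" where
  "commutative_subgroup H G \<longleftrightarrow> subgroup H G \<and> comm_group (G\<lparr>carrier := H\<rparr>)"

definition maximal_commutative_subgroup :: "'a set \<Rightarrow> ('a, 'b) monoid_scheme \<Rightarrow> bool" where
  "maximal_commutative_subgroup H G \<longleftrightarrow>
     commutative_subgroup H G \<and> (\<forall>K. commutative_subgroup K G \<and> H \<subseteq> K \<longrightarrow> K = H)"

definition conjugate_set :: "('a, 'b) monoid_scheme \<Rightarrow> 'a set \<Rightarrow> 'a \<Rightarrow> 'a set" where
  "conjugate_set G H s = (inv\<^bsub>G\<^esub> s <#\<^bsub>G\<^esub> H) #>\<^bsub>G\<^esub> s"

definition malnormal :: "'a set \<Rightarrow> ('a, 'b) monoid_scheme \<Rightarrow> bool" where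
  "malnormal H G \<longleftrightarrow>
     subgroup H G \<and> (\<forall>x \<in> carrier G - H. H \<inter> conjugate_set G H x = {\<one>\<^bsub>G\<^esub>})"

locale csa_group = group +
  assumes malnormal_if_maximal: "maximal_commutative_subgroup H G \<Longrightarrow> malnormal H G"

locale csa_star_group = csa_group +
  assumes no_order_two: "x \<in> carrier G \<Longrightarrow> ord x \<noteq> 2"

datatype 'a hnn_letter = Base 'a | Stable | Stable_inv

definition hnn_words :: "('a, 'b) monoid_scheme \<Rightarrow> 'a hnn_letter list set" where
  "hnn_words G = lists (Base ` carrier G \<union> {Stable, Stable_inv})"

text \<open>
  The congruence on words that defines the presentation
  \<open>\<langle>G, t | t\<^sup>-\<^sup>1 a t = \<phi> a, a \<in> A\<rangle>\<close>: besides the HNN relations it is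
  generated by the multiplication table of \<open>G\<close> and by \<open>t t\<^sup>-\<^sup>1 = t\<^sup>-\<^sup>1 t = 1\<close>.
  A formal inverse is only needed for the letter \<open>t\<close>,
  since \<open>Base g\<close> is inverted by \<open>Base (inv g)\<close>.
\<close>

inductive_set hnn_rel ::
    "('a, 'b) monoid_scheme \<Rightarrow> 'a set \<Rightarrow> ('a \<Rightarrow> 'a)
      \<Rightarrow> ('a hnn_letter list \<times> 'a hnn_letter list) set"
  for G and A and \<phi> where
  refl: "w \<in> hnn_words G \<Longrightarrow> (w, w) \<in> hnn_rel G A \<phi>"
| sym: "(u, v) \<in> hnn_rel G A \<phi> \<Longrightarrow> (v, u) \<in> hnn_rel G A \<phi>"
| trans: "(u, v) \<in> hnn_rel G A \<phi> \<Longrightarrow> (v, w) \<in> hnn_rel G A \<phi> \<Longrightarrow> (u, w) \<in> hnn_rel G A \<phi>"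
| append: "(u, v) \<in> hnn_rel G A \<phi> \<Longrightarrow> (u', v') \<in> hnn_rel G A \<phi>
    \<Longrightarrow> (u @ u', v @ v') \<in> hnn_rel G A \<phi>"
| one: "([Base \<one>\<^bsub>G\<^esub>], []) \<in> hnn_rel G A \<phi>"
| mult: "g \<in> carrier G \<Longrightarrow> h \<in> carrier G
    \<Longrightarrow> ([Base g, Base h], [Base (g \<otimes>\<^bsub>G\<^esub> h)]) \<in> hnn_rel G A \<phi>"
| right_inv: "([Stable, Stable_inv], []) \<in> hnn_rel G A \<phi>"
| left_inv: "([Stable_inv, Stable], []) \<in> hnn_rel G A \<phi>"
| conj: "a \<in> A \<Longrightarrow> ([Stable_inv, Base a, Stable], [Base (\<phi> a)]) \<in> hnn_rel G A \<phi>"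

definition HNN ::
    "('a, 'b) monoid_scheme \<Rightarrow> 'a set \<Rightarrow> ('a \<Rightarrow> 'a) \<Rightarrow> 'a hnn_letter list set monoid" where
  "HNN G A \<phi> =
     \<lparr>carrier = hnn_words G // hnn_rel G A \<phi>,
      mult = (\<lambda>X Y. \<Union>u\<in>X. \<Union>v\<in>Y. hnn_rel G A \<phi> `` {u @ v}),
      one = hnn_rel G A \<phi> `` {[]}\<rparr>"

definition separated_HNN :: "('a, 'b) monoid_scheme \<Rightarrow> 'a set \<Rightarrow> 'a set \<Rightarrow> bool" where
  "separated_HNN G A B \<longleftrightarrow> (\<forall>g \<in> carrier G. A \<inter> conjugate_set G B g = {\<one>\<^bsub>G\<^esub>})"

lemma hnn_rel_words:
  assumes "group G" "A \<subseteq> carrier G" "\<phi> ` A \<subseteq> carrier G" "(u, v) \<in> hnn_rel G A \<phi>"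
  shows "u \<in> hnn_words G \<and> v \<in> hnn_words G"
proof -
  interpret group G by fact
  show ?thesis
    using assms(4)
    by induction (use assms(2,3) in \<open>auto simp: hnn_words_def\<close>)
qed

lemma equiv_hnn_rel:
  assumes "group G" "A \<subseteq> carrier G" "\<phi> ` A \<subseteq> carrier G"
  shows "equiv (hnn_words G) (hnn_rel G A \<phi>)"
proof (intro equivI refl_onI symI transI)
  show "hnn_rel G A \<phi> \<subseteq> hnn_words G \<times> hnn_words G"
    using hnn_rel_words[OF assms] by auto
qed (blast intro: hnn_rel.refl, erule hnn_rel.sym, erule (1) hnn_rel.trans)

lemma HNN_mult_class:
  assumes "group G" "A \<subseteq> carrier G" "\<phi> ` A \<subseteq> carrier G"
    and "u \<in> hnn_words G" "v \<in> hnn_words G"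
  shows "(hnn_rel G A \<phi> `` {u}) \<otimes>\<^bsub>HNN G A \<phi>\<^esub> (hnn_rel G A \<phi> `` {v}) = hnn_rel G A \<phi> `` {u @ v}"
proof -
  have eq: "hnn_rel G A \<phi> `` {u' @ v'} = hnn_rel G A \<phi> `` {u @ v}"
    if "(u, u') \<in> hnn_rel G A \<phi>" "(v, v') \<in> hnn_rel G A \<phi>" for u' v'
    using equiv_class_eq[OF equiv_hnn_rel[OF assms(1-3)] hnn_rel.append[OF that]] by simp
  have "u \<in> hnn_rel G A \<phi> `` {u}" "v \<in> hnn_rel G A \<phi> `` {v}"
    using assms(4,5) by (auto intro: hnn_rel.refl)
  then have "(\<Union>u'\<in>hnn_rel G A \<phi> `` {u}. \<Union>v'\<in>hnn_rel G A \<phi> `` {v}. hnn_rel G A \<phi> `` {u' @ v'})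
      = hnn_rel G A \<phi> `` {u @ v}"
    using eq by blast
  then show ?thesis
    by (simp add: HNN_def)
qed

lemma group_HNN:
  assumes "group G" "A \<subseteq> carrier G" "\<phi> ` A \<subseteq> carrier G"
  shows "group (HNN G A \<phi>)"
proof -
  interpret G: group G by fact
  let ?R = "hnn_rel G A \<phi>" and ?H = "HNN G A \<phi>"
  note eqv = equiv_hnn_rel[OF assms] and mul = HNN_mult_class[OF assms]
  have car: "carrier ?H = (\<lambda>w. ?R `` {w}) ` hnn_words G" and one: "\<one>\<^bsub>?H\<^esub> = ?R `` {[]}"
    by (auto simp: HNN_def quotient_def)
  have app: "u @ v \<in> hnn_words G" if "u \<in> hnn_words G" "v \<in> hnn_words G" for u v
    using that by (auto simp: hnn_words_def)
  have nil: "[] \<in> hnn_words G" by (simp add: hnn_words_def)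
  have inv: "\<exists>v \<in> hnn_words G. (v @ w, []) \<in> ?R" if "w \<in> hnn_words G" for w
    using that
  proof (induction w)
    case Nil
    then show ?case using nil hnn_rel.refl[OF nil] by (intro bexI[of _ "[]"]) simp_all
  next
    case (Cons x w)
    then have x: "x \<in> Base ` carrier G \<union> {Stable, Stable_inv}" and w: "w \<in> hnn_words G"
      by (auto simp: hnn_words_def)
    obtain v where v: "v \<in> hnn_words G" "(v @ w, []) \<in> ?R" using Cons.IH[OF w] by blast
    obtain y where y: "[y] \<in> hnn_words G" "([y, x], []) \<in> ?R"
    proof (cases x)
      case (Base g)
      with x have g: "g \<in> carrier G" by auto
      have "([Base (inv\<^bsub>G\<^esub> g), Base g], [Base \<one>\<^bsub>G\<^esub>]) \<in> ?R"
        using hnn_rel.mult[of "inv\<^bsub>G\<^esub> g" G g A \<phi>] g by simp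
      then have "([Base (inv\<^bsub>G\<^esub> g), x], []) \<in> ?R"
        unfolding Base using hnn_rel.one by (rule hnn_rel.trans)
      then show ?thesis using that[of "Base (inv\<^bsub>G\<^esub> g)"] g by (auto simp: hnn_words_def)
    next
      case Stable
      then show ?thesis using that[of Stable_inv] hnn_rel.left_inv by (auto simp: hnn_words_def)
    next
      case Stable_inv
      then show ?thesis using that[of Stable] hnn_rel.right_inv by (auto simp: hnn_words_def)
    qed
    have "(v @ [y, x] @ w, v @ [] @ w) \<in> ?R"
      by (intro hnn_rel.append y hnn_rel.refl v w)
    then have "((v @ [y]) @ x # w, []) \<in> ?R"
      using hnn_rel.trans[of "v @ [y, x] @ w" "v @ [] @ w" G A \<phi> "[]"] v(2) by simp
    then show ?case using app[OF v(1) y(1)] by blast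
  qed
  show ?thesis
  proof (rule groupI)
    fix x assume "x \<in> carrier ?H"
    then obtain w where w: "w \<in> hnn_words G" "x = ?R `` {w}" by (auto simp: car)
    obtain v where v: "v \<in> hnn_words G" "(v @ w, []) \<in> ?R" using inv[OF w(1)] by blast
    have "?R `` {v} \<otimes>\<^bsub>?H\<^esub> x = \<one>\<^bsub>?H\<^esub>"
      using equiv_class_eq[OF eqv v(2)] by (simp add: w mul v(1) one)
    then show "\<exists>y\<in>carrier ?H. y \<otimes>\<^bsub>?H\<^esub> x = \<one>\<^bsub>?H\<^esub>"
      using v(1) by (auto simp: car)
  qed (auto simp: car one mul app nil)
qed

end

theory Submission
  imports Defs
begin

text \<open>
  A group is CSA iff each \<open>x \<noteq> \<one>\<close> has a commutative centralizer and commutes with every \<open>y\<close> for which it commutes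
  with its conjugate by \<open>y\<close> (\<open>csa_group_iff\<close>). In this form one direction of the theorem is a short calculation.
  If the extension is not separated, some nontrivial \<open>a \<in> A\<close> is conjugated by \<open>tg\<close> to an element of \<open>A\<close>,
  with \<open>t\<close> the stable letter and \<open>g \<in> G\<close>. If the extension is CSA, then \<open>tg\<close> commutes with \<open>a\<close>, hence with all of \<open>A\<close>, which
  says that \<open>\<phi>\<close> is conjugation by \<open>s = g\<^sup>-\<^sup>1\<close> (\<open>conjugator_if_csa\<close>).

  The converse uses the Bass-Serre tree, on which the HNN-extension acts with the conjugates of \<open>G\<close> as vertex
  stabilizers and the conjugates of \<open>A\<close> as edge stabilizers. Elements without a fixed vertex are treated in general
  (\<open>csa_tree_action.csa_star\<close>). Such an element translates an axis; its centralizer, and every \<open>y\<close> as above,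
  preserves the axis. The stabilizer of the axis is commutative: it contains no reflections because vertex
  stabilizers have no elements of order two, and a nontrivial commutator of translations would fix the axis
  pointwise and, by the CSA property for elements with fixed vertices, be centralized by both translations.

  There remain the elements with a fixed vertex, and here the two cases of the theorem differ. In the separated case
  the fixed set of a nontrivial element has a unique highest vertex, where height is the exponent sum of \<open>t\<close>. This
  vertex is preserved by all elements in question, so the claim reduces to the stabilizer of the vertex, a copy of \<open>G\<close>
  (\<open>separated_elliptic_csa\<close>). If \<open>\<phi>\<close> is conjugation by \<open>s\<close>, then \<open>ts\<^sup>-\<^sup>1\<close> commutes with \<open>A\<close>.
  Nontrivial elements of \<open>A\<close> fix exactly the orbit of the root under the powers of \<open>ts\<^sup>-\<^sup>1\<close>, and elements of \<open>G\<close> that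
  are not conjugate into \<open>A\<close> fix only the root (\<open>A_element_csa\<close>, \<open>base_element_csa\<close>).

  The tree is constructed as a set of lists, the normal forms of left cosets of \<open>G\<close> in the HNN-extension. The group
  acts on it by van der Waerden's method, and the tree enters the general argument only through its metric.
\<close>

section \<open>CSA-groups in terms of elements\<close>

text \<open>Required of all nontrivial elements, this is the CSA property of the group, in a form that does not
  mention subgroups. The variable \<open>x'\<close> stands for the conjugate \<open>y\<^sup>-\<^sup>1xy\<close>; the equation \<open>y x' = x y\<close> is
  transported by homomorphisms as it stands.\<close>

definition csa_element :: "('a, 'b) monoid_scheme \<Rightarrow> 'a \<Rightarrow> bool" where
  "csa_element G x \<longleftrightarrow>
    (\<forall>y \<in> carrier G. \<forall>z \<in> carrier G.
       x \<otimes>\<^bsub>G\<^esub> y = y \<otimes>\<^bsub>G\<^esub> x \<longrightarrow> x \<otimes>\<^bsub>G\<^esub> z = z \<otimes>\<^bsub>G\<^esub> x \<longrightarrow> y \<otimes>\<^bsub>G\<^esub> z = z \<otimes>\<^bsub>G\<^esub> y) \<and>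
    (\<forall>y \<in> carrier G. \<forall>x' \<in> carrier G.
       y \<otimes>\<^bsub>G\<^esub> x' = x \<otimes>\<^bsub>G\<^esub> y \<longrightarrow> x \<otimes>\<^bsub>G\<^esub> x' = x' \<otimes>\<^bsub>G\<^esub> x \<longrightarrow> x \<otimes>\<^bsub>G\<^esub> y = y \<otimes>\<^bsub>G\<^esub> x)"

lemma csa_elementI:
  assumes "\<And>y z. y \<in> carrier G \<Longrightarrow> z \<in> carrier G \<Longrightarrow> x \<otimes>\<^bsub>G\<^esub> y = y \<otimes>\<^bsub>G\<^esub> x \<Longrightarrow>
      x \<otimes>\<^bsub>G\<^esub> z = z \<otimes>\<^bsub>G\<^esub> x \<Longrightarrow> y \<otimes>\<^bsub>G\<^esub> z = z \<otimes>\<^bsub>G\<^esub> y"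
    and "\<And>y x'. y \<in> carrier G \<Longrightarrow> x' \<in> carrier G \<Longrightarrow> y \<otimes>\<^bsub>G\<^esub> x' = x \<otimes>\<^bsub>G\<^esub> y \<Longrightarrow>
      x \<otimes>\<^bsub>G\<^esub> x' = x' \<otimes>\<^bsub>G\<^esub> x \<Longrightarrow> x \<otimes>\<^bsub>G\<^esub> y = y \<otimes>\<^bsub>G\<^esub> x"
  shows "csa_element G x"
  using assms unfolding csa_element_def by blast

lemma csa_element_centralizer:
  assumes "csa_element G x" "y \<in> carrier G" "z \<in> carrier G"
    "x \<otimes>\<^bsub>G\<^esub> y = y \<otimes>\<^bsub>G\<^esub> x" "x \<otimes>\<^bsub>G\<^esub> z = z \<otimes>\<^bsub>G\<^esub> x"
  shows "y \<otimes>\<^bsub>G\<^esub> z = z \<otimes>\<^bsub>G\<^esub> y"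
  using assms unfolding csa_element_def by blast

lemma csa_element_conjugate:
  assumes "csa_element G x" "y \<in> carrier G" "x' \<in> carrier G"
    "y \<otimes>\<^bsub>G\<^esub> x' = x \<otimes>\<^bsub>G\<^esub> y" "x \<otimes>\<^bsub>G\<^esub> x' = x' \<otimes>\<^bsub>G\<^esub> x"
  shows "x \<otimes>\<^bsub>G\<^esub> y = y \<otimes>\<^bsub>G\<^esub> x"
  using assms unfolding csa_element_def by blast

lemma (in group) commutative_subgroup_iff:
  "commutative_subgroup H G \<longleftrightarrow> subgroup H G \<and> (\<forall>x \<in> H. \<forall>y \<in> H. x \<otimes> y = y \<otimes> x)"
proof
  assume "commutative_subgroup H G"
  then have H: "subgroup H G" "comm_group (G\<lparr>carrier := H\<rparr>)" by (auto simp: commutative_subgroup_def)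
  interpret H: comm_group "G\<lparr>carrier := H\<rparr>" by fact
  show "subgroup H G \<and> (\<forall>x \<in> H. \<forall>y \<in> H. x \<otimes> y = y \<otimes> x)"
    using H(1) H.m_comm by auto
next
  assume H: "subgroup H G \<and> (\<forall>x \<in> H. \<forall>y \<in> H. x \<otimes> y = y \<otimes> x)"
  interpret H: group "G\<lparr>carrier := H\<rparr>" using H subgroup_imp_group by blast
  show "commutative_subgroup H G"
    unfolding commutative_subgroup_def using H by (auto intro!: H.group_comm_groupI)
qed

lemma (in group) conj_eq_iff:
  assumes "x \<in> carrier G" "y \<in> carrier G" "z \<in> carrier G"
  shows "y \<otimes> z = x \<otimes> y \<longleftrightarrow> z = inv y \<otimes> x \<otimes> y"
  using assms inv_solve_left[of z y "x \<otimes> y"] by (auto simp: m_assoc)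

lemma (in group) mem_conjugate_set:
  assumes "H \<subseteq> carrier G" "s \<in> carrier G"
  shows "z \<in> conjugate_set G H s \<longleftrightarrow> z \<in> carrier G \<and> s \<otimes> z \<otimes> inv s \<in> H"
proof -
  have "z \<in> conjugate_set G H s \<longleftrightarrow> (\<exists>k\<in>H. z = inv s \<otimes> k \<otimes> s)"
    by (auto simp: conjugate_set_def l_coset_def r_coset_def)
  also have "\<dots> \<longleftrightarrow> z \<in> carrier G \<and> s \<otimes> z \<otimes> inv s \<in> H"
  proof -
    have "z = inv s \<otimes> k \<otimes> s \<longleftrightarrow> z \<in> carrier G \<and> s \<otimes> z \<otimes> inv s = k" if "k \<in> H" for k
    proof -
      have k: "k \<in> carrier G" using that assms by auto
      have "s \<otimes> z \<otimes> inv s = k \<longleftrightarrow> s \<otimes> z = k \<otimes> s" if "z \<in> carrier G"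
        using k that assms(2) inv_solve_right[of k "s \<otimes> z" s] by auto
      then show ?thesis using k assms(2) conj_eq_iff[of k s z] by (metis inv_closed m_closed)
    qed
    then show ?thesis by auto
  qed
  finally show ?thesis .
qed

lemma (in group) mult_commutes:
  assumes "x \<in> carrier G" "y \<in> carrier G" "z \<in> carrier G"
    and "x \<otimes> y = y \<otimes> x" "x \<otimes> z = z \<otimes> x"
  shows "x \<otimes> (y \<otimes> z) = (y \<otimes> z) \<otimes> x"
proof -
  have "x \<otimes> (y \<otimes> z) = y \<otimes> x \<otimes> z" using assms(1-4) by (simp add: m_assoc[symmetric])
  also have "\<dots> = (y \<otimes> z) \<otimes> x" using assms(1-3,5) by (simp add: m_assoc)
  finally show ?thesis .
qed

lemma (in group) inv_commutes:
  assumes "x \<in> carrier G" "y \<in> carrier G" "x \<otimes> y = y \<otimes> x"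
  shows "y \<otimes> inv x = inv x \<otimes> y"
proof -
  have "y = inv x \<otimes> (y \<otimes> x)" using assms inv_solve_left[of y x "y \<otimes> x"] by simp
  then have "y \<otimes> inv x = inv x \<otimes> (y \<otimes> x) \<otimes> inv x" by simp
  also have "\<dots> = inv x \<otimes> y" using assms by (simp add: m_assoc)
  finally show ?thesis .
qed

text \<open>Zorn's lemma is applied to sets of commuting elements instead of commutative subgroups: unions of
  chains then need no closure argument, and a maximal such set is a subgroup anyway.\<close>

lemma (in group) maximal_commutative_subgroup_exists:
  assumes "x \<in> carrier G" "y \<in> carrier G" "x \<otimes> y = y \<otimes> x"
  shows "\<exists>M. maximal_commutative_subgroup M G \<and> x \<in> M \<and> y \<in> M"
proof -
  define P where "P = {S. {x, y} \<subseteq> S \<and> S \<subseteq> carrier G \<and> (\<forall>a\<in>S. \<forall>b\<in>S. a \<otimes> b = b \<otimes> a)}"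
  have "\<exists>M\<in>P. \<forall>X\<in>P. M \<subseteq> X \<longrightarrow> X = M"
  proof (rule subset_Zorn_nonempty)
    show "P \<noteq> {}" using assms by (auto simp: P_def intro!: exI[of _ "{x, y}"])
    fix \<C> assume C: "\<C> \<noteq> {}" "subset.chain P \<C>"
    have CP: "S \<in> P" if "S \<in> \<C>" for S using C(2) that by (auto simp: subset_chain_def)
    have "a \<otimes> b = b \<otimes> a" if ab: "a \<in> \<Union>\<C>" "b \<in> \<Union>\<C>" for a b
    proof -
      obtain S T where ST: "a \<in> S" "S \<in> \<C>" "b \<in> T" "T \<in> \<C>" using ab by auto
      then have "S \<subseteq> T \<or> T \<subseteq> S" using C(2) by (auto simp: subset_chain_def)
      then show ?thesis using ST CP[of S] CP[of T] by (auto simp: P_def)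
    qed
    moreover have "{x, y} \<subseteq> \<Union>\<C>" using C(1) CP by (fastforce simp: P_def)
    moreover have "\<Union>\<C> \<subseteq> carrier G" using CP by (auto simp: P_def)
    ultimately show "\<Union>\<C> \<in> P" unfolding P_def by blast
  qed
  then obtain M where M: "M \<in> P" and max: "\<And>X. X \<in> P \<Longrightarrow> M \<subseteq> X \<Longrightarrow> X = M" by blast
  have Mc: "M \<subseteq> carrier G" and Mcomm: "\<And>a b. a \<in> M \<Longrightarrow> b \<in> M \<Longrightarrow> a \<otimes> b = b \<otimes> a"
    and xy: "x \<in> M" "y \<in> M" using M by (auto simp: P_def)
  \<comment> \<open>A maximal set of commuting elements is its own centralizer, hence a subgroup.\<close>
  have cent: "z \<in> M" if z: "z \<in> carrier G" "\<And>a. a \<in> M \<Longrightarrow> a \<otimes> z = z \<otimes> a" for z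
  proof -
    have "insert z M \<in> P" unfolding P_def using z Mc Mcomm xy by (auto simp: z(2)[symmetric])
    from max[OF this] show ?thesis by blast
  qed
  have sub: "subgroup M G"
  proof
    show "M \<subseteq> carrier G" by fact
    show "\<one> \<in> M" using Mc by (intro cent) auto
    fix a assume a: "a \<in> M"
    then have ac: "a \<in> carrier G" using Mc by auto
    { fix b assume b: "b \<in> M"
      show "a \<otimes> b \<in> M"
      proof (rule cent)
        show "a \<otimes> b \<in> carrier G" using a b Mc by auto
        fix c assume c: "c \<in> M"
        show "c \<otimes> (a \<otimes> b) = a \<otimes> b \<otimes> c"
          using mult_commutes[of c a b] Mcomm a b c Mc by blast
      qed }
    show "inv a \<in> M"
    proof (rule cent)
      show "inv a \<in> carrier G" using ac by simp
      fix c assume c: "c \<in> M"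
      then have "c \<in> carrier G" using Mc by auto
      then show "c \<otimes> inv a = inv a \<otimes> c"
        using inv_commutes[OF ac _ Mcomm[OF a c]] by simp
    qed
  qed
  have "maximal_commutative_subgroup M G"
    unfolding maximal_commutative_subgroup_def
  proof (intro conjI allI impI)
    show "commutative_subgroup M G" using sub Mcomm by (simp add: commutative_subgroup_iff)
    fix K assume K: "commutative_subgroup K G \<and> M \<subseteq> K"
    then have "K \<in> P" unfolding P_def using xy subgroup.subset[of K G]
      by (auto simp: commutative_subgroup_iff)
    then show "K = M" using max K by blast
  qed
  then show ?thesis using xy by blast
qed

text \<open>If \<open>x \<noteq> \<one>\<close> lies in a maximal commutative subgroup \<open>M\<close> and commutes with \<open>z\<close>, then \<open>x\<close> lies in \<open>M\<close> and in
  its conjugate by \<open>z\<close>, so malnormality puts \<open>z\<close> into \<open>M\<close>; the same argument works for a \<open>z\<close> that merely conjugates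
  \<open>x\<close> into \<open>M\<close>. Conversely, if \<open>y\<close> conjugates a nontrivial element of \<open>M\<close> to \<open>x \<in> M\<close>, these two commute,
  so \<open>y\<close> centralizes \<open>x\<close>, and the centralizer of \<open>x\<close> is \<open>M\<close>.\<close>

theorem (in group) csa_group_iff:
  "csa_group G \<longleftrightarrow> (\<forall>x \<in> carrier G - {\<one>}. csa_element G x)"
proof
  assume "csa_group G"
  then interpret csa_group G .
  show "\<forall>x \<in> carrier G - {\<one>}. csa_element G x"
  proof
    fix x assume "x \<in> carrier G - {\<one>}"
    then have x: "x \<in> carrier G" "x \<noteq> \<one>" by auto
    have mal: "y \<in> M" if M: "maximal_commutative_subgroup M G" and y: "y \<in> carrier G"
      and z: "z \<in> M" "z' \<in> M" "z' \<noteq> \<one>" "y \<otimes> z' = z \<otimes> y" for M y z z'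
    proof (rule ccontr)
      assume "y \<notin> M"
      have sub: "M \<subseteq> carrier G" using M
        by (auto simp: maximal_commutative_subgroup_def commutative_subgroup_iff dest: subgroup.subset)
      have "M \<inter> conjugate_set G M y = {\<one>}"
        using malnormal_if_maximal[OF M] y \<open>y \<notin> M\<close> by (auto simp: malnormal_def)
      moreover have "y \<otimes> z' \<otimes> inv y = z"
        using inv_solve_right[of z "y \<otimes> z'" y] z y sub by auto
      then have "z' \<in> conjugate_set G M y" using z y sub by (auto simp: mem_conjugate_set)
      ultimately show False using z by auto
    qed
    have comm: "y \<otimes> z = z \<otimes> y" if "maximal_commutative_subgroup M G" "y \<in> M" "z \<in> M" for M y z
      using that by (auto simp: maximal_commutative_subgroup_def commutative_subgroup_iff)
    show "csa_element G x"
    proof (rule csa_elementI)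
      fix y z assume yz: "y \<in> carrier G" "z \<in> carrier G" "x \<otimes> y = y \<otimes> x" "x \<otimes> z = z \<otimes> x"
      obtain M where M: "maximal_commutative_subgroup M G" "x \<in> M" "y \<in> M"
        using maximal_commutative_subgroup_exists[OF x(1) yz(1,3)] by blast
      have "z \<in> M" using mal[OF M(1) yz(2) M(2) M(2) x(2)] yz(4) by simp
      then show "y \<otimes> z = z \<otimes> y" using comm M by blast
    next
      fix y x' assume y: "y \<in> carrier G" "x' \<in> carrier G" "y \<otimes> x' = x \<otimes> y" "x \<otimes> x' = x' \<otimes> x"
      obtain M where M: "maximal_commutative_subgroup M G" "x \<in> M" "x' \<in> M"
        using maximal_commutative_subgroup_exists[OF x(1) y(2,4)] by blast
      have "x' \<noteq> \<one>" using x y r_cancel_one'[of y x] by auto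
      then have "y \<in> M" using mal[OF M(1) y(1) M(2,3)] y(3) by simp
      then show "x \<otimes> y = y \<otimes> x" using comm M by blast
    qed
  qed
next
  assume elt: "\<forall>x \<in> carrier G - {\<one>}. csa_element G x"
  show "csa_group G"
  proof
    fix M assume M: "maximal_commutative_subgroup M G"
    have sub: "subgroup M G" and comm: "\<And>y z. y \<in> M \<Longrightarrow> z \<in> M \<Longrightarrow> y \<otimes> z = z \<otimes> y"
      and max: "\<And>K. commutative_subgroup K G \<Longrightarrow> M \<subseteq> K \<Longrightarrow> K = M"
      using M by (auto simp: maximal_commutative_subgroup_def commutative_subgroup_iff)
    have Mc: "M \<subseteq> carrier G" using sub by (rule subgroup.subset)
    have "y \<in> M" if y: "y \<in> carrier G" and z: "z \<in> M" "z \<noteq> \<one>" "y \<otimes> z \<otimes> inv y \<in> M" for y z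
    proof -
      define x where "x = y \<otimes> z \<otimes> inv y"
      have zc: "z \<in> carrier G" using z Mc by auto
      then have x: "x \<in> carrier G" "y \<otimes> z = x \<otimes> y" using y by (auto simp: x_def m_assoc)
      have "x \<noteq> \<one>" using x y z zc l_cancel_one[of y z] by auto
      then have xe: "csa_element G x" using elt x by auto
      have xM: "x \<in> M" using z x_def by auto
      have xy: "x \<otimes> y = y \<otimes> x"
        using csa_element_conjugate[OF xe y zc] x(2) comm[OF xM z(1)] by blast
      \<comment> \<open>The centralizer of \<open>x\<close> is commutative and contains \<open>M\<close>, so it is \<open>M\<close> by maximality.\<close>
      define C where "C = {c \<in> carrier G. x \<otimes> c = c \<otimes> x}"
      have "commutative_subgroup C G"
        unfolding commutative_subgroup_iff
      proof (intro conjI ballI)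
        show "c \<otimes> d = d \<otimes> c" if "c \<in> C" "d \<in> C" for c d
          using csa_element_centralizer[OF xe] that by (auto simp: C_def)
        show "subgroup C G"
        proof
          show "C \<subseteq> carrier G" "\<one> \<in> C" using x by (auto simp: C_def)
          fix c assume c: "c \<in> C"
          { fix d assume d: "d \<in> C"
            show "c \<otimes> d \<in> C" using c d x mult_commutes[of x c d] unfolding C_def by auto }
          show "inv c \<in> C" using c x inv_commutes[of c x] unfolding C_def by auto
        qed
      qed
      moreover have "M \<subseteq> C" using comm[OF xM] Mc by (auto simp: C_def)
      ultimately have "C = M" by (rule max)
      then show "y \<in> M" using xy y by (auto simp: C_def)
    qed
    moreover have "\<one> \<in> M \<inter> conjugate_set G M y" if "y \<in> carrier G" for y
      using that sub subgroup.one_closed[OF sub] Mc by (auto simp: mem_conjugate_set)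
    ultimately have "M \<inter> conjugate_set G M y = {\<one>}" if "y \<in> carrier G - M" for y
      using that mem_conjugate_set[OF Mc, of y] by blast
    then show "malnormal M G"
      unfolding malnormal_def using sub by blast
  qed
qed

lemma (in group) csa_star_group_iff:
  "csa_star_group G \<longleftrightarrow>
    (\<forall>x \<in> carrier G - {\<one>}. csa_element G x \<and> x \<otimes> x \<noteq> \<one>)"
proof -
  have "ord x \<noteq> 2 \<longleftrightarrow> x \<otimes> x \<noteq> \<one> \<or> x = \<one>" if "x \<in> carrier G" for x
  proof
    assume "ord x \<noteq> 2"
    show "x \<otimes> x \<noteq> \<one> \<or> x = \<one>"
    proof (rule ccontr)
      assume "\<not> (x \<otimes> x \<noteq> \<one> \<or> x = \<one>)"
      then have "x [^] (2::nat) = \<one>" "x \<noteq> \<one>" using that by (auto simp: numeral_2_eq_2)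
      then have "ord x dvd 2" using that by (simp add: pow_eq_id)
      moreover have "ord x \<noteq> 1" using \<open>x \<noteq> \<one>\<close> that ord_eq_1 by auto
      ultimately show False using \<open>ord x \<noteq> 2\<close>
        by (metis One_nat_def Suc_1 dvd_imp_le dvd_0_left_iff le_SucE le_zero_eq zero_less_Suc n_not_Suc_n)
    qed
  next
    assume "x \<otimes> x \<noteq> \<one> \<or> x = \<one>"
    moreover have "x [^] ord x = \<one>" using that by (rule pow_ord_eq_1)
    moreover have "x [^] (2::nat) = x \<otimes> x" using that by (simp add: numeral_2_eq_2)
    ultimately show "ord x \<noteq> 2" using ord_id by auto
  qed
  then show ?thesis
    unfolding csa_star_group_def csa_star_group_axioms_def csa_group_iff by auto
qed

text \<open>The property is a universal statement about equations, so it descends to subgroups.\<close>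

lemma (in group) csa_element_of_hom:
  assumes "group H" "f \<in> hom G H" "inj_on f (carrier G)" "x \<in> carrier G" "csa_element H (f x)"
  shows "csa_element G x"
proof -
  have fm: "f (a \<otimes> b) = f a \<otimes>\<^bsub>H\<^esub> f b" "f a \<in> carrier H" if "a \<in> carrier G" "b \<in> carrier G" for a b
    using assms(2) that by (auto simp: hom_def)
  have eq: "f a \<otimes>\<^bsub>H\<^esub> f b = f c \<otimes>\<^bsub>H\<^esub> f e \<longleftrightarrow> a \<otimes> b = c \<otimes> e"
    if "a \<in> carrier G" "b \<in> carrier G" "c \<in> carrier G" "e \<in> carrier G" for a b c e
    using fm(1)[OF that(1,2)] fm(1)[OF that(3,4)] inj_onD[OF assms(3), of "a \<otimes> b" "c \<otimes> e"] that by auto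
  show ?thesis
  proof (rule csa_elementI)
    fix y z assume "y \<in> carrier G" "z \<in> carrier G" "x \<otimes> y = y \<otimes> x" "x \<otimes> z = z \<otimes> x"
    then show "y \<otimes> z = z \<otimes> y"
      using csa_element_centralizer[OF assms(5), of "f y" "f z"] eq fm(2) assms(4) by simp
  next
    fix y x' assume "y \<in> carrier G" "x' \<in> carrier G" "y \<otimes> x' = x \<otimes> y" "x \<otimes> x' = x' \<otimes> x"
    then show "x \<otimes> y = y \<otimes> x"
      using csa_element_conjugate[OF assms(5), of "f y" "f x'"] eq fm(2) assms(4) by simp
  qed
qed

definition (in group) conj_by :: "'a \<Rightarrow> 'a \<Rightarrow> 'a" where
  "conj_by w x = inv w \<otimes> x \<otimes> w"

lemma (in group) conj_by_closed [simp]: "\<lbrakk>w \<in> carrier G; x \<in> carrier G\<rbrakk> \<Longrightarrow> conj_by w x \<in> carrier G"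
  by (simp add: conj_by_def)

lemma (in group) inv_cancel_left:
  assumes "w \<in> carrier G" "x \<in> carrier G"
  shows "w \<otimes> (inv w \<otimes> x) = x" "inv w \<otimes> (w \<otimes> x) = x"
  using assms by (simp_all add: m_assoc[symmetric])

lemma (in group) conj_by_inv:
  "\<lbrakk>w \<in> carrier G; x \<in> carrier G\<rbrakk> \<Longrightarrow> conj_by (inv w) (conj_by w x) = x"
  by (simp add: conj_by_def m_assoc inv_cancel_left)

lemma (in group) conj_by_mult:
  "\<lbrakk>w \<in> carrier G; x \<in> carrier G; y \<in> carrier G\<rbrakk>
    \<Longrightarrow> conj_by w (x \<otimes> y) = conj_by w x \<otimes> conj_by w y"
  by (simp add: conj_by_def m_assoc inv_cancel_left)

lemma (in group) conj_by_eq_iff: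
  assumes "w \<in> carrier G" "x \<in> carrier G" "y \<in> carrier G"
  shows "conj_by w x = conj_by w y \<longleftrightarrow> x = y"
  using assms conj_by_inv by metis

lemma (in group) conj_by_one_iff:
  assumes "w \<in> carrier G" "x \<in> carrier G"
  shows "conj_by w x = \<one> \<longleftrightarrow> x = \<one>"
  using conj_by_eq_iff[of w x \<one>] assms by (simp add: conj_by_def)

lemma (in group) csa_element_conj_by:
  assumes "w \<in> carrier G" "x \<in> carrier G" "csa_element G (conj_by w x)"
  shows "csa_element G x"
proof (rule csa_element_of_hom[where H = G and f = "conj_by w"])
  show "conj_by w \<in> hom G G" using assms(1) by (auto simp: hom_def conj_by_mult)
  show "inj_on (conj_by w) (carrier G)" using assms(1) conj_by_eq_iff by (auto intro: inj_onI)
qed (use assms is_group in auto)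

section \<open>Groups acting on trees\<close>

text \<open>The vertices of a tree with their path metric \<open>d\<close>, described by metric axioms only: the four-point
  condition (hyperbolicity with constant zero) excludes cycles, and \<open>dist_step\<close> provides the edges. A
  height function with values of opposite parity at adjacent vertices, on which every group element acts
  by a shift, guarantees that no element swaps the ends of an edge.\<close>

locale graded_tree_action = group \<Gamma> for \<Gamma> (structure) +
  fixes V :: "'v set"
    and act :: "'a \<Rightarrow> 'v \<Rightarrow> 'v"
    and d :: "'v \<Rightarrow> 'v \<Rightarrow> int"
    and h :: "'v \<Rightarrow> int"
  assumes nonempty: "V \<noteq> {}"
    and act_closed: "\<lbrakk>g \<in> carrier \<Gamma>; v \<in> V\<rbrakk> \<Longrightarrow> act g v \<in> V"
    and act_one: "v \<in> V \<Longrightarrow> act \<one> v = v"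
    and act_mult: "\<lbrakk>g \<in> carrier \<Gamma>; k \<in> carrier \<Gamma>; v \<in> V\<rbrakk> \<Longrightarrow> act (g \<otimes> k) v = act g (act k v)"
    and dist_eq_0: "\<lbrakk>u \<in> V; v \<in> V\<rbrakk> \<Longrightarrow> d u v = 0 \<longleftrightarrow> u = v"
    and dist_sym: "\<lbrakk>u \<in> V; v \<in> V\<rbrakk> \<Longrightarrow> d u v = d v u"
    and four_point: "\<lbrakk>u \<in> V; v \<in> V; w \<in> V; x \<in> V\<rbrakk>
      \<Longrightarrow> d u v + d w x \<le> max (d u w + d v x) (d u x + d v w)"
    and dist_step: "\<lbrakk>u \<in> V; v \<in> V; u \<noteq> v\<rbrakk> \<Longrightarrow> \<exists>w\<in>V. d u w = 1 \<and> d w v = d u v - 1"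
    and dist_act: "\<lbrakk>g \<in> carrier \<Gamma>; u \<in> V; v \<in> V\<rbrakk> \<Longrightarrow> d (act g u) (act g v) = d u v"
    and parity: "\<lbrakk>u \<in> V; v \<in> V\<rbrakk> \<Longrightarrow> even (d u v - (h u - h v))"
    and height_act: "\<lbrakk>g \<in> carrier \<Gamma>; u \<in> V; v \<in> V\<rbrakk> \<Longrightarrow> h (act g u) - h u = h (act g v) - h v"
begin

lemma dist_self [simp]: "v \<in> V \<Longrightarrow> d v v = 0"
  using dist_eq_0 by blast

lemma dist_nonneg: "\<lbrakk>u \<in> V; v \<in> V\<rbrakk> \<Longrightarrow> d u v \<ge> 0"
  using four_point[of u u v v] by simp

lemma dist_triangle: "\<lbrakk>u \<in> V; v \<in> V; w \<in> V\<rbrakk> \<Longrightarrow> d u w \<le> d u v + d v w"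
  using four_point[of u w v v] dist_sym[of v w] by simp

lemma act_inv_cancel:
  assumes "g \<in> carrier \<Gamma>" "v \<in> V"
  shows "act (inv g) (act g v) = v" "act g (act (inv g) v) = v"
  using assms act_mult[of "inv g" g v] act_mult[of g "inv g" v] act_one by simp_all

lemma act_inj: "\<lbrakk>g \<in> carrier \<Gamma>; u \<in> V; v \<in> V; act g u = act g v\<rbrakk> \<Longrightarrow> u = v"
  using act_inv_cancel(1) by metis

lemma between_unique:
  assumes "a \<in> V" "b \<in> V" "m \<in> V" "m' \<in> V"
    and "d a m + d m b = d a b" "d a m' + d m' b = d a b" "d a m = d a m'"
  shows "m = m'"
proof -
  have "d a b + d m m' \<le> d a b"
    using four_point[of a b m m'] dist_sym[of b m] dist_sym[of b m'] assms by simp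
  then have "d m m' = 0" using dist_nonneg[of m m'] assms by simp
  then show ?thesis using assms dist_eq_0 by blast
qed

lemma fixes_between:
  assumes "g \<in> carrier \<Gamma>" "a \<in> V" "b \<in> V" "m \<in> V" "d a m + d m b = d a b"
    and "act g a = a" "act g b = b"
  shows "act g m = m"
proof (rule between_unique)
  have "d (act g a) (act g m) = d a m" "d (act g m) (act g b) = d m b"
    using assms dist_act[of g a m] dist_act[of g m b] by auto
  then show "d a (act g m) + d (act g m) b = d a b" "d a (act g m) = d a m"
    using assms by auto
qed (use assms act_closed in auto)

text \<open>Three consecutive vertices without backtracking prolong every geodesic that ends with the first
  two of them, since the four-point condition leaves no room for a shortcut.\<close>

lemma geodesic_extend:
  assumes "a \<in> V" "p \<in> V" "m \<in> V" "q \<in> V" "d p m = 1" "d m q = 1" "d p q = 2"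
    and "d a m = d a p + 1"
  shows "d a q = d a m + 1"
proof -
  have "d a m + d p q \<le> max (d a p + d m q) (d a q + d m p)"
    using four_point[of a m p q] assms by simp
  then have "d a q \<ge> d a m + 1" using assms dist_sym[of m p] by auto
  moreover have "d a q \<le> d a m + 1" using dist_triangle[of a m q] assms by simp
  ultimately show ?thesis by simp
qed

text \<open>The point \<open>m\<close> separates \<open>a'\<close> from \<open>b'\<close>. Points closer to \<open>a'\<close> and \<open>b'\<close> than \<open>m\<close> is stay in the
  respective components, so \<open>m\<close> separates them as well.\<close>

lemma between_stable:
  assumes V: "a \<in> V" "a' \<in> V" "b \<in> V" "b' \<in> V" "m \<in> V"
    and m: "d a' m + d m b' = d a' b'" and near: "d a a' < d a' m" "d b b' < d m b'"
  shows "d a m + d m b = d a b"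
proof -
  note sym = dist_sym[of a a'] dist_sym[of b b'] dist_sym[of m a] dist_sym[of m b] dist_sym[of m a']
    dist_sym[of m b'] dist_sym[of b a'] dist_sym[of b' a'] dist_sym[of a b] dist_sym[of a b']
  have nn: "d a m \<ge> 0" "d m b \<ge> 0" using dist_nonneg V by auto
  have 1: "d a' b' + d a m \<le> max (d a a' + d m b') (d a' m + d a b')"
    using four_point[of a' b' a m] sym V by (simp add: algebra_simps)
  then have "d a m + d m b' \<le> d a b'" using m near nn by linarith
  moreover have "d a b' \<le> d a m + d m b'" using dist_triangle V by blast
  ultimately have 2: "d a b' = d a m + d m b'" by simp
  have "d a b' + d b m \<le> max (d a b + d m b') (d a m + d b b')"
    using four_point[of a b' b m] sym V by (simp add: algebra_simps)
  then have "d a m + d m b \<le> d a b" using 2 near nn sym V by (simp add: max_def split: if_splits)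
  moreover have "d a b \<le> d a m + d m b" using dist_triangle V by blast
  ultimately show ?thesis by simp
qed

text \<open>A swap would shift the height by some \<open>c\<close> and by \<open>-c\<close>, so the two heights agree.\<close>

lemma no_inversion:
  assumes "g \<in> carrier \<Gamma>" "u \<in> V" "v \<in> V" "act g u = v" "act g v = u"
  shows "even (d u v)"
proof -
  have "h v - h u = h u - h v" "even (d u v - (h u - h v))"
    using height_act[of g u v] parity[of u v] assms by simp_all
  then show ?thesis by presburger
qed

definition geodesic_line :: "(int \<Rightarrow> 'v) \<Rightarrow> bool" where
  "geodesic_line \<gamma> \<longleftrightarrow> (\<forall>i. \<gamma> i \<in> V) \<and> (\<forall>i j. d (\<gamma> i) (\<gamma> j) = \<bar>i - j\<bar>)"

lemma geodesic_line_in: "geodesic_line \<gamma> \<Longrightarrow> \<gamma> i \<in> V"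
  and geodesic_line_dist: "geodesic_line \<gamma> \<Longrightarrow> d (\<gamma> i) (\<gamma> j) = \<bar>i - j\<bar>"
  by (auto simp: geodesic_line_def)

lemma geodesic_line_inj: "geodesic_line \<gamma> \<Longrightarrow> \<gamma> i = \<gamma> j \<longleftrightarrow> i = j"
  using dist_eq_0[of "\<gamma> i" "\<gamma> j"] by (auto simp: geodesic_line_def)

lemma geodesic_line_if_local:
  assumes V: "\<And>i. \<gamma> i \<in> V" and 1: "\<And>i. d (\<gamma> i) (\<gamma> (i + 1)) = 1" and 2: "\<And>i. d (\<gamma> i) (\<gamma> (i + 2)) = 2"
  shows "geodesic_line \<gamma>"
proof -
  have n: "d (\<gamma> i) (\<gamma> (i + int n)) = int n \<and> d (\<gamma> i) (\<gamma> (i + int n + 1)) = int n + 1" for i n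
  proof (induction n)
    case 0
    then show ?case using 1[of i] V by simp
  next
    case (Suc n)
    have "d (\<gamma> i) (\<gamma> (i + int n + 2)) = d (\<gamma> i) (\<gamma> (i + int n + 1)) + 1"
      by (rule geodesic_extend[where p = "\<gamma> (i + int n)"])
        (use V 1[of "i + int n"] 1[of "i + int n + 1"] 2[of "i + int n"] Suc.IH
          in \<open>simp_all add: add.assoc\<close>)
    then show ?case using Suc.IH by (simp add: algebra_simps)
  qed
  have le: "d (\<gamma> i) (\<gamma> j) = \<bar>i - j\<bar>" if "i \<le> j" for i j
    using n[of i "nat (j - i)"] that by simp
  have "d (\<gamma> i) (\<gamma> j) = \<bar>i - j\<bar>" for i j
    using le[of i j] le[of j i] dist_sym[OF V V, of i j] by (cases "i \<le> j") auto
  then show ?thesis using V by (simp add: geodesic_line_def)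
qed

lemma geodesic_exists:
  assumes "u \<in> V" "v \<in> V"
  shows "\<exists>p. p 0 = u \<and> p (d u v) = v \<and> (\<forall>i\<in>{0..d u v}. p i \<in> V) \<and>
    (\<forall>i\<in>{0..d u v}. \<forall>j\<in>{0..d u v}. d (p i) (p j) = \<bar>i - j\<bar>)"
  using assms
proof (induction "nat (d u v)" arbitrary: u)
  case 0
  then have "u = v" using dist_nonneg[of u v] dist_eq_0[of u v] by simp
  then show ?case using 0 by (intro exI[of _ "\<lambda>_. u"]) auto
next
  case (Suc n)
  define N where "N = d u v"
  have N: "N = int n + 1" using Suc(2) by (simp add: N_def)
  then have "u \<noteq> v" using Suc(3) by (auto simp: N_def)
  then obtain w where w: "w \<in> V" "d u w = 1" "d w v = N - 1"
    using dist_step Suc(3,4) N_def by blast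
  have "n = nat (d w v)" using w N by simp
  from Suc(1)[OF this w(1) Suc(4)] obtain p where p: "p 0 = w" "p (N - 1) = v"
    "\<And>i. i \<in> {0..N - 1} \<Longrightarrow> p i \<in> V"
    "\<And>i j. i \<in> {0..N - 1} \<Longrightarrow> j \<in> {0..N - 1} \<Longrightarrow> d (p i) (p j) = \<bar>i - j\<bar>"
    unfolding w(3) by blast
  have du: "d u (p j) = j + 1" if j: "j \<in> {0..N - 1}" for j
  proof -
    have "d u (p j) \<le> 1 + j" using dist_triangle[of u w "p j"] p(1) p(4)[of 0 j] p(3)[OF j] j w Suc(3) by simp
    moreover have "d u v \<le> d u (p j) + d (p j) v" using dist_triangle p(3)[OF j] Suc(3,4) by blast
    moreover have "d (p j) v = N - 1 - j" using p(4)[of j "N - 1"] p(2) j by auto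
    ultimately show ?thesis using N_def by simp
  qed
  let ?q = "\<lambda>i. if i = 0 then u else p (i - 1)"
  have "d (?q i) (?q j) = \<bar>i - j\<bar>" if "i \<in> {0..N}" "j \<in> {0..N}" for i j
  proof -
    have s: "d (p k) u = d u (p k)" if "k \<in> {0..N - 1}" for k
      using dist_sym Suc(3) p(3)[OF that] by blast
    show ?thesis
      using that du[of "j - 1"] du[of "i - 1"] s[of "i - 1"] p(4)[of "i - 1" "j - 1"] Suc(3) by auto
  qed
  moreover have "?q i \<in> V" if "i \<in> {0..N}" for i using that p(3)[of "i - 1"] Suc(3) by auto
  moreover have "?q N = v" using p(2) N by auto
  ultimately show ?case unfolding N_def[symmetric] by (intro exI[of _ ?q]) auto
qed

text \<open>The axis of an element without fixed vertices: a vertex with least displacement, its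
  geodesic to its image, and the translates of this geodesic.  A backtracking at a junction would
  yield a smaller displacement or an inverted edge.\<close>

lemma axis_exists:
  assumes g: "g \<in> carrier \<Gamma>" and hyp: "\<And>v. v \<in> V \<Longrightarrow> act g v \<noteq> v"
  shows "\<exists>\<gamma> l. geodesic_line \<gamma> \<and> 0 < l \<and> (\<forall>i. act g (\<gamma> i) = \<gamma> (i + l))"
proof -
  define disp where "disp v = nat (d v (act g v))" for v
  obtain v where v: "v \<in> V" and min: "\<And>w. w \<in> V \<Longrightarrow> disp v \<le> disp w"
    using nonempty ex_has_least_nat[of "\<lambda>v. v \<in> V" _ disp] by blast
  define l where "l = d v (act g v)"
  have gv: "act g v \<in> V" using act_closed g v by blast
  have l: "l > 0" using hyp[OF v] dist_nonneg[OF v gv] dist_eq_0[OF v gv] by (simp add: l_def)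
  have minl: "d w (act g w) \<ge> l" if "w \<in> V" for w
    using min[OF that] dist_nonneg[OF that act_closed[OF g that]] dist_nonneg[OF v gv]
    by (simp add: disp_def l_def)
  obtain p where p: "p 0 = v" "p l = act g v" "\<And>i. i \<in> {0..l} \<Longrightarrow> p i \<in> V"
    "\<And>i j. i \<in> {0..l} \<Longrightarrow> j \<in> {0..l} \<Longrightarrow> d (p i) (p j) = \<bar>i - j\<bar>"
    using geodesic_exists[OF v gv] unfolding l_def by blast
  define \<gamma> where "\<gamma> i = act (g [^] (i div l)) (p (i mod l))" for i
  have pow: "g [^] (k::int) \<in> carrier \<Gamma>" for k using g by simp
  have pm: "p (i mod l) \<in> V" for i
    using p(3)[of "i mod l"] pos_mod_bound[OF l, of i] pos_mod_sign[OF l, of i] by simp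
  have V: "\<gamma> i \<in> V" for i unfolding \<gamma>_def using act_closed pow pm by blast
  have shift: "act g (\<gamma> i) = \<gamma> (i + l)" for i
  proof -
    have "g [^] (1 + i div l) = g \<otimes> g [^] (i div l)" using int_pow_mult[OF g, of 1] g by simp
    then show ?thesis unfolding \<gamma>_def using act_mult[OF g pow pm] l by (simp add: add.commute)
  qed
  have start: "\<gamma> i = p i" if "i \<in> {0..l}" for i
  proof (cases "i = l")
    case True
    then show ?thesis using l p(1,2) g by (simp add: \<gamma>_def)
  next
    case False
    then have "i div l = 0" "i mod l = i" using that l by auto
    then show ?thesis using that by (simp add: \<gamma>_def act_one[OF p(3)])
  qed
  have shiftd: "d (\<gamma> (i + l)) (\<gamma> (j + l)) = d (\<gamma> i) (\<gamma> j)" for i j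
    using dist_act[OF g V V] by (simp add: shift)
  have shiftn: "d (\<gamma> (i + int n * l)) (\<gamma> (j + int n * l)) = d (\<gamma> i) (\<gamma> j)" for i j n
  proof (induction n)
    case (Suc n)
    then show ?case using shiftd[of "i + int n * l" "j + int n * l"] by (simp add: algebra_simps)
  qed simp
  have shiftz: "d (\<gamma> (i + k * l)) (\<gamma> (j + k * l)) = d (\<gamma> i) (\<gamma> j)" for i j k
    using shiftn[of i "nat k" j] shiftn[of "i + k * l" "nat (- k)" "j + k * l"]
    by (cases "k \<ge> 0") (simp_all add: algebra_simps)
  have red: "d (\<gamma> i) (\<gamma> (i + c)) = d (\<gamma> (i mod l)) (\<gamma> (i mod l + c))" for i c
    using shiftz[of "i mod l" "i div l" "i mod l + c"] by (simp add: algebra_simps)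
  have one: "d (\<gamma> i) (\<gamma> (i + 1)) = 1" if "i \<in> {0..<l}" for i
    using that start[of i] start[of "i + 1"] p(4)[of i "i + 1"] by simp
  have 1: "d (\<gamma> i) (\<gamma> (i + 1)) = 1" for i
    using one[of "i mod l"] l by (simp add: red[of i 1])
  have two: "d (\<gamma> i) (\<gamma> (i + 2)) = 2" if i: "i \<in> {0..<l}" for i
  proof (cases "i + 2 \<le> l")
    case True
    then show ?thesis using i start[of i] start[of "i + 2"] p(4)[of i "i + 2"] by simp
  next
    case False
    then have i: "i = l - 1" using i by simp
    \<comment> \<open>The junction of the geodesic with its translate.\<close>
    have "d (\<gamma> i) (\<gamma> (i + 2)) \<le> 2"
      using dist_triangle[OF V V V, of i "i + 2" "i + 1"] 1[of i] 1[of "i + 1"] by (simp add: add.assoc)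
    moreover have "even (d (\<gamma> i) (\<gamma> (i + 2)))"
      using parity[OF V V, of i "i + 1"] parity[OF V V, of "i + 1" "i + 2"]
        parity[OF V V, of i "i + 2"] 1[of i] 1[of "i + 1"] by (simp add: add.assoc)
    moreover have "\<gamma> i \<noteq> \<gamma> (i + 2)"
    proof
      assume eq: "\<gamma> i = \<gamma> (i + 2)"
      show False
      proof (cases "l = 1")
        case True
        then have "act g (\<gamma> 0) = \<gamma> 1" "act g (\<gamma> 1) = \<gamma> 0"
          using shift[of 0] shift[of 1] eq i by simp_all
        then have "even (d (\<gamma> 0) (\<gamma> 1))" using no_inversion[OF g V V] by blast
        then show False using 1[of 0] by simp
      next
        case False
        have "act g (\<gamma> 1) = \<gamma> (l - 1)" using shift[of 1] eq i by (simp add: add.commute)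
        moreover have "d (\<gamma> 1) (\<gamma> (l - 1)) = l - 2"
          using start[of 1] start[of "l - 1"] p(4)[of 1 "l - 1"] False l by simp
        ultimately show False using minl[OF V, of 1] by simp
      qed
    qed
    then have "d (\<gamma> i) (\<gamma> (i + 2)) \<noteq> 0" using dist_eq_0[OF V V] by blast
    ultimately show ?thesis using dist_nonneg[OF V V, of i "i + 2"] by presburger
  qed
  have 2: "d (\<gamma> i) (\<gamma> (i + 2)) = 2" for i
    using two[of "i mod l"] l by (simp add: red[of i 2])
  show ?thesis using geodesic_line_if_local[OF V 1 2] l shift by blast
qed

lemma translation_power:
  assumes "g \<in> carrier \<Gamma>" "\<And>i. act g (\<gamma> i) = \<gamma> (i + l)" "\<And>i. \<gamma> i \<in> V"
  shows "act (g [^] n) (\<gamma> i) = \<gamma> (i + int n * l)"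
proof (induction n arbitrary: i)
  case 0
  then show ?case using assms act_one by simp
next
  case (Suc n)
  then show ?case using assms act_mult[of "g [^] n" g "\<gamma> i"] by (simp add: algebra_simps)
qed

text \<open>Two axes of one element stay at bounded distance, so a long segment of one of them has its
  middle on the other.\<close>

lemma axis_range_mono:
  assumes g: "g \<in> carrier \<Gamma>"
    and \<gamma>: "geodesic_line \<gamma>" "\<And>i. act g (\<gamma> i) = \<gamma> (i + l)"
    and \<gamma>': "geodesic_line \<gamma>'" "0 < l'" "\<And>i. act g (\<gamma>' i) = \<gamma>' (i + l')"
  shows "range \<gamma>' \<subseteq> range \<gamma>"
proof safe
  fix j
  note V = geodesic_line_in[OF \<gamma>(1)] and V' = geodesic_line_in[OF \<gamma>'(1)]
  define D where "D = d (\<gamma> 0) (\<gamma>' 0)"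
  have D: "D \<ge> 0" using dist_nonneg V V' by (simp add: D_def)
  define n where "n = nat (D + \<bar>j\<bar> + 1)"
  have n: "int n * l' \<ge> D + \<bar>j\<bar> + 1" using \<gamma>'(2) D mult_left_mono[of 1 l' "int n"] by (simp add: n_def)
  have pow: "g [^] n \<in> carrier \<Gamma>" using g by simp
  have p: "act (g [^] n) (\<gamma> i) = \<gamma> (i + int n * l)" for i
    by (rule translation_power[of g \<gamma>]) (use g \<gamma> V in auto)
  have p': "act (g [^] n) (\<gamma>' i) = \<gamma>' (i + int n * l')" for i
    by (rule translation_power[of g \<gamma>']) (use g \<gamma>' V' in auto)
  let ?a = "\<gamma> (- (int n * l))" and ?b = "\<gamma> (int n * l)"
  let ?a' = "\<gamma>' (- (int n * l'))" and ?b' = "\<gamma>' (int n * l')"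
  have "d (act (g [^] n) ?a) (act (g [^] n) ?a') = D" using p[of "- (int n * l)"] p'[of "- (int n * l')"] by (simp add: D_def)
  then have a: "d ?a ?a' = D" using dist_act[OF pow V V'] by simp
  have b: "d ?b ?b' = D" using dist_act[OF pow V V', of 0 0] p[of 0] p'[of 0] by (simp add: D_def)
  have btw: "d ?a (\<gamma>' j) + d (\<gamma>' j) ?b = d ?a ?b"
  proof (rule between_stable[OF V V' V V' V'])
    show "d ?a' (\<gamma>' j) + d (\<gamma>' j) ?b' = d ?a' ?b'"
      "d ?a ?a' < d ?a' (\<gamma>' j)" "d ?b ?b' < d (\<gamma>' j) ?b'"
      unfolding geodesic_line_dist[OF \<gamma>'(1)] a b using n D by linarith+
  qed
  define k where "k = d ?a (\<gamma>' j)"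
  have k: "0 \<le> k" "k \<le> d ?a ?b" using btw
    dist_nonneg[OF V V', of "- (int n * l)" j] dist_nonneg[OF V' V, of j "int n * l"]
    unfolding k_def by linarith+
  have "\<exists>i. d ?a (\<gamma> i) = k \<and> d (\<gamma> i) ?b = d ?a ?b - k"
  proof (cases "l \<ge> 0")
    case True
    then show ?thesis using k by (intro exI[of _ "k - int n * l"]) (simp add: geodesic_line_dist[OF \<gamma>(1)])
  next
    case False
    then have "int n * l \<le> 0" by (simp add: mult_le_0_iff)
    then show ?thesis using k unfolding geodesic_line_dist[OF \<gamma>(1)]
      by (intro exI[of _ "- k - int n * l"] conjI) linarith+
  qed
  then obtain i where i: "d ?a (\<gamma> i) = k" "d (\<gamma> i) ?b = d ?a ?b - k" by blast
  have "\<gamma>' j = \<gamma> i"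
    by (rule between_unique[of ?a ?b]) (use V V' i btw k_def in auto)
  then show "\<gamma>' j \<in> range \<gamma>" by blast
qed

lemma line_isometry:
  assumes "y \<in> carrier \<Gamma>" "geodesic_line \<gamma>" "act y ` range \<gamma> \<subseteq> range \<gamma>"
  shows "\<exists>c. (\<forall>i. act y (\<gamma> i) = \<gamma> (c + i)) \<or> (\<forall>i. act y (\<gamma> i) = \<gamma> (c - i))"
proof -
  have "\<exists>j. act y (\<gamma> i) = \<gamma> j" for i using assms(3) by blast
  then obtain f where f: "\<And>i. act y (\<gamma> i) = \<gamma> (f i)" by metis
  have ab: "\<bar>f i - f j\<bar> = \<bar>i - j\<bar>" for i j
    using dist_act[OF assms(1), of "\<gamma> i" "\<gamma> j"] assms(2) f by (simp add: geodesic_line_def)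
  show ?thesis
  proof (cases "f 1 = f 0 + 1")
    case True
    have "f i = f 0 + i" for i using ab[of i 0] ab[of i 1] True by arith
    then show ?thesis using f by metis
  next
    case False
    then have "f 1 = f 0 - 1" using ab[of 1 0] by arith
    then have "f i = f 0 - i" for i using ab[of i 0] ab[of i 1] by arith
    then show ?thesis using f by metis
  qed
qed

text \<open>The centre of a reflection cannot be the midpoint of an edge, since edges are not inverted.\<close>

lemma reflection_fixes:
  assumes "y \<in> carrier \<Gamma>" "geodesic_line \<gamma>" "\<And>i. act y (\<gamma> i) = \<gamma> (c - i)"
  shows "\<exists>i. act y (\<gamma> i) = \<gamma> i"
proof (cases "even c")
  case True
  then have eq: "c - c div 2 = c div 2" by presburger
  have "act y (\<gamma> (c div 2)) = \<gamma> (c div 2)" using assms(3)[of "c div 2"] unfolding eq .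
  then show ?thesis by blast
next
  case False
  then have eq: "c - c div 2 = c div 2 + 1" "c - (c div 2 + 1) = c div 2" by presburger+
  have "even (d (\<gamma> (c div 2)) (\<gamma> (c div 2 + 1)))"
    using no_inversion[OF assms(1)] geodesic_line_in[OF assms(2)] assms(3)[of "c div 2"]
      assms(3)[of "c div 2 + 1"] unfolding eq by blast
  then show ?thesis using assms(2) by (simp add: geodesic_line_def)
qed

end

lemma (in graded_tree_action) conj_by_fixes_iff:
  assumes "w \<in> carrier \<Gamma>" "x \<in> carrier \<Gamma>" "v \<in> V"
  shows "act (conj_by w x) v = v \<longleftrightarrow> act x (act w v) = act w v"
proof -
  have wv: "act w v \<in> V" "act x (act w v) \<in> V" using assms act_closed by auto
  have "act (conj_by w x) v = act (inv w) (act x (act w v))"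
    using assms wv act_mult[of "inv w \<otimes> x" w v] act_mult[of "inv w" x "act w v"] by (simp add: conj_by_def)
  then show ?thesis using act_inv_cancel assms wv by metis
qed

lemma (in graded_tree_action) commuting_fixes:
  assumes "x \<in> carrier \<Gamma>" "y \<in> carrier \<Gamma>" "x' \<in> carrier \<Gamma>" "y \<otimes> x' = x \<otimes> y" "v \<in> V"
  shows "act x (act y v) = act y v \<longleftrightarrow> act x' v = v"
  using act_mult[OF assms(2,3,5)] act_mult[OF assms(1,2,5)] act_inj[OF assms(2) _ assms(5), of "act x' v"]
    act_closed[OF assms(3,5)] assms(4) by metis

text \<open>The hypotheses speak of elements with a fixed vertex and of edge stabilizers only; the other elements
  inherit the CSA property from them.\<close>

locale csa_tree_action = graded_tree_action +
  assumes edge_comm: "\<lbrakk>u \<in> V; v \<in> V; d u v = 1; g \<in> carrier \<Gamma>; k \<in> carrier \<Gamma>;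
      act g u = u; act g v = v; act k u = u; act k v = v\<rbrakk> \<Longrightarrow> g \<otimes> k = k \<otimes> g"
    and elliptic_csa: "\<lbrakk>g \<in> carrier \<Gamma>; g \<noteq> \<one>; v \<in> V; act g v = v\<rbrakk> \<Longrightarrow> csa_element \<Gamma> g"
    and elliptic_square: "\<lbrakk>g \<in> carrier \<Gamma>; g \<noteq> \<one>; v \<in> V; act g v = v\<rbrakk> \<Longrightarrow> g \<otimes> g \<noteq> \<one>"
begin

text \<open>The conjugate of \<open>k\<close> by \<open>y\<close> fixes the line as well. Hence it shares an edge stabilizer with \<open>k\<close> and
  commutes with it, and \<open>k\<close> has the CSA property.\<close>

lemma line_fixer_commutes:
  assumes \<gamma>: "geodesic_line \<gamma>" and k: "k \<in> carrier \<Gamma>" "k \<noteq> \<one>" "\<And>i. act k (\<gamma> i) = \<gamma> i"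
    and y: "y \<in> carrier \<Gamma>" "act y ` range \<gamma> \<subseteq> range \<gamma>"
  shows "k \<otimes> y = y \<otimes> k"
proof -
  note V = geodesic_line_in[OF \<gamma>]
  define k' where "k' = inv y \<otimes> k \<otimes> y"
  have k': "k' \<in> carrier \<Gamma>" "y \<otimes> k' = k \<otimes> y"
    using k y conj_eq_iff[of k y k'] by (simp_all add: k'_def)
  have fix': "act k' (\<gamma> i) = \<gamma> i" for i
  proof -
    have "\<exists>j. act y (\<gamma> i) = \<gamma> j" using y by blast
    then have "act y (act k' (\<gamma> i)) = act y (\<gamma> i)"
      using act_mult[of y k' "\<gamma> i"] act_mult[of k y "\<gamma> i"] k k' y V by auto
    then show ?thesis using act_inj[OF y(1)] act_closed k' V by blast
  qed
  have "d (\<gamma> 0) (\<gamma> 1) = 1" using geodesic_line_dist[OF \<gamma>] by simp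
  then have "k \<otimes> k' = k' \<otimes> k" using edge_comm[OF V V] k(1,3) k'(1) fix' by blast
  then show ?thesis
    using csa_element_conjugate[OF elliptic_csa[OF k(1,2) V k(3)] y(1) k'] by simp
qed

text \<open>A reflection \<open>y\<close> has a fixed vertex, so \<open>y\<^sup>2\<close> is nontrivial; it fixes the axis pointwise and therefore
  commutes with the translation \<open>x\<close>. As \<open>y\<close> commutes with \<open>y\<^sup>2\<close> too, it would commute with \<open>x\<close>, whereas a
  reflection reverses translations. This is the place where elements of order two would do harm.\<close>

lemma axis_stabilizer_translates:
  assumes x: "x \<in> carrier \<Gamma>" and \<gamma>: "geodesic_line \<gamma>" and l: "0 < l" "\<And>i. act x (\<gamma> i) = \<gamma> (i + l)"
    and y: "y \<in> carrier \<Gamma>" "act y ` range \<gamma> \<subseteq> range \<gamma>"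
  shows "\<exists>c. \<forall>i. act y (\<gamma> i) = \<gamma> (c + i)"
proof (rule ccontr)
  assume no: "\<not> ?thesis"
  note V = geodesic_line_in[OF \<gamma>]
  obtain c where c: "\<And>i. act y (\<gamma> i) = \<gamma> (c - i)" using line_isometry[OF y(1) \<gamma> y(2)] no by blast
  obtain i where i: "act y (\<gamma> i) = \<gamma> i" using reflection_fixes[OF y(1) \<gamma> c] by blast
  have "y \<noteq> \<one>"
  proof
    assume "y = \<one>"
    then have "\<forall>i. act y (\<gamma> i) = \<gamma> (0 + i)" using act_one V by simp
    then show False using no by blast
  qed
  then have ne: "y \<otimes> y \<noteq> \<one>" using elliptic_square[OF y(1) _ V i] by blast
  have fix2: "act (y \<otimes> y) (\<gamma> i) = \<gamma> i" for i using act_mult[OF y(1) y(1) V] c by simp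
  have yy: "y \<otimes> y \<in> carrier \<Gamma>" using y by simp
  have xr: "act x ` range \<gamma> \<subseteq> range \<gamma>" using l by auto
  have "(y \<otimes> y) \<otimes> x = x \<otimes> (y \<otimes> y)" by (rule line_fixer_commutes[OF \<gamma> yy ne fix2 x xr])
  then have "x \<otimes> y = y \<otimes> x"
    using csa_element_centralizer[OF elliptic_csa[OF yy ne V fix2] x y(1)] y by (simp add: m_assoc)
  then have "act x (act y (\<gamma> 0)) = act y (act x (\<gamma> 0))" using act_mult[OF x y(1) V] act_mult[OF y(1) x V] by metis
  then have "c + l = c - l" using c l geodesic_line_inj[OF \<gamma>] by simp
  then show False using l by simp
qed

text \<open>The commutator of two translations fixes the line pointwise. Were it nontrivial, both translations would
  commute with it, hence with each other.\<close>

lemma axis_stabilizer_commutes: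
  assumes x: "x \<in> carrier \<Gamma>" and \<gamma>: "geodesic_line \<gamma>" and l: "0 < l" "\<And>i. act x (\<gamma> i) = \<gamma> (i + l)"
    and y: "y \<in> carrier \<Gamma>" "act y ` range \<gamma> \<subseteq> range \<gamma>"
    and z: "z \<in> carrier \<Gamma>" "act z ` range \<gamma> \<subseteq> range \<gamma>"
  shows "y \<otimes> z = z \<otimes> y"
proof (rule ccontr)
  assume ne: "y \<otimes> z \<noteq> z \<otimes> y"
  note V = geodesic_line_in[OF \<gamma>]
  obtain c e where c: "\<And>i. act y (\<gamma> i) = \<gamma> (c + i)" and e: "\<And>i. act z (\<gamma> i) = \<gamma> (e + i)"
    using axis_stabilizer_translates[OF x \<gamma> l y] axis_stabilizer_translates[OF x \<gamma> l z] by blast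
  define k where "k = inv (z \<otimes> y) \<otimes> (y \<otimes> z)"
  have k: "k \<in> carrier \<Gamma>" using y z by (simp add: k_def)
  have kne: "k \<noteq> \<one>"
  proof
    assume "k = \<one>"
    then have "y \<otimes> z = z \<otimes> y"
      using inv_solve_left'[of \<one> "z \<otimes> y" "y \<otimes> z"] y z by (simp add: k_def)
    then show False using ne by simp
  qed
  have kfix: "act k (\<gamma> i) = \<gamma> i" for i
  proof -
    have "act (y \<otimes> z) (\<gamma> i) = act (z \<otimes> y) (\<gamma> i)"
      using act_mult[of y z "\<gamma> i"] act_mult[of z y "\<gamma> i"] y z V c e by (simp add: algebra_simps)
    then show ?thesis
      unfolding k_def using act_mult[of "inv (z \<otimes> y)" "y \<otimes> z" "\<gamma> i"]
        act_inv_cancel(1)[of "z \<otimes> y" "\<gamma> i"] y z V by simp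
  qed
  have "k \<otimes> y = y \<otimes> k" "k \<otimes> z = z \<otimes> k"
    using line_fixer_commutes[OF \<gamma> k kne kfix] y z by blast+
  then show False
    using csa_element_centralizer[OF elliptic_csa[OF k kne V kfix] y(1) z(1)] ne by blast
qed

lemma axis_preserved:
  assumes x: "x \<in> carrier \<Gamma>" and \<gamma>: "geodesic_line \<gamma>" and l: "l \<noteq> 0" "\<And>i. act x (\<gamma> i) = \<gamma> (i + l)"
    and y: "y \<in> carrier \<Gamma>" and x': "x' \<in> carrier \<Gamma>" "y \<otimes> x' = x \<otimes> y"
    and \<delta>: "geodesic_line \<delta>" "0 < m" "\<And>i. act x' (\<delta> i) = \<delta> (i + m)"
  shows "act y ` range \<delta> \<subseteq> range \<gamma>"
proof -
  note V = geodesic_line_in[OF \<delta>(1)]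
  have "geodesic_line (act y \<circ> \<delta>)"
    using \<delta>(1) dist_act[OF y] act_closed[OF y] by (simp add: geodesic_line_def)
  moreover have "act x ((act y \<circ> \<delta>) i) = (act y \<circ> \<delta>) (i + m)" for i
    using act_mult[OF x y V, of i] act_mult[OF y x'(1) V, of i] x'(2) \<delta>(3) by simp
  ultimately have "range (act y \<circ> \<delta>) \<subseteq> range \<gamma>"
    using axis_range_mono[OF x \<gamma> l(2) _ \<delta>(2)] by blast
  then show ?thesis by auto
qed

text \<open>Centralizing elements preserve the axis, and the stabilizer of the axis is commutative. If \<open>x\<close> commutes
  with its conjugate by \<open>y\<close>, then the latter translates the axis of \<open>x\<close>; so both have the same axis, and
  \<open>y\<close> preserves it.\<close>

lemma hyperbolic_csa:
  assumes x: "x \<in> carrier \<Gamma>" "\<And>v. v \<in> V \<Longrightarrow> act x v \<noteq> v"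
  shows "csa_element \<Gamma> x"
proof -
  obtain \<gamma> l where \<gamma>: "geodesic_line \<gamma>" and l: "0 < l" "\<And>i. act x (\<gamma> i) = \<gamma> (i + l)"
    using axis_exists[OF x] by blast
  note V = geodesic_line_in[OF \<gamma>]
  have comm: "y \<otimes> z = z \<otimes> y" if "y \<in> carrier \<Gamma>" "act y ` range \<gamma> \<subseteq> range \<gamma>"
    "z \<in> carrier \<Gamma>" "act z ` range \<gamma> \<subseteq> range \<gamma>" for y z
    by (rule axis_stabilizer_commutes[OF x(1) \<gamma> l that])
  have cent: "act y ` range \<gamma> \<subseteq> range \<gamma>" if "y \<in> carrier \<Gamma>" "x \<otimes> y = y \<otimes> x" for y
    by (rule axis_preserved[OF x(1) \<gamma> _ l(2) that(1) x(1) _ \<gamma> l]) (use l that in auto)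
  show ?thesis
  proof (rule csa_elementI)
    fix y z assume "y \<in> carrier \<Gamma>" "z \<in> carrier \<Gamma>" "x \<otimes> y = y \<otimes> x" "x \<otimes> z = z \<otimes> x"
    then show "y \<otimes> z = z \<otimes> y" using comm cent by blast
  next
    fix y x' assume y: "y \<in> carrier \<Gamma>" "x' \<in> carrier \<Gamma>" "y \<otimes> x' = x \<otimes> y" "x \<otimes> x' = x' \<otimes> x"
    obtain c where c: "\<And>i. act x' (\<gamma> i) = \<gamma> (c + i)"
      using axis_stabilizer_translates[OF x(1) \<gamma> l y(2) cent[OF y(2,4)]] by blast
    have "c \<noteq> 0"
    proof
      assume "c = 0"
      then have "act x' (\<gamma> 0) = \<gamma> 0" using c by simp
      then have "act x (act y (\<gamma> 0)) = act y (\<gamma> 0)"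
        using act_mult[OF x(1) y(1) V] act_mult[OF y(1,2) V] y(3) by metis
      then show False using x(2) act_closed[OF y(1) V] by blast
    qed
    \<comment> \<open>Up to its direction, the axis of \<open>x\<close> is an axis of its conjugate \<open>x'\<close>.\<close>
    define \<delta> where "\<delta> i = \<gamma> (sgn c * i)" for i
    have "\<bar>sgn c * i - sgn c * j\<bar> = \<bar>i - j\<bar>" for i j
      using \<open>c \<noteq> 0\<close> by (cases "c > 0") auto
    then have "geodesic_line \<delta>" using \<gamma> by (simp add: geodesic_line_def \<delta>_def)
    moreover have "act x' (\<delta> i) = \<delta> (i + \<bar>c\<bar>)" for i
      using c[of "sgn c * i"] by (simp add: \<delta>_def distrib_left mult_sgn_abs add.commute)
    ultimately have "act y ` range \<delta> \<subseteq> range \<gamma>"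
      using axis_preserved[OF x(1) \<gamma> _ l(2) y(1,2,3), of \<delta> "\<bar>c\<bar>"] l(1) \<open>c \<noteq> 0\<close> by simp
    moreover have "\<gamma> i = \<delta> (sgn c * i)" for i
      using \<open>c \<noteq> 0\<close> by (cases "c > 0") (auto simp: \<delta>_def)
    then have "range \<gamma> \<subseteq> range \<delta>" by auto
    ultimately have "act y ` range \<gamma> \<subseteq> range \<gamma>" by blast
    then show "x \<otimes> y = y \<otimes> x" using comm[OF x(1) _ y(1)] cent[OF x(1)] by blast
  qed
qed

theorem csa_star: "csa_star_group \<Gamma>"
  unfolding csa_star_group_iff
proof (intro ballI conjI)
  fix x assume "x \<in> carrier \<Gamma> - {\<one>}"
  then have x: "x \<in> carrier \<Gamma>" "x \<noteq> \<one>" by auto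
  show "csa_element \<Gamma> x" using elliptic_csa[OF x] hyperbolic_csa[OF x(1)] by blast
  show "x \<otimes> x \<noteq> \<one>"
  proof (cases "\<exists>v\<in>V. act x v = v")
    case True
    then show ?thesis using elliptic_square[OF x] by blast
  next
    case False
    then obtain \<gamma> l where \<gamma>: "geodesic_line \<gamma>" and l: "0 < l" "\<And>i. act x (\<gamma> i) = \<gamma> (i + l)"
      using axis_exists[OF x(1)] by blast
    have "act (x \<otimes> x) (\<gamma> 0) = \<gamma> (l + l)"
      using act_mult[OF x(1) x(1) geodesic_line_in[OF \<gamma>]] l(2)[of 0] l(2)[of l] by simp
    moreover have "\<gamma> (l + l) \<noteq> \<gamma> 0" using geodesic_line_inj[OF \<gamma>] l by simp
    ultimately show ?thesis using act_one[OF geodesic_line_in[OF \<gamma>]] by metis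
  qed
qed

end

section \<open>Normal forms and the action of words\<close>

text \<open>The tree is built from normal forms. A word \<open>c\<^sub>1 t\<^sup>\<plusminus> c\<^sub>2 t\<^sup>\<plusminus> \<dots> c\<^sub>n t\<^sup>\<plusminus>\<close> is stored as the list of the pairs
  \<open>(c\<^sub>i, e\<^sub>i)\<close>, where \<open>e\<^sub>i\<close> is the sign and \<open>c\<^sub>i\<close> a chosen representative of a left coset of \<open>A\<close> (for
  \<open>True\<close>) or \<open>B\<close> (for \<open>False\<close>), without a factor \<open>t\<^sup>\<plusminus> \<one> t\<^sup>\<mp>\<close>. Such lists correspond to the left cosets of \<open>G\<close>
  in the HNN-extension, and dropping the last pair leads to the neighbour towards the root, the coset \<open>G\<close>.\<close>

locale hnn_extension = group +
  fixes A B :: "'a set" and \<phi> :: "'a \<Rightarrow> 'a"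
  assumes subgroup_A: "subgroup A G" and subgroup_B: "subgroup B G"
    and iso_AB: "\<phi> \<in> iso (G\<lparr>carrier := A\<rparr>) (G\<lparr>carrier := B\<rparr>)"
begin

text \<open>The subgroup and the isomorphism on either side, with \<open>h t\<^sup>e = t\<^sup>e (twist e h)\<close> for \<open>h \<in> edge_group e\<close>.\<close>

definition edge_group :: "bool \<Rightarrow> 'a set" where
  "edge_group e = (if e then A else B)"

definition twist :: "bool \<Rightarrow> 'a \<Rightarrow> 'a" where
  "twist e = (if e then \<phi> else inv_into A \<phi>)"

lemma subgroup_edge_group: "subgroup (edge_group e) G"
  using subgroup_A subgroup_B by (simp add: edge_group_def)

lemma edge_group_carrier: "x \<in> edge_group e \<Longrightarrow> x \<in> carrier G"
  using subgroup_edge_group subgroup.subset by blast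

lemma bij_phi: "bij_betw \<phi> A B"
  using iso_AB by (auto simp: iso_def)

lemma twist_mem: "x \<in> edge_group e \<Longrightarrow> twist e x \<in> edge_group (\<not> e)"
  using bij_phi bij_betw_inv_into[OF bij_phi]
  by (auto simp: edge_group_def twist_def dest: bij_betwE)

lemma twist_twist: "x \<in> edge_group e \<Longrightarrow> twist (\<not> e) (twist e x) = x"
  using bij_phi by (auto simp: edge_group_def twist_def bij_betw_inv_into_left bij_betw_inv_into_right)

lemma phi_mult: "\<lbrakk>x \<in> A; y \<in> A\<rbrakk> \<Longrightarrow> \<phi> (x \<otimes> y) = \<phi> x \<otimes> \<phi> y"
  using iso_AB by (auto simp: iso_def hom_def)

lemma twist_mult:
  assumes "x \<in> edge_group e" "y \<in> edge_group e"
  shows "twist e (x \<otimes> y) = twist e x \<otimes> twist e y"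
proof (cases e)
  case True
  then show ?thesis using assms by (simp add: edge_group_def twist_def phi_mult)
next
  case False
  have "twist (\<not> e) (twist e x \<otimes> twist e y) = x \<otimes> y"
    using False twist_mem[OF assms(1)] twist_mem[OF assms(2)] twist_twist[OF assms(1)]
      twist_twist[OF assms(2)] phi_mult
    by (simp add: edge_group_def twist_def)
  moreover have "twist e x \<otimes> twist e y \<in> edge_group (\<not> e)"
    using twist_mem assms subgroup.m_closed[OF subgroup_edge_group] by blast
  ultimately show ?thesis using twist_twist[of "twist e x \<otimes> twist e y" "\<not> e"] by simp
qed

lemma twist_one: "twist e \<one> = \<one>"
proof -
  have 1: "\<one> \<in> edge_group e" using subgroup.one_closed[OF subgroup_edge_group] .
  then have "twist e \<one> = twist e \<one> \<otimes> twist e \<one>" using twist_mult[OF 1 1] by simp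
  then show ?thesis using edge_group_carrier[OF twist_mem[OF 1]] by (simp add: r_cancel_one')
qed

text \<open>The representative of the subgroup itself has to be \<open>\<one>\<close>, so that reducedness of a normal form can be read off.\<close>

definition rep :: "bool \<Rightarrow> 'a \<Rightarrow> 'a" where
  "rep e g = (if g \<in> edge_group e then \<one> else SOME c. c \<in> carrier G \<and> inv c \<otimes> g \<in> edge_group e)"

text \<open>What remains after moving \<open>g\<close> across the stable letter: \<open>g t\<^sup>e = rep e g \<cdot> t\<^sup>e \<cdot> residue e g\<close>.\<close>

definition residue :: "bool \<Rightarrow> 'a \<Rightarrow> 'a" where
  "residue e g = twist e (inv (rep e g) \<otimes> g)"

lemma edge_group_cancel:
  assumes "h \<in> edge_group e" "x \<in> carrier G"
  shows "x \<otimes> h \<in> edge_group e \<longleftrightarrow> x \<in> edge_group e" "h \<otimes> x \<in> edge_group e \<longleftrightarrow> x \<in> edge_group e"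
proof -
  note s = subgroup_edge_group[of e]
  have h: "h \<in> carrier G" "inv h \<in> edge_group e"
    using assms edge_group_carrier subgroup.m_inv_closed[OF s] by auto
  have "x = x \<otimes> h \<otimes> inv h" "x = inv h \<otimes> (h \<otimes> x)" using assms h by (simp_all add: m_assoc m_assoc[symmetric])
  then show "x \<otimes> h \<in> edge_group e \<longleftrightarrow> x \<in> edge_group e" "h \<otimes> x \<in> edge_group e \<longleftrightarrow> x \<in> edge_group e"
    using assms h subgroup.m_closed[OF s] by metis+
qed

lemma rep_props:
  assumes g: "g \<in> carrier G"
  shows "rep e g \<in> carrier G \<and> inv (rep e g) \<otimes> g \<in> edge_group e"
proof (cases "g \<in> edge_group e")
  case True
  then show ?thesis using g by (simp add: rep_def)
next
  case False
  have "\<exists>c. c \<in> carrier G \<and> inv c \<otimes> g \<in> edge_group e"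
    using g subgroup.one_closed[OF subgroup_edge_group] by (intro exI[of _ g]) simp
  from someI_ex[OF this] False show ?thesis by (simp add: rep_def)
qed

lemma rep_closed [simp]: "g \<in> carrier G \<Longrightarrow> rep e g \<in> carrier G"
  and rep_mem: "g \<in> carrier G \<Longrightarrow> inv (rep e g) \<otimes> g \<in> edge_group e"
  using rep_props by auto

lemma residue_mem: "g \<in> carrier G \<Longrightarrow> residue e g \<in> edge_group (\<not> e)"
  by (simp add: residue_def rep_mem twist_mem)

lemma residue_closed [simp]: "g \<in> carrier G \<Longrightarrow> residue e g \<in> carrier G"
  using residue_mem edge_group_carrier by blast

lemma rep_mult:
  assumes "g \<in> carrier G" "h \<in> edge_group e"
  shows "rep e (g \<otimes> h) = rep e g"
proof -
  have h: "h \<in> carrier G" using assms edge_group_carrier by blast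
  have "(c \<in> carrier G \<and> inv c \<otimes> (g \<otimes> h) \<in> edge_group e) \<longleftrightarrow> (c \<in> carrier G \<and> inv c \<otimes> g \<in> edge_group e)" for c
    using assms h edge_group_cancel(1)[of h e "inv c \<otimes> g"] by (auto simp: m_assoc)
  then show ?thesis using assms edge_group_cancel(1)[of h e g] by (simp add: rep_def)
qed

lemma rep_decompose:
  assumes "g \<in> carrier G"
  shows "rep e g \<otimes> (inv (rep e g) \<otimes> g) = g"
  using assms by (simp add: m_assoc[symmetric])

lemma rep_rep [simp]: "g \<in> carrier G \<Longrightarrow> rep e (rep e g) = rep e g"
  using rep_mult[of "rep e g" "inv (rep e g) \<otimes> g" e] rep_decompose rep_mem by simp

lemma rep_one_iff: "g \<in> carrier G \<Longrightarrow> rep e g = \<one> \<longleftrightarrow> g \<in> edge_group e"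
  using rep_mem[of g e] by (auto simp: rep_def)

lemma rep_eq_iff:
  assumes "g \<in> carrier G" "c \<in> carrier G" "rep e c = c"
  shows "rep e g = c \<longleftrightarrow> inv c \<otimes> g \<in> edge_group e"
proof
  assume "inv c \<otimes> g \<in> edge_group e"
  then have "rep e (c \<otimes> (inv c \<otimes> g)) = c" using rep_mult assms by simp
  then show "rep e g = c" using assms by (simp add: m_assoc[symmetric])
qed (use rep_mem assms in auto)

lemma residue_rep: "\<lbrakk>c \<in> carrier G; rep e c = c\<rbrakk> \<Longrightarrow> residue e c = \<one>"
  by (simp add: residue_def twist_one)

lemma residue_in_edge_group: "h \<in> edge_group e \<Longrightarrow> residue e h = twist e h"
  using edge_group_carrier by (simp add: residue_def rep_def)

lemma rep_mult_rep:
  assumes "g \<in> carrier G" "c \<in> carrier G"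
  shows "rep e (g \<otimes> rep e c) = rep e (g \<otimes> c)"
    and "residue e (g \<otimes> rep e c) \<otimes> residue e c = residue e (g \<otimes> c)"
proof -
  define h where "h = inv (rep e c) \<otimes> c"
  have h: "h \<in> edge_group e" "h \<in> carrier G" "c = rep e c \<otimes> h"
    using assms rep_mem[of c e] edge_group_carrier rep_decompose[of c e] by (auto simp: h_def)
  have gc: "g \<otimes> c = g \<otimes> rep e c \<otimes> h" using assms h(2) by (subst h(3)) (simp add: m_assoc)
  show eq: "rep e (g \<otimes> rep e c) = rep e (g \<otimes> c)"
    unfolding gc using rep_mult[of "g \<otimes> rep e c" h e] assms h by simp
  have "residue e (g \<otimes> rep e c) \<otimes> residue e c
      = twist e (inv (rep e (g \<otimes> c)) \<otimes> (g \<otimes> rep e c) \<otimes> h)"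
    unfolding residue_def h_def[symmetric] eq
    using twist_mult[OF _ h(1)] rep_mem[of "g \<otimes> rep e c" e] assms by (simp add: eq)
  also have "\<dots> = residue e (g \<otimes> c)"
    unfolding residue_def using assms h(2) gc by (simp add: m_assoc)
  finally show "residue e (g \<otimes> rep e c) \<otimes> residue e c = residue e (g \<otimes> c)" .
qed

fun vertex :: "('a \<times> bool) list \<Rightarrow> bool" where
  "vertex [] \<longleftrightarrow> True"
| "vertex ((c, e) # l) \<longleftrightarrow> c \<in> carrier G \<and> rep e c = c \<and> vertex l \<and> (l \<noteq> [] \<longrightarrow> hd l \<noteq> (\<one>, \<not> e))"

text \<open>Left multiplication of a normal form \<open>l\<close> by \<open>g\<close> gives the normal form \<open>shift g l\<close> followed by the element
  \<open>carry g l\<close> of the base group; \<open>push e\<close> is left multiplication by \<open>t\<^sup>e\<close>, which leaves nothing over.\<close>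

fun shift :: "'a \<Rightarrow> ('a \<times> bool) list \<Rightarrow> ('a \<times> bool) list" where
  "shift g [] = []"
| "shift g ((c, e) # l) = (rep e (g \<otimes> c), e) # shift (residue e (g \<otimes> c)) l"

fun carry :: "'a \<Rightarrow> ('a \<times> bool) list \<Rightarrow> 'a" where
  "carry g [] = g"
| "carry g ((c, e) # l) = carry (residue e (g \<otimes> c)) l"

fun push :: "bool \<Rightarrow> ('a \<times> bool) list \<Rightarrow> ('a \<times> bool) list" where
  "push e [] = [(\<one>, e)]"
| "push e ((c, e') # l) = (if c = \<one> \<and> e' = (\<not> e) then l else (\<one>, e) # (c, e') # l)"

lemma rep_one [simp]: "rep e \<one> = \<one>"
  using subgroup.one_closed[OF subgroup_edge_group] by (simp add: rep_def)

text \<open>Left multiplication by \<open>h\<close> permutes the cosets of the associated subgroup and fixes the trivial one, so it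
  does not destroy reducedness.\<close>

lemma shift_hd:
  assumes "h \<in> edge_group e" "vertex l"
  shows "shift h l \<noteq> [] \<and> hd (shift h l) = (\<one>, e) \<longleftrightarrow> l \<noteq> [] \<and> hd l = (\<one>, e)"
proof (cases l)
  case (Cons p l')
  obtain c e' where p: "p = (c, e')" by force
  then have c: "c \<in> carrier G" "rep e' c = c" using assms Cons by auto
  have h: "h \<in> carrier G" using assms edge_group_carrier by blast
  have "rep e (h \<otimes> c) = \<one> \<longleftrightarrow> c = \<one>" if "e' = e"
    using rep_one_iff[of "h \<otimes> c" e] rep_one_iff[of c e] edge_group_cancel(2)[OF assms(1) c(1)] c h that by simp
  then show ?thesis using Cons p by auto
qed simp

lemma shift_vertex: "\<lbrakk>g \<in> carrier G; vertex l\<rbrakk> \<Longrightarrow> vertex (shift g l)"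
proof (induction l arbitrary: g)
  case (Cons p l)
  obtain c e where p: "p = (c, e)" by force
  then show ?case
    using Cons shift_hd[OF residue_mem[of "g \<otimes> c" e], of l] by auto
qed simp

lemma carry_closed: "\<lbrakk>g \<in> carrier G; vertex l\<rbrakk> \<Longrightarrow> carry g l \<in> carrier G"
proof (induction l arbitrary: g)
  case (Cons p l)
  then show ?case by (cases p) simp
qed simp

lemma shift_one: "vertex l \<Longrightarrow> shift \<one> l = l \<and> carry \<one> l = \<one>"
proof (induction l)
  case (Cons p l)
  then show ?case by (cases p) (simp add: residue_rep)
qed simp

lemma shift_mult:
  "\<lbrakk>g \<in> carrier G; k \<in> carrier G; vertex l\<rbrakk> \<Longrightarrow>
    shift (g \<otimes> k) l = shift g (shift k l) \<and> carry (g \<otimes> k) l = carry g (shift k l) \<otimes> carry k l"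
proof (induction l arbitrary: g k)
  case (Cons p l)
  obtain c e where p: "p = (c, e)" by force
  with Cons.prems have c: "c \<in> carrier G" "vertex l" by auto
  have r: "rep e (g \<otimes> k \<otimes> c) = rep e (g \<otimes> rep e (k \<otimes> c))"
    "residue e (g \<otimes> k \<otimes> c) = residue e (g \<otimes> rep e (k \<otimes> c)) \<otimes> residue e (k \<otimes> c)"
    using rep_mult_rep[of g "k \<otimes> c" e] Cons.prems c by (simp_all add: m_assoc)
  show ?case using Cons.IH[OF _ _ c(2)] Cons.prems c by (simp add: p r)
qed simp

lemma push_vertex: "vertex l \<Longrightarrow> vertex (push e l)"
  by (cases l) auto

lemma push_push: "vertex l \<Longrightarrow> push e (push (\<not> e) l) = l"
proof (cases l)
  case (Cons p l')
  assume "vertex l"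
  with Cons show ?thesis by (cases p; cases l') (auto split: if_splits)
qed simp

lemma push_shift:
  assumes h: "h \<in> edge_group e" and l: "vertex l"
  shows "shift h (push e l) = push e (shift (twist e h) l) \<and> carry h (push e l) = carry (twist e h) l"
proof (cases l)
  case Nil
  then show ?thesis using h edge_group_carrier[OF h] by (simp add: rep_def residue_in_edge_group)
next
  case (Cons p l')
  obtain c e' where p: "p = (c, e')" by force
  have hc: "h \<in> carrier G" "twist e h \<in> carrier G" "twist e h \<in> edge_group (\<not> e)"
    using h twist_mem edge_group_carrier by auto
  show ?thesis
  proof (cases "c = \<one> \<and> e' = (\<not> e)")
    case True
    then have eq: "push e l = l'" using Cons p by simp
    have "residue (\<not> e) (twist e h) = h" using residue_in_edge_group[OF hc(3)] twist_twist[OF h] by simp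
    moreover have "rep (\<not> e) (twist e h) = \<one>" using rep_one_iff hc by simp
    ultimately show ?thesis using eq Cons p True hc by simp
  next
    case False
    then have eq: "push e l = (\<one>, e) # l" using Cons p by simp
    have "hd (shift (twist e h) l) \<noteq> (\<one>, \<not> e)"
      using shift_hd[OF hc(3) l] False Cons p by auto
    then have "push e (shift (twist e h) l) = (\<one>, e) # shift (twist e h) l"
      using Cons p by auto
    then show ?thesis using eq h hc by (simp add: rep_def residue_in_edge_group)
  qed
qed

fun letter_act :: "'a hnn_letter \<Rightarrow> ('a \<times> bool) list \<Rightarrow> ('a \<times> bool) list" where
  "letter_act (Base g) l = shift g l"
| "letter_act Stable l = push True l"
| "letter_act Stable_inv l = push False l"

fun letter_carry :: "'a hnn_letter \<Rightarrow> ('a \<times> bool) list \<Rightarrow> 'a" where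
  "letter_carry (Base g) l = carry g l"
| "letter_carry Stable l = \<one>"
| "letter_carry Stable_inv l = \<one>"

fun word_act :: "'a hnn_letter list \<Rightarrow> ('a \<times> bool) list \<Rightarrow> ('a \<times> bool) list" where
  "word_act [] l = l"
| "word_act (x # w) l = letter_act x (word_act w l)"

fun word_carry :: "'a hnn_letter list \<Rightarrow> ('a \<times> bool) list \<Rightarrow> 'a" where
  "word_carry [] l = \<one>"
| "word_carry (x # w) l = letter_carry x (word_act w l) \<otimes> word_carry w l"

lemma hnn_words_Cons: "x # w \<in> hnn_words G \<longleftrightarrow> [x] \<in> hnn_words G \<and> w \<in> hnn_words G"
  by (auto simp: hnn_words_def)

lemma hnn_words_append: "u @ v \<in> hnn_words G \<longleftrightarrow> u \<in> hnn_words G \<and> v \<in> hnn_words G"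
  by (auto simp: hnn_words_def)

lemma hnn_words_Base: "[Base g] \<in> hnn_words G \<longleftrightarrow> g \<in> carrier G"
  by (auto simp: hnn_words_def)

lemma word_act_vertex: "\<lbrakk>w \<in> hnn_words G; vertex l\<rbrakk> \<Longrightarrow> vertex (word_act w l)"
proof (induction w)
  case (Cons x w)
  then show ?case using hnn_words_Cons[of x w] hnn_words_Base shift_vertex push_vertex by (cases x) auto
qed simp

lemma word_carry_closed: "\<lbrakk>w \<in> hnn_words G; vertex l\<rbrakk> \<Longrightarrow> word_carry w l \<in> carrier G"
proof (induction w)
  case (Cons x w)
  then show ?case using hnn_words_Cons[of x w] hnn_words_Base carry_closed word_act_vertex by (cases x) auto
qed simp

lemma word_act_append: "word_act (u @ v) l = word_act u (word_act v l)"
  by (induction u) auto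

lemma word_carry_append:
  "\<lbrakk>u \<in> hnn_words G; v \<in> hnn_words G; vertex l\<rbrakk>
    \<Longrightarrow> word_carry (u @ v) l = word_carry u (word_act v l) \<otimes> word_carry v l"
proof (induction u)
  case Nil
  then show ?case using word_carry_closed by simp
next
  case (Cons x u)
  have w: "[x] \<in> hnn_words G" "u \<in> hnn_words G" using Cons.prems hnn_words_Cons[of x u] by auto
  have v: "vertex (word_act v l)" "vertex (word_act u (word_act v l))" using Cons.prems w word_act_vertex by auto
  have "letter_carry x (word_act u (word_act v l)) \<in> carrier G"
    using word_carry_closed[OF w(1) v(2)] w(1) carry_closed[OF _ v(2)] hnn_words_Base by (cases x) auto
  then show ?case using Cons.IH w v Cons.prems word_carry_closed by (simp add: word_act_append m_assoc)
qed

lemma phi_image: "\<phi> ` A = B" using bij_phi by (rule bij_betw_imp_surj_on)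

lemma subset_A: "A \<subseteq> carrier G" and subset_phi: "\<phi> ` A \<subseteq> carrier G"
  using subgroup.subset subgroup_A subgroup_B phi_image by auto

text \<open>The defining relations act trivially, on the vertices as well as on the carried elements. For the vertices
  this gives the action; the carried elements show that the base group embeds.\<close>

lemma word_act_rel:
  assumes "(u, v) \<in> hnn_rel G A \<phi>" "vertex l"
  shows "word_act u l = word_act v l \<and> word_carry u l = word_carry v l"
  using assms
proof (induction arbitrary: l)
  case (append u v u' v')
  have w: "u \<in> hnn_words G" "v \<in> hnn_words G" "u' \<in> hnn_words G" "v' \<in> hnn_words G"
    using hnn_rel_words[OF is_group subset_A subset_phi] append.hyps by blast+
  show ?case using append.IH word_act_vertex append.prems w by (simp add: word_act_append word_carry_append)
next
  case one
  then show ?case using shift_one by simp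
next
  case (mult g h)
  then show ?case using shift_mult[OF mult(1,2), of l] carry_closed shift_vertex by simp
next
  case right_inv
  then show ?case using push_push[of l True] by simp
next
  case left_inv
  then show ?case using push_push[of l False] by simp
next
  case (conj a)
  then have a: "a \<in> edge_group True" by (simp add: edge_group_def)
  have "twist True a = \<phi> a" by (simp add: twist_def)
  moreover have "\<phi> a \<in> carrier G" using subset_phi conj by auto
  ultimately show ?case
    using push_shift[OF a conj(2)] push_push[of "shift (\<phi> a) l" False] shift_vertex carry_closed conj by simp
qed auto

end

section \<open>The tree of an HNN-extension\<close>

fun common_prefix :: "'b list \<Rightarrow> 'b list \<Rightarrow> nat" where
  "common_prefix (x # xs) (y # ys) = (if x = y then Suc (common_prefix xs ys) else 0)"
| "common_prefix _ _ = 0"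

text \<open>Distance in the tree of all lists, in which the parent of a nonempty list is obtained by dropping
  its last entry.\<close>

definition tree_dist :: "'b list \<Rightarrow> 'b list \<Rightarrow> int" where
  "tree_dist u v = int (length u) + int (length v) - 2 * int (common_prefix u v)"

text \<open>The exponent sum of the stable letter.\<close>

definition height :: "('b \<times> bool) list \<Rightarrow> int" where
  "height l = (\<Sum>(c, e)\<leftarrow>l. if e then 1 else - 1)"

lemma height_Nil [simp]: "height [] = 0"
  and height_Cons [simp]: "height ((c, e) # l) = (if e then 1 else - 1) + height l"
  by (simp_all add: height_def)

lemma common_prefix_Nil [simp]: "common_prefix u [] = 0"
  by (cases u) auto

lemma common_prefix_sym: "common_prefix u v = common_prefix v u"
  by (induction u v rule: common_prefix.induct) auto

lemma common_prefix_le: "common_prefix u v \<le> length u"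
  by (induction u v rule: common_prefix.induct) auto

lemma common_prefix_self [simp]: "common_prefix u u = length u"
  by (induction u) auto

lemma common_prefix_full: "common_prefix u v = length u \<Longrightarrow> length u = length v \<Longrightarrow> u = v"
  by (induction u v rule: common_prefix.induct) (auto split: if_splits)

lemma common_prefix_ultrametric:
  "min (common_prefix u v) (common_prefix v w) \<le> common_prefix u w"
proof (induction u v arbitrary: w rule: common_prefix.induct)
  case (1 x xs y ys)
  show ?case
  proof (cases w)
    case (Cons z zs)
    then show ?thesis using 1[of zs] by auto
  qed simp
qed auto

lemma tree_dist_eq_0_iff: "tree_dist u v = 0 \<longleftrightarrow> u = v"
  using common_prefix_le[of u v] common_prefix_le[of v u] common_prefix_full[of u v]
  by (auto simp: tree_dist_def common_prefix_sym[of v u])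

lemma tree_dist_sym: "tree_dist u v = tree_dist v u"
  by (simp add: tree_dist_def common_prefix_sym[of v u])

text \<open>With \<open>common_prefix\<close> as Gromov product at the root, this is the ultrametric inequality.\<close>

lemma tree_dist_four_point:
  "tree_dist u v + tree_dist w x \<le> max (tree_dist u w + tree_dist v x) (tree_dist u x + tree_dist v w)"
proof -
  let ?c = common_prefix
  have "min (?c u w + ?c v x) (?c u x + ?c v w) \<le> ?c u v + ?c w x"
    using common_prefix_ultrametric[of u w v] common_prefix_ultrametric[of u x v]
      common_prefix_ultrametric[of w u x] common_prefix_ultrametric[of w v x]
      common_prefix_ultrametric[of u v w] common_prefix_ultrametric[of u x w]
      common_prefix_ultrametric[of u v x] common_prefix_ultrametric[of u w x]
      common_prefix_ultrametric[of v u w] common_prefix_ultrametric[of v x w]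
      common_prefix_ultrametric[of v u x] common_prefix_ultrametric[of v w x]
    by (simp only: common_prefix_sym[of w u] common_prefix_sym[of w v] common_prefix_sym[of x u]
      common_prefix_sym[of x v] common_prefix_sym[of v u] common_prefix_sym[of x w]) linarith
  then show ?thesis by (simp add: tree_dist_def max_def min_def split: if_splits)
qed

lemma height_parity: "even (height l - int (length l))"
  by (induction l) (auto split: if_splits)

lemma tree_dist_parity: "even (tree_dist u v - (height u - height v))"
  using height_parity[of u] height_parity[of v] unfolding tree_dist_def by presburger

lemma height_le_length: "\<bar>height l\<bar> \<le> int (length l)"
  by (induction l) (auto split: if_splits)

lemma height_diff_le_dist: "\<bar>height u - height v\<bar> \<le> tree_dist u v"
proof (induction u v rule: common_prefix.induct)
  case (1 x xs y ys)
  show ?case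
  proof (cases "x = y")
    case True
    moreover obtain c e where "y = (c, e)" by force
    ultimately show ?thesis using 1 by (simp add: tree_dist_def)
  next
    case False
    then show ?thesis using height_le_length[of "x # xs"] height_le_length[of "y # ys"]
      by (simp add: tree_dist_def)
  qed
next
  case ("2_1" v)
  then show ?case using height_le_length[of v] by (simp add: tree_dist_def)
next
  case ("2_2" u)
  then show ?case using height_le_length[of u] by (simp add: tree_dist_def)
qed

context hnn_extension
begin

lemma shift_length [simp]: "length (shift g l) = length l"
  by (induction g l rule: shift.induct) auto

lemma shift_height [simp]: "height (shift g l) = height l"
  by (induction g l rule: shift.induct) auto

lemma rep_mult_inj:
  assumes "g \<in> carrier G" "c \<in> carrier G" "c' \<in> carrier G" "rep e c = c" "rep e c' = c'"
    and "rep e (g \<otimes> c) = rep e (g \<otimes> c')"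
  shows "c = c'"
proof -
  have "rep e (inv g \<otimes> rep e (g \<otimes> x)) = rep e x" if "x \<in> carrier G" for x
    using rep_mult_rep(1)[of "inv g" "g \<otimes> x" e] that assms(1) by (simp add: m_assoc[symmetric])
  then show ?thesis using assms by metis
qed

lemma shift_common_prefix:
  "\<lbrakk>g \<in> carrier G; vertex u; vertex v\<rbrakk> \<Longrightarrow> common_prefix (shift g u) (shift g v) = common_prefix u v"
proof (induction u v arbitrary: g rule: common_prefix.induct)
  case (1 p u q v)
  obtain c e c' e' where p: "p = (c, e)" "q = (c', e')" by force
  then show ?case using 1 rep_mult_inj[of g c c' e] by auto
qed auto

lemma shift_dist: "\<lbrakk>g \<in> carrier G; vertex u; vertex v\<rbrakk> \<Longrightarrow> tree_dist (shift g u) (shift g v) = tree_dist u v"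
  by (simp add: tree_dist_def shift_common_prefix)

lemma push_height: "height (push e l) = height l + (if e then 1 else - 1)"
  by (cases l) auto

lemma push_cases:
  assumes "vertex l"
  obtains l' where "l = (\<one>, \<not> e) # l'" "push e l = l'" "l' = [] \<or> hd l' \<noteq> (\<one>, e)"
  | "push e l = (\<one>, e) # l" "l = [] \<or> hd l \<noteq> (\<one>, \<not> e)"
proof (cases "l \<noteq> [] \<and> hd l = (\<one>, \<not> e)")
  case True
  then obtain l' where l: "l = (\<one>, \<not> e) # l'" by (cases l) auto
  then show ?thesis using that(1)[OF l] assms by auto
next
  case False
  then have "push e l = (\<one>, e) # l" by (cases "(e, l)" rule: push.cases) auto
  then show ?thesis using that(2) False by blast
qed

lemma common_prefix_hd_neq: "v = [] \<or> hd v \<noteq> x \<Longrightarrow> common_prefix (x # u) v = 0 \<and> common_prefix v (x # u) = 0"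
  by (cases v) auto

text \<open>If exactly one of the two lists is shortened, the other one gets longer and the results branch at the root.\<close>

lemma push_dist:
  assumes "vertex u" "vertex v"
  shows "tree_dist (push e u) (push e v) = tree_dist u v"
proof (rule push_cases[OF assms(1), of e]; rule push_cases[OF assms(2), of e])
qed (auto simp: tree_dist_def common_prefix_hd_neq)

lemma word_act_dist:
  "\<lbrakk>w \<in> hnn_words G; vertex u; vertex v\<rbrakk> \<Longrightarrow> tree_dist (word_act w u) (word_act w v) = tree_dist u v"
proof (induction w)
  case (Cons x w)
  then have w: "[x] \<in> hnn_words G" "w \<in> hnn_words G" using hnn_words_Cons[of x w] by auto
  then show ?case
    using Cons shift_dist push_dist word_act_vertex hnn_words_Base by (cases x) auto
qed simp

lemma word_act_height: "height (word_act w u) - height u = height (word_act w v) - height v"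
proof (induction w)
  case (Cons x w)
  then show ?case by (cases x) (auto simp: push_height)
qed simp

abbreviation \<Gamma> :: "'a hnn_letter list set monoid" where
  "\<Gamma> \<equiv> HNN G A \<phi>"

definition cls :: "'a hnn_letter list \<Rightarrow> 'a hnn_letter list set" where
  "cls w = hnn_rel G A \<phi> `` {w}"

definition base :: "'a \<Rightarrow> 'a hnn_letter list set" where
  "base g = cls [Base g]"

definition stable :: "bool \<Rightarrow> 'a hnn_letter list set" where
  "stable e = cls [if e then Stable else Stable_inv]"

definition vertex_act :: "'a hnn_letter list set \<Rightarrow> ('a \<times> bool) list \<Rightarrow> ('a \<times> bool) list" where
  "vertex_act X = word_act (SOME w. w \<in> X)"

sublocale \<Gamma>: group \<Gamma>
  using group_HNN[OF is_group subset_A subset_phi] .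

lemma carrier_\<Gamma>: "carrier \<Gamma> = cls ` hnn_words G"
  by (auto simp: HNN_def quotient_def cls_def)

lemma one_\<Gamma>: "\<one>\<^bsub>\<Gamma>\<^esub> = cls []"
  by (simp add: HNN_def cls_def)

lemma cls_append: "\<lbrakk>u \<in> hnn_words G; v \<in> hnn_words G\<rbrakk> \<Longrightarrow> cls (u @ v) = cls u \<otimes>\<^bsub>\<Gamma>\<^esub> cls v"
  using HNN_mult_class[OF is_group subset_A subset_phi] by (simp add: cls_def)

lemma cls_eq: "(u, v) \<in> hnn_rel G A \<phi> \<Longrightarrow> cls u = cls v"
  using equiv_class_eq[OF equiv_hnn_rel[OF is_group subset_A subset_phi]] by (simp add: cls_def)

lemma cls_eqD: "\<lbrakk>cls u = cls v; u \<in> hnn_words G; v \<in> hnn_words G\<rbrakk> \<Longrightarrow> (u, v) \<in> hnn_rel G A \<phi>"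
  using eq_equiv_class_iff[OF equiv_hnn_rel[OF is_group subset_A subset_phi]] by (simp add: cls_def)

lemma base_closed [simp]: "g \<in> carrier G \<Longrightarrow> base g \<in> carrier \<Gamma>"
  by (auto simp: carrier_\<Gamma> base_def hnn_words_Base)

lemma stable_words: "[if e then Stable else Stable_inv] \<in> hnn_words G"
  by (auto simp: hnn_words_def)

lemma stable_closed [simp]: "stable e \<in> carrier \<Gamma>"
  using stable_words by (auto simp: carrier_\<Gamma> stable_def)

lemma base_mult: "\<lbrakk>g \<in> carrier G; k \<in> carrier G\<rbrakk> \<Longrightarrow> base (g \<otimes> k) = base g \<otimes>\<^bsub>\<Gamma>\<^esub> base k"
  using cls_append[of "[Base g]" "[Base k]"] cls_eq[OF hnn_rel.mult] by (simp add: base_def hnn_words_Base)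

lemma base_one: "base \<one> = \<one>\<^bsub>\<Gamma>\<^esub>"
  using cls_eq[OF hnn_rel.one] by (simp add: base_def one_\<Gamma>)

lemma base_inj: "\<lbrakk>g \<in> carrier G; k \<in> carrier G; base g = base k\<rbrakk> \<Longrightarrow> g = k"
  using word_act_rel[OF cls_eqD[of "[Base g]" "[Base k]"], of "[]"] by (simp add: base_def hnn_words_Base)

lemma base_inv: "g \<in> carrier G \<Longrightarrow> base (inv g) = inv\<^bsub>\<Gamma>\<^esub> base g"
  using \<Gamma>.inv_equality[of "base (inv g)" "base g"] base_mult[of "inv g" g] base_one by simp

lemma stable_cancel: "stable (\<not> e) \<otimes>\<^bsub>\<Gamma>\<^esub> stable e = \<one>\<^bsub>\<Gamma>\<^esub>"
proof -
  have w: "[Stable] \<in> hnn_words G" "[Stable_inv] \<in> hnn_words G" by (auto simp: hnn_words_def)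
  show ?thesis
    using cls_append[OF w(2,1)] cls_append[OF w] cls_eq[OF hnn_rel.left_inv] cls_eq[OF hnn_rel.right_inv]
    by (simp add: stable_def one_\<Gamma>)
qed

lemma stable_inv: "stable (\<not> e) = inv\<^bsub>\<Gamma>\<^esub> stable e"
  using \<Gamma>.inv_equality[OF stable_cancel] by simp

lemma stable_conj_True: "a \<in> A \<Longrightarrow> base a \<otimes>\<^bsub>\<Gamma>\<^esub> stable True = stable True \<otimes>\<^bsub>\<Gamma>\<^esub> base (\<phi> a)"
proof -
  assume a: "a \<in> A"
  then have c: "a \<in> carrier G" "\<phi> a \<in> carrier G" using subset_A subset_phi by auto
  have w: "[Stable] \<in> hnn_words G" "[Stable_inv] \<in> hnn_words G" "[Base a, Stable] \<in> hnn_words G"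
    using c by (auto simp: hnn_words_def)
  have "base (\<phi> a) = stable False \<otimes>\<^bsub>\<Gamma>\<^esub> (base a \<otimes>\<^bsub>\<Gamma>\<^esub> stable True)"
    using cls_eq[OF hnn_rel.conj[OF a]] cls_append[OF w(2,3)] cls_append[of "[Base a]" "[Stable]"] w c
    by (simp add: base_def stable_def hnn_words_Base)
  then show ?thesis
    using stable_inv[of True] \<Gamma>.inv_solve_left[of "base (\<phi> a)" "stable True" "base a \<otimes>\<^bsub>\<Gamma>\<^esub> stable True"] c by simp
qed

lemma stable_conj:
  assumes "h \<in> edge_group e"
  shows "base h \<otimes>\<^bsub>\<Gamma>\<^esub> stable e = stable e \<otimes>\<^bsub>\<Gamma>\<^esub> base (twist e h)"
proof (cases e)
  case True
  then show ?thesis using assms stable_conj_True by (simp add: edge_group_def twist_def)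
next
  case False
  define a where "a = twist False h"
  have h: "h \<in> edge_group False" using assms False by simp
  have a: "a \<in> A" "\<phi> a = h" using twist_mem[OF h] twist_twist[OF h] by (simp_all add: a_def edge_group_def twist_def)
  have c: "a \<in> carrier G" "h \<in> carrier G" using a subset_A assms edge_group_carrier by auto
  have "stable False \<otimes>\<^bsub>\<Gamma>\<^esub> (base a \<otimes>\<^bsub>\<Gamma>\<^esub> stable True) = base h"
    using stable_conj_True[OF a(1)] stable_inv[of True] \<Gamma>.inv_solve_left[of "base h" "stable True" "base a \<otimes>\<^bsub>\<Gamma>\<^esub> stable True"] c a(2) by simp
  then have "base h \<otimes>\<^bsub>\<Gamma>\<^esub> stable False = stable False \<otimes>\<^bsub>\<Gamma>\<^esub> base a \<otimes>\<^bsub>\<Gamma>\<^esub> (stable True \<otimes>\<^bsub>\<Gamma>\<^esub> stable False)"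
    using c by (metis \<Gamma>.m_assoc \<Gamma>.m_closed base_closed stable_closed)
  then show ?thesis using stable_cancel[of False] c False by (simp add: a_def)
qed

fun vertex_elt :: "('a \<times> bool) list \<Rightarrow> 'a hnn_letter list set" where
  "vertex_elt [] = \<one>\<^bsub>\<Gamma>\<^esub>"
| "vertex_elt ((c, e) # l) = base c \<otimes>\<^bsub>\<Gamma>\<^esub> stable e \<otimes>\<^bsub>\<Gamma>\<^esub> vertex_elt l"

lemma vertex_elt_closed: "vertex l \<Longrightarrow> vertex_elt l \<in> carrier \<Gamma>"
proof (induction l)
  case (Cons p l)
  then show ?case by (cases p) auto
qed simp

lemma base_vertex_elt:
  "\<lbrakk>g \<in> carrier G; vertex l\<rbrakk> \<Longrightarrow>
    base g \<otimes>\<^bsub>\<Gamma>\<^esub> vertex_elt l = vertex_elt (shift g l) \<otimes>\<^bsub>\<Gamma>\<^esub> base (carry g l)"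
proof (induction l arbitrary: g)
  case (Cons p l)
  obtain c e where p: "p = (c, e)" by force
  with Cons.prems have c: "c \<in> carrier G" "vertex l" by auto
  define r h where "r = rep e (g \<otimes> c)" and "h = inv r \<otimes> (g \<otimes> c)"
  have rh: "r \<in> carrier G" "h \<in> edge_group e" "h \<in> carrier G" "g \<otimes> c = r \<otimes> h" "residue e (g \<otimes> c) = twist e h"
    using Cons.prems c rep_mem[of "g \<otimes> c" e] edge_group_carrier rep_decompose[of "g \<otimes> c" e]
    by (auto simp: r_def h_def residue_def)
  have rr: "rep e (r \<otimes> h) = r" using rh(4) r_def by simp
  have tw: "twist e h \<in> carrier G" using rh twist_mem edge_group_carrier by blast
  note vc [simp] = vertex_elt_closed[OF c(2)] vertex_elt_closed[OF shift_vertex[OF tw c(2)]]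
    carry_closed[OF tw c(2)]
  have "base g \<otimes>\<^bsub>\<Gamma>\<^esub> vertex_elt (p # l) = base (g \<otimes> c) \<otimes>\<^bsub>\<Gamma>\<^esub> stable e \<otimes>\<^bsub>\<Gamma>\<^esub> vertex_elt l"
    using Cons.prems c by (simp add: p base_mult \<Gamma>.m_assoc)
  also have "\<dots> = base r \<otimes>\<^bsub>\<Gamma>\<^esub> (base h \<otimes>\<^bsub>\<Gamma>\<^esub> stable e) \<otimes>\<^bsub>\<Gamma>\<^esub> vertex_elt l"
    using rh by (simp add: base_mult \<Gamma>.m_assoc)
  also have "\<dots> = base r \<otimes>\<^bsub>\<Gamma>\<^esub> stable e \<otimes>\<^bsub>\<Gamma>\<^esub> (base (twist e h) \<otimes>\<^bsub>\<Gamma>\<^esub> vertex_elt l)"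
    using rh tw by (simp add: stable_conj \<Gamma>.m_assoc)
  also have "\<dots> = vertex_elt (shift g (p # l)) \<otimes>\<^bsub>\<Gamma>\<^esub> base (carry g (p # l))"
    using Cons.IH[OF tw c(2)] rh tw by (simp add: p \<Gamma>.m_assoc rr)
  finally show ?case .
qed simp

lemma stable_vertex_elt:
  assumes "vertex l"
  shows "stable e \<otimes>\<^bsub>\<Gamma>\<^esub> vertex_elt l = vertex_elt (push e l)"
proof (rule push_cases[OF assms, of e])
  fix l' assume l: "l = (\<one>, \<not> e) # l'" "push e l = l'"
  then have "vertex_elt l' \<in> carrier \<Gamma>" using assms vertex_elt_closed by simp
  then show ?thesis using l stable_cancel[of "\<not> e"] by (simp add: base_one \<Gamma>.m_assoc[symmetric])
qed (use assms vertex_elt_closed in \<open>simp add: base_one\<close>)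

text \<open>The action on normal forms agrees with multiplication in the group. Together with \<open>word_act_rel\<close> this is
  the normal form theorem for HNN-extensions.\<close>

lemma cls_vertex_elt:
  "\<lbrakk>w \<in> hnn_words G; vertex l\<rbrakk> \<Longrightarrow>
    cls w \<otimes>\<^bsub>\<Gamma>\<^esub> vertex_elt l = vertex_elt (word_act w l) \<otimes>\<^bsub>\<Gamma>\<^esub> base (word_carry w l)"
proof (induction w)
  case Nil
  then show ?case using vertex_elt_closed by (simp add: one_\<Gamma>[symmetric] base_one)
next
  case (Cons x w)
  have w: "[x] \<in> hnn_words G" "w \<in> hnn_words G" using Cons.prems hnn_words_Cons[of x w] by auto
  define m where "m = word_act w l"
  have m: "vertex m" "word_carry w l \<in> carrier G" using word_act_vertex word_carry_closed w Cons.prems by (auto simp: m_def)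
  have cl: "cls w \<in> carrier \<Gamma>" "cls [x] \<in> carrier \<Gamma>" using w by (auto simp: carrier_\<Gamma>)
  have step: "cls [x] \<otimes>\<^bsub>\<Gamma>\<^esub> vertex_elt m = vertex_elt (letter_act x m) \<otimes>\<^bsub>\<Gamma>\<^esub> base (letter_carry x m)"
  proof (cases x)
    case (Base g)
    then show ?thesis using base_vertex_elt[of g m] w m by (simp add: base_def[symmetric] hnn_words_Base)
  next
    case Stable
    then show ?thesis using stable_vertex_elt[OF m(1), of True] vertex_elt_closed push_vertex m
      by (simp add: stable_def base_one)
  next
    case Stable_inv
    then show ?thesis using stable_vertex_elt[OF m(1), of False] vertex_elt_closed push_vertex m
      by (simp add: stable_def base_one)
  qed
  have lc: "letter_carry x m \<in> carrier G" "vertex (letter_act x m)"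
    using word_act_vertex[OF w(1) m(1)] w m carry_closed hnn_words_Base by (cases x; auto)+
  have "cls (x # w) \<otimes>\<^bsub>\<Gamma>\<^esub> vertex_elt l = cls [x] \<otimes>\<^bsub>\<Gamma>\<^esub> (cls w \<otimes>\<^bsub>\<Gamma>\<^esub> vertex_elt l)"
    using cls_append[OF w] cl vertex_elt_closed Cons.prems by (simp add: \<Gamma>.m_assoc)
  also have "\<dots> = (cls [x] \<otimes>\<^bsub>\<Gamma>\<^esub> vertex_elt m) \<otimes>\<^bsub>\<Gamma>\<^esub> base (word_carry w l)"
    using Cons.IH w Cons.prems cl m vertex_elt_closed by (simp add: \<Gamma>.m_assoc m_def)
  also have "\<dots> = vertex_elt (word_act (x # w) l) \<otimes>\<^bsub>\<Gamma>\<^esub> base (word_carry (x # w) l)"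
    using step lc m vertex_elt_closed by (simp add: \<Gamma>.m_assoc base_mult m_def)
  finally show ?case .
qed

lemma vertex_act_cls:
  assumes "w \<in> hnn_words G" "vertex l"
  shows "vertex_act (cls w) l = word_act w l"
proof -
  have "w \<in> cls w" using assms hnn_rel.refl by (simp add: cls_def)
  then have "(SOME u. u \<in> cls w) \<in> cls w" by (rule someI)
  then have "(w, SOME u. u \<in> cls w) \<in> hnn_rel G A \<phi>" by (simp add: cls_def)
  from word_act_rel[OF this assms(2)] show ?thesis by (simp add: vertex_act_def)
qed

lemma vertex_act_base: "\<lbrakk>g \<in> carrier G; vertex l\<rbrakk> \<Longrightarrow> vertex_act (base g) l = shift g l"
  using vertex_act_cls[of "[Base g]" l] by (simp add: base_def hnn_words_Base)

lemma vertex_act_stable: "vertex l \<Longrightarrow> vertex_act (stable e) l = push e l"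
  using vertex_act_cls[OF stable_words, of l e] by (cases e) (auto simp: stable_def)

lemma vertex_act_closed: "\<lbrakk>X \<in> carrier \<Gamma>; vertex l\<rbrakk> \<Longrightarrow> vertex (vertex_act X l)"
  by (auto simp: carrier_\<Gamma> vertex_act_cls word_act_vertex)

lemma vertex_act_mult:
  "\<lbrakk>X \<in> carrier \<Gamma>; Y \<in> carrier \<Gamma>; vertex l\<rbrakk> \<Longrightarrow> vertex_act (X \<otimes>\<^bsub>\<Gamma>\<^esub> Y) l = vertex_act X (vertex_act Y l)"
  by (auto simp: carrier_\<Gamma> vertex_act_cls word_act_vertex cls_append[symmetric] hnn_words_append word_act_append)

lemma vertex_act_one: "vertex l \<Longrightarrow> vertex_act \<one>\<^bsub>\<Gamma>\<^esub> l = l"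
  using vertex_act_cls[of "[]" l] by (simp add: one_\<Gamma> hnn_words_def)

lemma vertex_act_elt: "vertex l \<Longrightarrow> vertex_act (vertex_elt l) [] = l"
proof (induction l)
  case Nil
  then show ?case by (simp add: vertex_act_one)
next
  case (Cons p l)
  obtain c e where p: "p = (c, e)" by force
  have l: "c \<in> carrier G" "rep e c = c" "vertex l" "vertex_elt l \<in> carrier \<Gamma>" "l = [] \<or> hd l \<noteq> (\<one>, \<not> e)"
    using Cons.prems p vertex_elt_closed by auto
  have "push e l = (\<one>, e) # l" using push_cases[OF l(3), of e] l(5) by fastforce
  then show ?case
    using Cons.IH l vertex_act_mult[of "base c \<otimes>\<^bsub>\<Gamma>\<^esub> stable e" "vertex_elt l" "[]"]
      vertex_act_mult[of "base c" "stable e" l] push_vertex[OF l(3), of e]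
    by (simp add: p vertex_act_stable vertex_act_base residue_rep shift_one)
qed

text \<open>If multiplication by \<open>X\<close> leaves the empty normal form empty, then all of \<open>X\<close> has been carried into \<open>G\<close>.\<close>

lemma stabilizer_root:
  assumes "X \<in> carrier \<Gamma>" "vertex_act X [] = []"
  shows "\<exists>g \<in> carrier G. X = base g"
proof -
  obtain w where w: "w \<in> hnn_words G" "X = cls w" using assms carrier_\<Gamma> by auto
  then have "word_act w [] = []" using assms vertex_act_cls by simp
  then have "X = base (word_carry w [])"
    using cls_vertex_elt[OF w(1), of "[]"] word_carry_closed[OF w(1), of "[]"] assms(1) w(2) by simp
  then show ?thesis using word_carry_closed[OF w(1), of "[]"] by auto
qed

sublocale graded_tree_action \<Gamma> "{l. vertex l}" vertex_act tree_dist height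
proof
  show "{l. vertex l} \<noteq> {}" by (auto intro: exI[of _ "[]"])
next
  show "even (tree_dist u v - (height u - height v))" for u v :: "('a \<times> bool) list"
    by (rule tree_dist_parity)
next
  fix u v assume uv: "u \<in> {l. vertex l}" "v \<in> {l. vertex l}" "u \<noteq> v"
  define X where "X = vertex_elt u"
  have X: "X \<in> carrier \<Gamma>" "vertex_act X [] = u" using uv vertex_elt_closed vertex_act_elt by (auto simp: X_def)
  obtain x where x: "x \<in> hnn_words G" "X = cls x" using X carrier_\<Gamma> by auto
  define v' where "v' = vertex_act (inv\<^bsub>\<Gamma>\<^esub> X) v"
  have v': "vertex v'" "vertex_act X v' = v"
    using X uv vertex_act_closed vertex_act_mult[of X "inv\<^bsub>\<Gamma>\<^esub> X" v] vertex_act_one by (auto simp: v'_def)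
  have "v' \<noteq> []" using X v' uv by auto
  then obtain c e l where l: "v' = (c, e) # l" by (metis list.exhaust prod.exhaust)
  have c: "vertex [(c, e)]" using v' l by simp
  have dX: "tree_dist (vertex_act X a) (vertex_act X b) = tree_dist a b" if "vertex a" "vertex b" for a b
    using word_act_dist[OF x(1) that] vertex_act_cls[OF x(1)] that x(2) by simp
  \<comment> \<open>At the root, the first step towards \<open>v'\<close> is its first entry.\<close>
  have "tree_dist u (vertex_act X [(c, e)]) = 1"
    using dX[of "[]" "[(c, e)]"] X c by (simp add: tree_dist_def)
  moreover have "tree_dist (vertex_act X [(c, e)]) v = tree_dist u v - 1"
    using dX[OF c v'(1)] dX[of "[]" v'] X v' l by (simp add: tree_dist_def)
  ultimately show "\<exists>w\<in>{l. vertex l}. tree_dist u w = 1 \<and> tree_dist w v = tree_dist u v - 1"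
    using vertex_act_closed[OF X(1) c] by blast
qed (auto simp: vertex_act_closed vertex_act_mult vertex_act_one tree_dist_eq_0_iff tree_dist_sym
    tree_dist_four_point carrier_\<Gamma> vertex_act_cls word_act_dist word_act_height)

end

section \<open>Stabilizers of vertices and edges\<close>

context hnn_extension
begin

lemma neighbor_of_root:
  assumes "vertex v" "tree_dist [] v = 1"
  obtains c e where "v = [(c, e)]" "c \<in> carrier G" "rep e c = c" "height v = (if e then 1 else - 1)"
proof -
  have "length v = 1" using assms(2) by (simp add: tree_dist_def)
  then obtain c e where v: "v = [(c, e)]" by (metis One_nat_def length_0_conv length_Suc_conv prod.exhaust)
  show thesis by (rule that[OF v]) (use assms v in auto)
qed

lemma base_fixes_root: "g \<in> carrier G \<Longrightarrow> vertex_act (base g) [] = []"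
  by (simp add: vertex_act_base)

lemma base_fixes_neighbor_iff:
  assumes "g \<in> carrier G" "c \<in> carrier G" "rep e c = c"
  shows "vertex_act (base g) [(c, e)] = [(c, e)] \<longleftrightarrow> inv c \<otimes> g \<otimes> c \<in> edge_group e"
  using rep_eq_iff[of "g \<otimes> c" c e] assms by (simp add: vertex_act_base m_assoc)

lemma transitive:
  assumes "vertex v"
  obtains W where "W \<in> carrier \<Gamma>" "vertex_act W [] = v"
  using vertex_elt_closed[OF assms] vertex_act_elt[OF assms] that by blast

lemma stabilizer_conj_base:
  assumes "W \<in> carrier \<Gamma>" "X \<in> carrier \<Gamma>" "vertex_act X (vertex_act W []) = vertex_act W []"
  obtains g where "g \<in> carrier G" "\<Gamma>.conj_by W X = base g"
  using assms stabilizer_root[of "\<Gamma>.conj_by W X"] conj_by_fixes_iff[of W X "[]"] by auto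

text \<open>After moving \<open>b\<close> to the root, an edge at \<open>b\<close> is a coset \<open>c\<close> of \<open>A\<close> if it goes up and of \<open>B\<close> if it goes
  down, and its stabilizer is the corresponding conjugate.\<close>

lemma edge_at_root:
  assumes W: "W \<in> carrier \<Gamma>" and b: "b = vertex_act W []" and v: "vertex v" "tree_dist b v = 1"
  obtains c e where "c \<in> carrier G" "rep e c = c" "v = vertex_act W [(c, e)]"
    "height v = height b + (if e then 1 else - 1)"
    "\<And>X g. \<lbrakk>X \<in> carrier \<Gamma>; g \<in> carrier G; \<Gamma>.conj_by W X = base g; vertex_act X v = v\<rbrakk>
      \<Longrightarrow> inv c \<otimes> g \<otimes> c \<in> edge_group e"
proof -
  define u where "u = vertex_act (inv\<^bsub>\<Gamma>\<^esub> W) v"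
  have u: "vertex u" "v = vertex_act W u"
    using W v vertex_act_closed act_inv_cancel(2)[of W v] by (auto simp: u_def)
  have "tree_dist [] u = 1" using dist_act[OF W, of "[]" u] u v(2) b by simp
  then obtain c e where c: "u = [(c, e)]" "c \<in> carrier G" "rep e c = c" "height u = (if e then 1 else - 1)"
    using neighbor_of_root u(1) by blast
  show thesis
  proof (rule that[OF c(2,3)])
    show "v = vertex_act W [(c, e)]" using u c by simp
    show "height v = height b + (if e then 1 else - 1)"
      using height_act[OF W, of "[]" u] u b c(4) by simp
    fix X g assume X: "X \<in> carrier \<Gamma>" "g \<in> carrier G" "\<Gamma>.conj_by W X = base g" "vertex_act X v = v"
    then have "vertex_act (base g) u = u" using conj_by_fixes_iff[OF W X(1), of u] u by simp
    then show "inv c \<otimes> g \<otimes> c \<in> edge_group e" using base_fixes_neighbor_iff[OF X(2) c(2,3)] c(1) by simp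
  qed
qed

end

text \<open>What both cases of the theorem need to know about \<open>G\<close>, \<open>A\<close> and \<open>B\<close>, in terms of elements.\<close>

locale csa_hnn_extension = hnn_extension +
  assumes base_csa: "\<lbrakk>g \<in> carrier G; g \<noteq> \<one>\<rbrakk> \<Longrightarrow> csa_element G g"
    and base_square: "\<lbrakk>g \<in> carrier G; g \<noteq> \<one>\<rbrakk> \<Longrightarrow> g \<otimes> g \<noteq> \<one>"
    and edge_group_comm: "\<lbrakk>x \<in> edge_group e; y \<in> edge_group e\<rbrakk> \<Longrightarrow> x \<otimes> y = y \<otimes> x"
    and A_malnormal: "\<lbrakk>x \<in> A; x' \<in> A; x \<noteq> \<one>; y \<in> carrier G; y \<otimes> x' = x \<otimes> y\<rbrakk> \<Longrightarrow> y \<in> A"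
begin

lemma edge_stabilizer_comm:
  assumes "vertex u" "vertex v" "tree_dist u v = 1" "X \<in> carrier \<Gamma>" "Y \<in> carrier \<Gamma>"
    and "vertex_act X u = u" "vertex_act X v = v" "vertex_act Y u = u" "vertex_act Y v = v"
  shows "X \<otimes>\<^bsub>\<Gamma>\<^esub> Y = Y \<otimes>\<^bsub>\<Gamma>\<^esub> X"
proof -
  obtain W where W: "W \<in> carrier \<Gamma>" "vertex_act W [] = u" using transitive assms(1) by blast
  obtain g where g: "g \<in> carrier G" "\<Gamma>.conj_by W X = base g" using stabilizer_conj_base[OF W(1) assms(4)] assms W by auto
  obtain k where k: "k \<in> carrier G" "\<Gamma>.conj_by W Y = base k" using stabilizer_conj_base[OF W(1) assms(5)] assms W by auto
  obtain c e where c: "c \<in> carrier G"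
    "\<And>X g. \<lbrakk>X \<in> carrier \<Gamma>; g \<in> carrier G; \<Gamma>.conj_by W X = base g; vertex_act X v = v\<rbrakk>
      \<Longrightarrow> inv c \<otimes> g \<otimes> c \<in> edge_group e"
    using edge_at_root[OF W(1) W(2)[symmetric] assms(2,3)] by metis
  have "conj_by c g \<in> edge_group e" "conj_by c k \<in> edge_group e"
    unfolding conj_by_def using c(2) g k assms by blast+
  then have "conj_by c (g \<otimes> k) = conj_by c (k \<otimes> g)"
    using edge_group_comm c(1) g(1) k(1) by (simp add: conj_by_mult)
  then have "g \<otimes> k = k \<otimes> g" using conj_by_eq_iff c(1) g(1) k(1) by simp
  then have "\<Gamma>.conj_by W (X \<otimes>\<^bsub>\<Gamma>\<^esub> Y) = \<Gamma>.conj_by W (Y \<otimes>\<^bsub>\<Gamma>\<^esub> X)"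
    using W assms g k by (simp add: \<Gamma>.conj_by_mult base_mult[symmetric])
  then show ?thesis using \<Gamma>.conj_by_eq_iff W assms by simp
qed

lemma stabilizer_square:
  assumes "X \<in> carrier \<Gamma>" "X \<noteq> \<one>\<^bsub>\<Gamma>\<^esub>" "vertex v" "vertex_act X v = v"
  shows "X \<otimes>\<^bsub>\<Gamma>\<^esub> X \<noteq> \<one>\<^bsub>\<Gamma>\<^esub>"
proof
  assume eq: "X \<otimes>\<^bsub>\<Gamma>\<^esub> X = \<one>\<^bsub>\<Gamma>\<^esub>"
  obtain W where W: "W \<in> carrier \<Gamma>" "vertex_act W [] = v" using transitive assms(3) by blast
  obtain g where g: "g \<in> carrier G" "\<Gamma>.conj_by W X = base g" using stabilizer_conj_base[OF W(1) assms(1)] assms W by auto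
  have "base (g \<otimes> g) = base \<one>"
    using \<Gamma>.conj_by_mult[OF W(1) assms(1,1)] \<Gamma>.conj_by_one_iff[OF W(1), of "\<one>\<^bsub>\<Gamma>\<^esub>"] eq g by (simp add: base_mult base_one)
  then have "g \<otimes> g = \<one>" using base_inj g by blast
  then have "g = \<one>" using base_square g by blast
  then show False using \<Gamma>.conj_by_one_iff[OF W(1) assms(1)] g assms(2) base_one by simp
qed

text \<open>A vertex \<open>v\<close> that is fixed by all elements in question reduces the claim to the stabilizer of \<open>v\<close>, which
  is a conjugate of the base group.\<close>

lemma csa_element_of_center:
  assumes X: "X \<in> carrier \<Gamma>" "X \<noteq> \<one>\<^bsub>\<Gamma>\<^esub>" and v: "vertex v"
    and cent: "\<And>Y. \<lbrakk>Y \<in> carrier \<Gamma>; X \<otimes>\<^bsub>\<Gamma>\<^esub> Y = Y \<otimes>\<^bsub>\<Gamma>\<^esub> X\<rbrakk> \<Longrightarrow> vertex_act Y v = v"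
    and conj: "\<And>Y X'. \<lbrakk>Y \<in> carrier \<Gamma>; X' \<in> carrier \<Gamma>; Y \<otimes>\<^bsub>\<Gamma>\<^esub> X' = X \<otimes>\<^bsub>\<Gamma>\<^esub> Y;
      X \<otimes>\<^bsub>\<Gamma>\<^esub> X' = X' \<otimes>\<^bsub>\<Gamma>\<^esub> X\<rbrakk> \<Longrightarrow> vertex_act Y v = v"
  shows "csa_element \<Gamma> X"
proof -
  obtain W where W: "W \<in> carrier \<Gamma>" "vertex_act W [] = v" using transitive v by blast
  have rb: "\<exists>g\<in>carrier G. \<Gamma>.conj_by W Y = base g" if "Y \<in> carrier \<Gamma>" "vertex_act Y v = v" for Y
  proof -
    have "vertex_act Y (vertex_act W []) = vertex_act W []" using that(2) unfolding W(2) .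
    from stabilizer_conj_base[OF W(1) that(1) this] show ?thesis by blast
  qed
  obtain g where g: "g \<in> carrier G" "\<Gamma>.conj_by W X = base g" using rb[OF X(1) cent[OF X(1) HOL.refl]] by blast
  have "g \<noteq> \<one>" using \<Gamma>.conj_by_one_iff[OF W(1) X(1)] g X(2) base_one by auto
  then have ge: "csa_element G g" using base_csa g by blast
  have eq: "K \<otimes>\<^bsub>\<Gamma>\<^esub> L = M \<otimes>\<^bsub>\<Gamma>\<^esub> N \<longleftrightarrow> k \<otimes> l = m \<otimes> n"
    if "K \<in> carrier \<Gamma>" "L \<in> carrier \<Gamma>" "M \<in> carrier \<Gamma>" "N \<in> carrier \<Gamma>"
      "k \<in> carrier G" "l \<in> carrier G" "m \<in> carrier G" "n \<in> carrier G"
      "\<Gamma>.conj_by W K = base k" "\<Gamma>.conj_by W L = base l" "\<Gamma>.conj_by W M = base m" "\<Gamma>.conj_by W N = base n"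
    for K L M N k l m n
  proof -
    have "K \<otimes>\<^bsub>\<Gamma>\<^esub> L = M \<otimes>\<^bsub>\<Gamma>\<^esub> N \<longleftrightarrow> base (k \<otimes> l) = base (m \<otimes> n)"
      using that W \<Gamma>.conj_by_eq_iff[OF W(1), of "K \<otimes>\<^bsub>\<Gamma>\<^esub> L" "M \<otimes>\<^bsub>\<Gamma>\<^esub> N"]
      by (simp add: \<Gamma>.conj_by_mult base_mult)
    then show ?thesis using base_inj that by auto
  qed
  show ?thesis
  proof (rule csa_elementI)
    fix Y Z assume YZ: "Y \<in> carrier \<Gamma>" "Z \<in> carrier \<Gamma>" "X \<otimes>\<^bsub>\<Gamma>\<^esub> Y = Y \<otimes>\<^bsub>\<Gamma>\<^esub> X" "X \<otimes>\<^bsub>\<Gamma>\<^esub> Z = Z \<otimes>\<^bsub>\<Gamma>\<^esub> X"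
    obtain y where y: "y \<in> carrier G" "\<Gamma>.conj_by W Y = base y" using rb[OF YZ(1) cent[OF YZ(1,3)]] by blast
    obtain z where z: "z \<in> carrier G" "\<Gamma>.conj_by W Z = base z" using rb[OF YZ(2) cent[OF YZ(2,4)]] by blast
    have gy: "g \<otimes> y = y \<otimes> g"
      using eq[OF X(1) YZ(1) YZ(1) X(1) g(1) y(1) y(1) g(1) g(2) y(2) y(2) g(2)] YZ(3) by blast
    have gz: "g \<otimes> z = z \<otimes> g"
      using eq[OF X(1) YZ(2) YZ(2) X(1) g(1) z(1) z(1) g(1) g(2) z(2) z(2) g(2)] YZ(4) by blast
    have "y \<otimes> z = z \<otimes> y" by (rule csa_element_centralizer[OF ge y(1) z(1) gy gz])
    then show "Y \<otimes>\<^bsub>\<Gamma>\<^esub> Z = Z \<otimes>\<^bsub>\<Gamma>\<^esub> Y"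
      using eq[OF YZ(1,2,2,1) y(1) z(1) z(1) y(1) y(2) z(2) z(2) y(2)] by blast
  next
    fix Y X' assume Y: "Y \<in> carrier \<Gamma>" "X' \<in> carrier \<Gamma>" "Y \<otimes>\<^bsub>\<Gamma>\<^esub> X' = X \<otimes>\<^bsub>\<Gamma>\<^esub> Y" "X \<otimes>\<^bsub>\<Gamma>\<^esub> X' = X' \<otimes>\<^bsub>\<Gamma>\<^esub> X"
    obtain y where y: "y \<in> carrier G" "\<Gamma>.conj_by W Y = base y" using rb[OF Y(1) conj[OF Y]] by blast
    obtain x where x: "x \<in> carrier G" "\<Gamma>.conj_by W X' = base x" using rb[OF Y(2) cent[OF Y(2,4)]] by blast
    have yx: "y \<otimes> x = g \<otimes> y"
      using eq[OF Y(1,2) X(1) Y(1) y(1) x(1) g(1) y(1) y(2) x(2) g(2) y(2)] Y(3) by blast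
    have gx: "g \<otimes> x = x \<otimes> g"
      using eq[OF X(1) Y(2,2) X(1) g(1) x(1) x(1) g(1) g(2) x(2) x(2) g(2)] Y(4) by blast
    have "g \<otimes> y = y \<otimes> g" by (rule csa_element_conjugate[OF ge y(1) x(1) yx gx])
    then show "X \<otimes>\<^bsub>\<Gamma>\<^esub> Y = Y \<otimes>\<^bsub>\<Gamma>\<^esub> X"
      using eq[OF X(1) Y(1,1) X(1) g(1) y(1) y(1) g(1) g(2) y(2) y(2) g(2)] by blast
  qed
qed

lemma csa_star_if_elliptic:
  assumes "\<And>X v. \<lbrakk>X \<in> carrier \<Gamma>; X \<noteq> \<one>\<^bsub>\<Gamma>\<^esub>; vertex v; vertex_act X v = v\<rbrakk> \<Longrightarrow> csa_element \<Gamma> X"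
  shows "csa_star_group \<Gamma>"
proof -
  interpret csa_tree_action \<Gamma> "{l. vertex l}" vertex_act tree_dist height
    by unfold_locales (use assms edge_stabilizer_comm stabilizer_square in auto)
  show ?thesis by (rule csa_star)
qed

text \<open>Every argument about fixed sets below is local. This lemma translates two edges at \<open>b\<close> with a common
  nontrivial stabilizing element into two conjugates, by \<open>c\<close> and \<open>c'\<close>, of one element of \<open>G\<close> that lie in
  associated subgroups.\<close>

lemma fixed_edges_at_vertex:
  assumes X: "X \<in> carrier \<Gamma>" "X \<noteq> \<one>\<^bsub>\<Gamma>\<^esub>"
    and b: "vertex b" "vertex_act X b = b"
    and u: "vertex u" "tree_dist b u = 1" "vertex_act X u = u"
    and v: "vertex v" "tree_dist b v = 1" "vertex_act X v = v"
  obtains g c c' e e' where "g \<in> carrier G" "g \<noteq> \<one>" "c \<in> carrier G" "c' \<in> carrier G"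
    "inv c \<otimes> g \<otimes> c \<in> edge_group e" "inv c' \<otimes> g \<otimes> c' \<in> edge_group e'"
    "height u = height b + (if e then 1 else - 1)" "height v = height b + (if e' then 1 else - 1)"
    "e = e' \<Longrightarrow> inv c \<otimes> c' \<in> edge_group e \<Longrightarrow> u = v"
proof -
  obtain W where W: "W \<in> carrier \<Gamma>" "vertex_act W [] = b" using transitive b(1) by blast
  obtain g where g: "g \<in> carrier G" "\<Gamma>.conj_by W X = base g" using stabilizer_conj_base[OF W(1) X(1)] b W by auto
  have g1: "g \<noteq> \<one>" using \<Gamma>.conj_by_one_iff[OF W(1) X(1)] g X(2) base_one by auto
  obtain c e where c: "c \<in> carrier G" "rep e c = c" "u = vertex_act W [(c, e)]"
    "height u = height b + (if e then 1 else - 1)" "inv c \<otimes> g \<otimes> c \<in> edge_group e"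
    using edge_at_root[OF W(1) W(2)[symmetric] u(1,2)] X(1) g u(3) by metis
  obtain c' e' where c': "c' \<in> carrier G" "rep e' c' = c'" "v = vertex_act W [(c', e')]"
    "height v = height b + (if e' then 1 else - 1)" "inv c' \<otimes> g \<otimes> c' \<in> edge_group e'"
    using edge_at_root[OF W(1) W(2)[symmetric] v(1,2)] X(1) g v(3) by metis
  show thesis
  proof (rule that[OF g(1) g1 c(1) c'(1) c(5) c'(5) c(4) c'(4)])
    assume "e = e'" "inv c \<otimes> c' \<in> edge_group e"
    then have "c = c'" using rep_eq_iff[OF c'(1) c(1,2)] c'(2) by simp
    then show "u = v" using \<open>e = e'\<close> c c' by simp
  qed
qed

section \<open>Separated HNN-extensions\<close>

text \<open>Nontrivial elements fix only small subtrees: two edges at a vertex \<open>b\<close> with a common nontrivial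
  stabilizing element both go down, since \<open>A\<close> is malnormal and meets every conjugate of \<open>B\<close> trivially. So the fixed set is a star
  below its unique highest vertex.\<close>

context
  assumes separated: "\<And>g x. \<lbrakk>g \<in> carrier G; x \<in> A; g \<otimes> x \<otimes> inv g \<in> B\<rbrakk> \<Longrightarrow> x = \<one>"
begin

lemma separated_peak:
  assumes X: "X \<in> carrier \<Gamma>" "X \<noteq> \<one>\<^bsub>\<Gamma>\<^esub>"
    and b: "vertex b" "vertex_act X b = b"
    and u: "vertex u" "tree_dist b u = 1" "vertex_act X u = u"
    and v: "vertex v" "tree_dist b v = 1" "vertex_act X v = v"
    and "u \<noteq> v"
  shows "height u = height b - 1 \<and> height v = height b - 1"
proof -
  obtain g c c' e e' where *: "g \<in> carrier G" "g \<noteq> \<one>" "c \<in> carrier G" "c' \<in> carrier G"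
    "inv c \<otimes> g \<otimes> c \<in> edge_group e" "inv c' \<otimes> g \<otimes> c' \<in> edge_group e'"
    "height u = height b + (if e then 1 else - 1)" "height v = height b + (if e' then 1 else - 1)"
    "e = e' \<Longrightarrow> inv c \<otimes> c' \<in> edge_group e \<Longrightarrow> u = v"
    using fixed_edges_at_vertex[OF X b u v] by metis
  have ne: "conj_by c g \<noteq> \<one>" "conj_by c' g \<noteq> \<one>" using * conj_by_one_iff by auto
  \<comment> \<open>The two conjugates of \<open>g\<close> are conjugate to each other by \<open>inv p \<otimes> q\<close>.\<close>
  have tr: "conj_by (inv p \<otimes> q) (conj_by p g) = conj_by q g" if "p \<in> carrier G" "q \<in> carrier G" for p q
  proof -
    have "conj_by (inv p \<otimes> q) (conj_by p g) = inv q \<otimes> conj_by (inv p) (conj_by p g) \<otimes> q"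
      using that * by (simp add: conj_by_def inv_mult_group m_assoc inv_cancel_left)
    then show ?thesis using that * by (simp add: conj_by_inv) (simp add: conj_by_def)
  qed
  have not_mixed: False if "p \<in> carrier G" "q \<in> carrier G" "conj_by p g \<in> A" "conj_by q g \<in> B" "conj_by p g \<noteq> \<one>" for p q
  proof -
    have "inv (inv p \<otimes> q) \<otimes> conj_by p g \<otimes> inv (inv (inv p \<otimes> q)) \<in> B"
      using tr[OF that(1,2)] that by (simp add: conj_by_def)
    then show False using separated[of "inv (inv p \<otimes> q)" "conj_by p g"] that by simp
  qed
  have "\<not> (e \<and> \<not> e')" using not_mixed[of c c'] * ne by (auto simp: conj_by_def edge_group_def split: if_splits)
  moreover have "\<not> (\<not> e \<and> e')" using not_mixed[of c' c] * ne by (auto simp: conj_by_def edge_group_def split: if_splits)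
  moreover have "\<not> (e \<and> e')"
  proof
    assume e: "e \<and> e'"
    then have A: "conj_by c g \<in> A" "conj_by c' g \<in> A" using * by (auto simp: conj_by_def edge_group_def)
    define y where "y = inv c \<otimes> c'"
    have y: "y \<in> carrier G" using * by (simp add: y_def)
    have cg: "conj_by c g \<in> carrier G" "conj_by c' g \<in> carrier G" using * by auto
    have "y \<otimes> conj_by c' g = conj_by c g \<otimes> y"
      using tr[OF *(3,4)] conj_eq_iff[OF cg(1) y cg(2)] by (simp add: y_def conj_by_def)
    then have "y \<in> A" using A_malnormal[OF A ne(1) y] by blast
    then show False using * e assms by (auto simp: y_def edge_group_def)
  qed
  ultimately show ?thesis using * by auto
qed

text \<open>Two consecutive inner vertices of a fixed path would both have to be higher than the other one.\<close>

lemma separated_fixed_dist: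
  assumes X: "X \<in> carrier \<Gamma>" "X \<noteq> \<one>\<^bsub>\<Gamma>\<^esub>"
    and u: "vertex u" "vertex_act X u = u" and v: "vertex v" "vertex_act X v = v"
  shows "tree_dist u v \<le> 2" 
    and "tree_dist u v = 2 \<Longrightarrow> \<exists>m. vertex m \<and> vertex_act X m = m \<and> height u = height m - 1 \<and> height v = height m - 1"
proof -
  obtain p where p: "p 0 = u" "p (tree_dist u v) = v" "\<And>i. i \<in> {0..tree_dist u v} \<Longrightarrow> vertex (p i)"
    "\<And>i j. i \<in> {0..tree_dist u v} \<Longrightarrow> j \<in> {0..tree_dist u v} \<Longrightarrow> tree_dist (p i) (p j) = \<bar>i - j\<bar>"
    using geodesic_exists[of u v] u v by auto
  have fix': "vertex_act X (p i) = p i" if "i \<in> {0..tree_dist u v}" for i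
    using fixes_between[OF X(1), of u v "p i"] u v p(1,2) p(3)[OF that] p(4)[of 0 i] p(4)[of i "tree_dist u v"] that
    by simp
  have peak: "height (p (i - 1)) = height (p i) - 1 \<and> height (p (i + 1)) = height (p i) - 1"
    if i: "i - 1 \<in> {0..tree_dist u v}" "i + 1 \<in> {0..tree_dist u v}" for i
  proof -
    have ii: "i \<in> {0..tree_dist u v}" using i by simp
    have "tree_dist (p (i - 1)) (p (i + 1)) = 2" using p(4)[OF i] by simp
    then have "p (i - 1) \<noteq> p (i + 1)" using tree_dist_eq_0_iff[of "p (i - 1)" "p (i + 1)"] by auto
    then show ?thesis
      using separated_peak[OF X p(3)[OF ii] fix'[OF ii] p(3)[OF i(1)] _ fix'[OF i(1)] p(3)[OF i(2)] _ fix'[OF i(2)]]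
        p(4)[OF ii i(1)] p(4)[OF ii i(2)] by simp
  qed
  show "tree_dist u v \<le> 2"
  proof (rule ccontr)
    assume "\<not> tree_dist u v \<le> 2"
    then show False using peak[of 1] peak[of 2] by simp
  qed
  show "\<exists>m. vertex m \<and> vertex_act X m = m \<and> height u = height m - 1 \<and> height v = height m - 1"
    if "tree_dist u v = 2"
    using that peak[of 1] p(1,2) p(3)[of 1] fix'[of 1] by auto
qed

lemma separated_top:
  assumes X: "X \<in> carrier \<Gamma>" "X \<noteq> \<one>\<^bsub>\<Gamma>\<^esub>" and u: "vertex u" "vertex_act X u = u"
  obtains T where "vertex T" "vertex_act X T = T"
    "\<And>w. \<lbrakk>vertex w; vertex_act X w = w\<rbrakk> \<Longrightarrow> height w \<le> height T"
    "\<And>w. \<lbrakk>vertex w; vertex_act X w = w; height w = height T\<rbrakk> \<Longrightarrow> w = T"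
proof -
  define P where "P w \<longleftrightarrow> vertex w \<and> vertex_act X w = w" for w
  define f where "f w = nat (height w - height u + 2)" for w :: "('a \<times> bool) list"
  have near: "\<bar>height w - height u\<bar> \<le> 2" if "P w" for w
    using height_diff_le_dist[of w u] separated_fixed_dist(1)[OF X, of w u] that u by (simp add: P_def)
  have "\<exists>T. P T \<and> (\<forall>w. P w \<longrightarrow> f w \<le> f T)"
  proof (rule ex_has_greatest_nat[of P u])
    show "P u" using u by (simp add: P_def)
    show "\<forall>w. P w \<longrightarrow> f w < 5" using near by (fastforce simp: f_def)
  qed
  then obtain T where T: "P T" "\<And>w. P w \<Longrightarrow> f w \<le> f T" by blast
  have max: "height w \<le> height T" if "P w" for w
    using T(2)[OF that] near[OF that] near[OF T(1)] by (simp add: f_def)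
  have "w = T" if w: "P w" "height w = height T" for w
  proof (rule ccontr)
    assume "w \<noteq> T"
    then have "tree_dist w T \<noteq> 0" using tree_dist_eq_0_iff[of w T] by simp
    moreover have "tree_dist w T \<le> 2" using separated_fixed_dist(1)[OF X] w T by (auto simp: P_def)
    moreover have "tree_dist w T \<ge> 0" using dist_nonneg w T by (auto simp: P_def)
    moreover have "even (tree_dist w T)" using tree_dist_parity[of w T] w(2) by simp
    ultimately have "tree_dist w T = 2" by presburger
    then obtain m where "P m" "height T = height m - 1"
      using separated_fixed_dist(2)[OF X] w T unfolding P_def by blast
    then show False using max by fastforce
  qed
  then show thesis using that T(1) max unfolding P_def by blast
qed

text \<open>The centre is the highest fixed vertex \<open>T\<close>. An element \<open>Y\<close> that centralizes \<open>X\<close> permutes the fixed set and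
  shifts heights by a constant, so it fixes \<open>T\<close>. If \<open>X\<close> commutes with its conjugate by \<open>Y\<close>, it also commutes with
  the conjugate by \<open>Y\<^sup>-\<^sup>1\<close>; both conjugates therefore fix \<open>T\<close>, so \<open>X\<close> fixes the images of \<open>T\<close> under \<open>Y\<close> and
  \<open>Y\<^sup>-\<^sup>1\<close>, and neither of them is higher than \<open>T\<close>.\<close>

lemma separated_elliptic_csa:
  assumes X: "X \<in> carrier \<Gamma>" "X \<noteq> \<one>\<^bsub>\<Gamma>\<^esub>" and u: "vertex u" "vertex_act X u = u"
  shows "csa_element \<Gamma> X"
proof -
  obtain T where T: "vertex T" "vertex_act X T = T"
    "\<And>w. \<lbrakk>vertex w; vertex_act X w = w\<rbrakk> \<Longrightarrow> height w \<le> height T"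
    "\<And>w. \<lbrakk>vertex w; vertex_act X w = w; height w = height T\<rbrakk> \<Longrightarrow> w = T"
    using separated_top[OF X u] by blast
  \<comment> \<open>An element that shifts \<open>T\<close> within the fixed set of \<open>X\<close> in both directions fixes \<open>T\<close>.\<close>
  have both: "vertex_act Y T = T" if Y: "Y \<in> carrier \<Gamma>"
    "vertex_act X (vertex_act Y T) = vertex_act Y T"
    "vertex_act X (vertex_act (inv\<^bsub>\<Gamma>\<^esub> Y) T) = vertex_act (inv\<^bsub>\<Gamma>\<^esub> Y) T" for Y
  proof -
    have v: "vertex (vertex_act Y T)" "vertex (vertex_act (inv\<^bsub>\<Gamma>\<^esub> Y) T)"
      using Y(1) T(1) vertex_act_closed by auto
    have "height (vertex_act Y T) - height T
        = height (vertex_act Y (vertex_act (inv\<^bsub>\<Gamma>\<^esub> Y) T)) - height (vertex_act (inv\<^bsub>\<Gamma>\<^esub> Y) T)"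
      using height_act[OF Y(1), of T "vertex_act (inv\<^bsub>\<Gamma>\<^esub> Y) T"] v T(1) by simp
    then have "height (vertex_act Y T) - height T = height T - height (vertex_act (inv\<^bsub>\<Gamma>\<^esub> Y) T)"
      using act_inv_cancel(2)[OF Y(1), of T] T(1) by simp
    then have "height (vertex_act Y T) = height T" using T(3)[OF v(1) Y(2)] T(3)[OF v(2) Y(3)] by simp
    then show ?thesis using T(4)[OF v(1) Y(2)] by blast
  qed
  have moves: "vertex_act X (vertex_act Y T) = vertex_act Y T"
    if "Y \<in> carrier \<Gamma>" "X \<otimes>\<^bsub>\<Gamma>\<^esub> Y = Y \<otimes>\<^bsub>\<Gamma>\<^esub> X" for Y
    using commuting_fixes[OF X(1) that(1) X(1) that(2)[symmetric], of T] T(1,2) by simp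
  have cent: "vertex_act Y T = T" if Y: "Y \<in> carrier \<Gamma>" "X \<otimes>\<^bsub>\<Gamma>\<^esub> Y = Y \<otimes>\<^bsub>\<Gamma>\<^esub> X" for Y
    using both[OF Y(1) moves[OF Y] moves] \<Gamma>.inv_commutes[OF Y(1) X(1) Y(2)[symmetric]] Y(1) by simp
  show ?thesis
  proof (rule csa_element_of_center[OF X T(1) cent])
    fix Y X' assume Y: "Y \<in> carrier \<Gamma>" "X' \<in> carrier \<Gamma>" "Y \<otimes>\<^bsub>\<Gamma>\<^esub> X' = X \<otimes>\<^bsub>\<Gamma>\<^esub> Y" "X \<otimes>\<^bsub>\<Gamma>\<^esub> X' = X' \<otimes>\<^bsub>\<Gamma>\<^esub> X"
    define Z where "Z = \<Gamma>.conj_by (inv\<^bsub>\<Gamma>\<^esub> Y) X"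
    have X': "X' = \<Gamma>.conj_by Y X" using \<Gamma>.conj_eq_iff[OF X(1) Y(1,2)] Y(3) by (simp add: \<Gamma>.conj_by_def)
    have Z: "Z \<in> carrier \<Gamma>" using X Y by (simp add: Z_def)
    have "\<Gamma>.conj_by (inv\<^bsub>\<Gamma>\<^esub> Y) (X \<otimes>\<^bsub>\<Gamma>\<^esub> X') = Z \<otimes>\<^bsub>\<Gamma>\<^esub> X" "\<Gamma>.conj_by (inv\<^bsub>\<Gamma>\<^esub> Y) (X' \<otimes>\<^bsub>\<Gamma>\<^esub> X) = X \<otimes>\<^bsub>\<Gamma>\<^esub> Z"
      using X Y(1,2) by (simp_all add: \<Gamma>.conj_by_mult Z_def X' \<Gamma>.conj_by_inv)
    then have "X \<otimes>\<^bsub>\<Gamma>\<^esub> Z = Z \<otimes>\<^bsub>\<Gamma>\<^esub> X" using Y(4) by simp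
    then have "vertex_act Z T = T" using cent Z by blast
    then have "vertex_act X (vertex_act (inv\<^bsub>\<Gamma>\<^esub> Y) T) = vertex_act (inv\<^bsub>\<Gamma>\<^esub> Y) T"
      unfolding Z_def using conj_by_fixes_iff[of "inv\<^bsub>\<Gamma>\<^esub> Y" X T] X Y T(1) by simp
    moreover have "vertex_act X (vertex_act Y T) = vertex_act Y T"
      using commuting_fixes[OF X(1) Y(1,2,3), of T] cent[OF Y(2,4)] T(1) by simp
    ultimately show "vertex_act Y T = T" using both[OF Y(1)] by blast
  qed
qed

end

end

section \<open>Extensions of a centralizer\<close>

text \<open>If \<open>\<phi>\<close> is conjugation by \<open>s\<close>, then \<open>t = (stable letter) s\<^sup>-\<^sup>1\<close> commutes with \<open>A\<close>. A nontrivial element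
  of \<open>A\<close> then fixes precisely the orbit of the root under the powers of \<open>t\<close>, a line that climbs by one
  level at each step.\<close>

locale centralizer_extension = csa_hnn_extension +
  fixes s
  assumes s_closed: "s \<in> carrier G"
    and B_conj: "B = conjugate_set G A s"
    and phi_conj: "a \<in> A \<Longrightarrow> \<phi> a = inv s \<otimes> a \<otimes> s"
begin

definition t :: "'a hnn_letter list set" where
  "t = stable True \<otimes>\<^bsub>\<Gamma>\<^esub> base (inv s)"

lemma t_closed [simp]: "t \<in> carrier \<Gamma>"
  using s_closed by (simp add: t_def)

lemma t_pow_closed [simp]: "t [^]\<^bsub>\<Gamma>\<^esub> (k::int) \<in> carrier \<Gamma>"
  by simp

lemma t_commutes:
  assumes "a \<in> A"
  shows "base a \<otimes>\<^bsub>\<Gamma>\<^esub> t = t \<otimes>\<^bsub>\<Gamma>\<^esub> base a"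
proof -
  have c: "a \<in> carrier G" "\<phi> a \<in> carrier G" using assms subset_A subset_phi by auto
  have "\<phi> a \<otimes> inv s = inv s \<otimes> a"
    unfolding phi_conj[OF assms] using c(1) s_closed by (simp add: m_assoc)
  then have eq: "base (\<phi> a) \<otimes>\<^bsub>\<Gamma>\<^esub> base (inv s) = base (inv s) \<otimes>\<^bsub>\<Gamma>\<^esub> base a"
    using c s_closed by (simp add: base_mult[symmetric])
  have "base a \<otimes>\<^bsub>\<Gamma>\<^esub> t = (base a \<otimes>\<^bsub>\<Gamma>\<^esub> stable True) \<otimes>\<^bsub>\<Gamma>\<^esub> base (inv s)"
    using c s_closed by (simp add: t_def \<Gamma>.m_assoc)
  also have "\<dots> = stable True \<otimes>\<^bsub>\<Gamma>\<^esub> (base (\<phi> a) \<otimes>\<^bsub>\<Gamma>\<^esub> base (inv s))"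
    unfolding stable_conj_True[OF assms] using c s_closed by (simp add: \<Gamma>.m_assoc)
  also have "\<dots> = t \<otimes>\<^bsub>\<Gamma>\<^esub> base a"
    unfolding eq using c s_closed by (simp add: t_def \<Gamma>.m_assoc)
  finally show ?thesis .
qed

lemma t_pow_commutes:
  assumes "a \<in> A"
  shows "base a \<otimes>\<^bsub>\<Gamma>\<^esub> t [^]\<^bsub>\<Gamma>\<^esub> (k::int) = t [^]\<^bsub>\<Gamma>\<^esub> k \<otimes>\<^bsub>\<Gamma>\<^esub> base a"
proof -
  have a: "base a \<in> carrier \<Gamma>" using assms subset_A by auto
  have n: "base a \<otimes>\<^bsub>\<Gamma>\<^esub> t [^]\<^bsub>\<Gamma>\<^esub> n = t [^]\<^bsub>\<Gamma>\<^esub> n \<otimes>\<^bsub>\<Gamma>\<^esub> base a" for n :: nat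
  proof (induction n)
    case (Suc n)
    have "t [^]\<^bsub>\<Gamma>\<^esub> n \<in> carrier \<Gamma>" by simp
    from \<Gamma>.mult_commutes[OF a this t_closed Suc.IH t_commutes[OF assms]]
    show ?case unfolding \<Gamma>.nat_pow_Suc .
  qed (use a in simp)
  show ?thesis
  proof (cases k rule: int_cases2)
    case (nonneg m)
    show ?thesis unfolding nonneg int_pow_int by (rule n)
  next
    case (nonpos m)
    have "t [^]\<^bsub>\<Gamma>\<^esub> m \<in> carrier \<Gamma>" by simp
    then show ?thesis
      unfolding nonpos \<Gamma>.int_pow_neg_int[OF t_closed] by (rule \<Gamma>.inv_commutes[OF _ a n[symmetric]])
  qed
qed

definition axis :: "int \<Rightarrow> ('a \<times> bool) list" where
  "axis k = vertex_act (t [^]\<^bsub>\<Gamma>\<^esub> k) []"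

lemma axis_vertex [simp]: "vertex (axis k)"
  by (simp add: axis_def vertex_act_closed)

lemma axis_zero: "axis 0 = []"
  by (simp add: axis_def vertex_act_one)

lemma t_root: "vertex_act t [] = push True []"
  using s_closed vertex_act_mult[of "stable True" "base (inv s)" "[]"]
  by (simp add: t_def vertex_act_base vertex_act_stable)

lemma axis_step: "axis (k + 1) = vertex_act (t [^]\<^bsub>\<Gamma>\<^esub> k) (push True [])"
proof -
  have "t [^]\<^bsub>\<Gamma>\<^esub> (k + 1) = t [^]\<^bsub>\<Gamma>\<^esub> k \<otimes>\<^bsub>\<Gamma>\<^esub> t" using \<Gamma>.int_pow_mult[OF t_closed, of k 1] by simp
  then show ?thesis using vertex_act_mult[of "t [^]\<^bsub>\<Gamma>\<^esub> k" t "[]"] t_root by (simp add: axis_def)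
qed

lemma axis_adjacent: "tree_dist (axis k) (axis (k + 1)) = 1"
  unfolding axis_step unfolding axis_def
  using dist_act[OF t_pow_closed, of "[]" "push True []" k] push_vertex[of "[]" True]
  by (simp add: tree_dist_def)

lemma axis_height_step: "height (axis (k + 1)) = height (axis k) + 1"
  unfolding axis_step unfolding axis_def
  using height_act[OF t_pow_closed, of "[]" "push True []" k] push_vertex[of "[]" True] by simp

lemma axis_height: "height (axis k) = k"
proof (induction k rule: int_induct[of _ 0])
  case base
  then show ?case by (simp add: axis_zero)
next
  case (step1 i)
  then show ?case using axis_height_step[of i] by simp
next
  case (step2 i)
  then show ?case using axis_height_step[of "i - 1"] by simp
qed

lemma base_fixes_axis:
  assumes "a \<in> A"
  shows "vertex_act (base a) (axis k) = axis k"
proof -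
  have a: "a \<in> carrier G" using assms subset_A by auto
  show ?thesis
    unfolding axis_def
    using commuting_fixes[OF base_closed[OF a] t_pow_closed base_closed[OF a] t_pow_commutes[OF assms, symmetric], of "[]"]
      base_fixes_root[OF a] by simp
qed

lemma edge_group_malnormal:
  assumes "x \<in> edge_group e" "x' \<in> edge_group e" "x \<noteq> \<one>" "y \<in> carrier G" "y \<otimes> x' = x \<otimes> y"
  shows "y \<in> edge_group e"
proof (cases e)
  case True
  then show ?thesis using A_malnormal[OF _ _ assms(3-5)] assms(1,2) by (simp add: edge_group_def)
next
  case False
  let ?f = "conj_by (inv s)"
  have mem: "z \<in> B \<longleftrightarrow> z \<in> carrier G \<and> ?f z \<in> A" for z
    unfolding B_conj mem_conjugate_set[OF subset_A s_closed] conj_by_def using s_closed by simp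
  have "x \<in> B" "x' \<in> B" using assms(1,2) False by (simp_all add: edge_group_def)
  then have x: "x \<in> carrier G" "x' \<in> carrier G" "?f x \<in> A" "?f x' \<in> A" unfolding mem by blast+
  have si: "inv s \<in> carrier G" using s_closed by simp
  have eq: "?f y \<otimes> ?f x' = ?f x \<otimes> ?f y"
    unfolding conj_by_mult[OF si assms(4) x(2), symmetric] conj_by_mult[OF si x(1) assms(4), symmetric]
      assms(5) ..
  have "?f x \<noteq> \<one>" using conj_by_one_iff[OF si x(1)] assms(3) by blast
  then have "?f y \<in> A" using A_malnormal[OF x(3,4) _ conj_by_closed[OF si assms(4)] eq] by blast
  then have "y \<in> B" unfolding mem using assms(4) by blast
  then show ?thesis using False by (simp add: edge_group_def)
qed

text \<open>\<open>A\<close> and its conjugate \<open>B\<close> are both malnormal, so a nontrivial element fixes at most one edge upwards and one edge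
  downwards at each vertex.\<close>

lemma fixed_neighbor_unique:
  assumes X: "X \<in> carrier \<Gamma>" "X \<noteq> \<one>\<^bsub>\<Gamma>\<^esub>"
    and b: "vertex b" "vertex_act X b = b"
    and u: "vertex u" "tree_dist b u = 1" "vertex_act X u = u"
    and v: "vertex v" "tree_dist b v = 1" "vertex_act X v = v"
    and "height u = height v"
  shows "u = v"
proof -
  obtain g c c' e e' where *: "g \<in> carrier G" "g \<noteq> \<one>" "c \<in> carrier G" "c' \<in> carrier G"
    "inv c \<otimes> g \<otimes> c \<in> edge_group e" "inv c' \<otimes> g \<otimes> c' \<in> edge_group e'"
    "height u = height b + (if e then 1 else - 1)" "height v = height b + (if e' then 1 else - 1)"
    "e = e' \<Longrightarrow> inv c \<otimes> c' \<in> edge_group e \<Longrightarrow> u = v"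
    using fixed_edges_at_vertex[OF X b u v] by metis
  then have e: "e = e'" using assms by (auto split: if_splits)
  define y where "y = inv c \<otimes> c'"
  have y: "y \<in> carrier G" using * by (simp add: y_def)
  have ne: "inv c \<otimes> g \<otimes> c \<noteq> \<one>" using conj_by_one_iff[of c g] * by (simp add: conj_by_def)
  have "y \<otimes> (inv c' \<otimes> g \<otimes> c') = inv c \<otimes> g \<otimes> c \<otimes> y"
    using * by (simp add: y_def m_assoc inv_cancel_left)
  then have "y \<in> edge_group e" using edge_group_malnormal[OF *(5) _ ne y] *(6) e by blast
  then show ?thesis using *(9) e by (simp add: y_def)
qed

text \<open>A fixed vertex \<open>w\<close> is reached from the root along fixed vertices, and the axis already supplies the only
  fixed neighbours above and below.\<close>

lemma axis_of_fixed:
  assumes a: "a \<in> A" "a \<noteq> \<one>" and w: "vertex w" "vertex_act (base a) w = w"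
  shows "\<exists>k. w = axis k"
  using w
proof (induction "nat (tree_dist w [])" arbitrary: w)
  case 0
  then have "tree_dist w [] = 0" using dist_nonneg[of w "[]"] by simp
  then show ?case using axis_zero tree_dist_eq_0_iff by metis
next
  case (Suc n)
  have ac: "a \<in> carrier G" using a subset_A by auto
  have ne: "base a \<noteq> \<one>\<^bsub>\<Gamma>\<^esub>" using base_inj[OF ac one_closed] a(2) base_one by auto
  have "w \<noteq> []" using Suc.hyps(2) tree_dist_eq_0_iff[of w "[]"] by auto
  then obtain b where b: "vertex b" "tree_dist w b = 1" "tree_dist b [] = tree_dist w [] - 1"
    using dist_step[of w "[]"] Suc.prems by auto
  have bf: "vertex_act (base a) b = b"
    by (rule fixes_between[of _ w "[]"]) (use Suc.prems b ac base_fixes_root in auto)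
  have "n = nat (tree_dist b [])" using b Suc.hyps(2) by simp
  then obtain k where k: "b = axis k" using Suc.hyps(1) b bf by blast
  have dbw: "tree_dist b w = 1" using b(2) tree_dist_sym by metis
  have up: "tree_dist b (axis (k + 1)) = 1" using axis_adjacent k by simp
  have down: "tree_dist b (axis (k - 1)) = 1"
    using axis_adjacent[of "k - 1"] tree_dist_sym[of "axis k"] k by simp
  have "height w = height b + 1 \<or> height w = height b - 1"
    using height_diff_le_dist[of b w] tree_dist_parity[of b w] unfolding dbw by presburger
  then show ?case
  proof
    assume "height w = height b + 1"
    then have "w = axis (k + 1)"
      using fixed_neighbor_unique[OF base_closed[OF ac] ne b(1) bf Suc.prems(1) dbw Suc.prems(2) _ up]
        base_fixes_axis[OF a(1)] axis_height k by simp
    then show ?thesis by blast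
  next
    assume "height w = height b - 1"
    then have "w = axis (k - 1)"
      using fixed_neighbor_unique[OF base_closed[OF ac] ne b(1) bf Suc.prems(1) dbw Suc.prems(2) _ down]
        base_fixes_axis[OF a(1)] axis_height k by simp
    then show ?thesis by blast
  qed
qed

lemma decompose_axis_mover:
  assumes "Y \<in> carrier \<Gamma>" "vertex_act Y [] = axis k"
  obtains y where "y \<in> carrier G" "Y = t [^]\<^bsub>\<Gamma>\<^esub> k \<otimes>\<^bsub>\<Gamma>\<^esub> base y"
proof -
  let ?T = "t [^]\<^bsub>\<Gamma>\<^esub> k"
  have "vertex_act (inv\<^bsub>\<Gamma>\<^esub> ?T \<otimes>\<^bsub>\<Gamma>\<^esub> Y) [] = []"
    using vertex_act_mult[of "inv\<^bsub>\<Gamma>\<^esub> ?T" Y "[]"] act_inv_cancel(1)[OF t_pow_closed, of "[]" k] assms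
    by (simp add: axis_def)
  then obtain y where y: "y \<in> carrier G" "inv\<^bsub>\<Gamma>\<^esub> ?T \<otimes>\<^bsub>\<Gamma>\<^esub> Y = base y"
    using stabilizer_root[of "inv\<^bsub>\<Gamma>\<^esub> ?T \<otimes>\<^bsub>\<Gamma>\<^esub> Y"] assms by auto
  have "Y = ?T \<otimes>\<^bsub>\<Gamma>\<^esub> base y" using \<Gamma>.inv_cancel_left(1)[OF t_pow_closed[of k] assms(1)] y(2) by simp
  then show thesis using that y by blast
qed

lemma twisted_eq_iff:
  assumes "a \<in> A" "y \<in> carrier G" "x \<in> carrier G"
  shows "t [^]\<^bsub>\<Gamma>\<^esub> (k::int) \<otimes>\<^bsub>\<Gamma>\<^esub> base y \<otimes>\<^bsub>\<Gamma>\<^esub> base x = base a \<otimes>\<^bsub>\<Gamma>\<^esub> (t [^]\<^bsub>\<Gamma>\<^esub> k \<otimes>\<^bsub>\<Gamma>\<^esub> base y) \<longleftrightarrow> y \<otimes> x = a \<otimes> y"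
proof -
  let ?T = "t [^]\<^bsub>\<Gamma>\<^esub> k"
  have ac: "a \<in> carrier G" using assms subset_A by auto
  have "base a \<otimes>\<^bsub>\<Gamma>\<^esub> (?T \<otimes>\<^bsub>\<Gamma>\<^esub> base y) = base a \<otimes>\<^bsub>\<Gamma>\<^esub> ?T \<otimes>\<^bsub>\<Gamma>\<^esub> base y"
    using assms ac by (simp add: \<Gamma>.m_assoc)
  also have "\<dots> = ?T \<otimes>\<^bsub>\<Gamma>\<^esub> base (a \<otimes> y)"
    unfolding t_pow_commutes[OF assms(1)] using assms ac by (simp add: base_mult \<Gamma>.m_assoc)
  finally have "?T \<otimes>\<^bsub>\<Gamma>\<^esub> base y \<otimes>\<^bsub>\<Gamma>\<^esub> base x = base a \<otimes>\<^bsub>\<Gamma>\<^esub> (?T \<otimes>\<^bsub>\<Gamma>\<^esub> base y)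
      \<longleftrightarrow> ?T \<otimes>\<^bsub>\<Gamma>\<^esub> base (y \<otimes> x) = ?T \<otimes>\<^bsub>\<Gamma>\<^esub> base (a \<otimes> y)"
    using assms by (simp add: base_mult \<Gamma>.m_assoc)
  also have "\<dots> \<longleftrightarrow> y \<otimes> x = a \<otimes> y"
    using \<Gamma>.Units_l_cancel[of ?T "base (y \<otimes> x)" "base (a \<otimes> y)"] base_inj[of "y \<otimes> x" "a \<otimes> y"] assms ac by auto
  finally show ?thesis .
qed

text \<open>An element that moves the root along the axis of \<open>a\<close> has the form \<open>t\<^sup>k y\<close> with \<open>y \<in> G\<close>, and
  equations with \<open>a\<close> become equations for \<open>y\<close> because \<open>t\<close> commutes with \<open>A\<close>. In each of them malnormality puts \<open>y\<close>
  into \<open>A\<close>. In particular the centralizer of \<open>a\<close> is \<open>A \<times> \<langle>t\<rangle>\<close>.\<close>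

lemma A_element_csa:
  assumes a: "a \<in> A" "a \<noteq> \<one>"
  shows "csa_element \<Gamma> (base a)"
proof -
  have ac: "a \<in> carrier G" using a subset_A by auto
  have cent: "\<exists>k y. y \<in> A \<and> Y = t [^]\<^bsub>\<Gamma>\<^esub> (k::int) \<otimes>\<^bsub>\<Gamma>\<^esub> base y"
    if Y: "Y \<in> carrier \<Gamma>" "base a \<otimes>\<^bsub>\<Gamma>\<^esub> Y = Y \<otimes>\<^bsub>\<Gamma>\<^esub> base a" for Y
  proof -
    have "vertex_act (base a) (vertex_act Y []) = vertex_act Y []"
      using commuting_fixes[OF base_closed[OF ac] Y(1) base_closed[OF ac] Y(2)[symmetric], of "[]"]
        base_fixes_root[OF ac] by simp
    then obtain k where "vertex_act Y [] = axis k"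
      using axis_of_fixed[OF a] vertex_act_closed Y(1) by fastforce
    then obtain y where y: "y \<in> carrier G" "Y = t [^]\<^bsub>\<Gamma>\<^esub> k \<otimes>\<^bsub>\<Gamma>\<^esub> base y"
      using decompose_axis_mover[OF Y(1)] by blast
    have "y \<otimes> a = a \<otimes> y" using twisted_eq_iff[OF a(1) y(1) ac, of k] Y(2) y(2) by simp
    then have "y \<in> A" using A_malnormal[OF a(1,1,2) y(1)] by blast
    then show ?thesis using y by blast
  qed
  show ?thesis
  proof (rule csa_elementI)
    fix Y Z assume YZ: "Y \<in> carrier \<Gamma>" "Z \<in> carrier \<Gamma>" "base a \<otimes>\<^bsub>\<Gamma>\<^esub> Y = Y \<otimes>\<^bsub>\<Gamma>\<^esub> base a"
      "base a \<otimes>\<^bsub>\<Gamma>\<^esub> Z = Z \<otimes>\<^bsub>\<Gamma>\<^esub> base a"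
    obtain k y where y: "y \<in> A" "Y = t [^]\<^bsub>\<Gamma>\<^esub> (k::int) \<otimes>\<^bsub>\<Gamma>\<^esub> base y" using cent YZ by blast
    obtain l z where z: "z \<in> A" "Z = t [^]\<^bsub>\<Gamma>\<^esub> (l::int) \<otimes>\<^bsub>\<Gamma>\<^esub> base z" using cent YZ by blast
    have c: "y \<in> carrier G" "z \<in> carrier G" using y z subset_A by auto
    have "Y \<otimes>\<^bsub>\<Gamma>\<^esub> Z = t [^]\<^bsub>\<Gamma>\<^esub> (k + l) \<otimes>\<^bsub>\<Gamma>\<^esub> base (y \<otimes> z)" if "y \<in> A" "z \<in> A"
      "Y = t [^]\<^bsub>\<Gamma>\<^esub> (k::int) \<otimes>\<^bsub>\<Gamma>\<^esub> base y" "Z = t [^]\<^bsub>\<Gamma>\<^esub> (l::int) \<otimes>\<^bsub>\<Gamma>\<^esub> base z" for Y Z y z k l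
    proof -
      have c: "y \<in> carrier G" "z \<in> carrier G" using that subset_A by auto
      have "Y \<otimes>\<^bsub>\<Gamma>\<^esub> Z = t [^]\<^bsub>\<Gamma>\<^esub> k \<otimes>\<^bsub>\<Gamma>\<^esub> (base y \<otimes>\<^bsub>\<Gamma>\<^esub> t [^]\<^bsub>\<Gamma>\<^esub> l) \<otimes>\<^bsub>\<Gamma>\<^esub> base z"
        using that c by (simp add: \<Gamma>.m_assoc)
      then show ?thesis
        unfolding t_pow_commutes[OF that(1)] using c
        by (simp add: \<Gamma>.m_assoc[symmetric] \<Gamma>.int_pow_mult) (simp add: \<Gamma>.m_assoc base_mult)
    qed
    note prod = this
    have "y \<otimes> z = z \<otimes> y" using edge_group_comm[of y True z] y z by (simp add: edge_group_def)
    then show "Y \<otimes>\<^bsub>\<Gamma>\<^esub> Z = Z \<otimes>\<^bsub>\<Gamma>\<^esub> Y" using prod[OF y(1) z(1) y(2) z(2)] prod[OF z(1) y(1) z(2) y(2)] by (simp add: add.commute)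
  next
    fix Y X' assume Y: "Y \<in> carrier \<Gamma>" "X' \<in> carrier \<Gamma>" "Y \<otimes>\<^bsub>\<Gamma>\<^esub> X' = base a \<otimes>\<^bsub>\<Gamma>\<^esub> Y"
      "base a \<otimes>\<^bsub>\<Gamma>\<^esub> X' = X' \<otimes>\<^bsub>\<Gamma>\<^esub> base a"
    obtain k x where x: "x \<in> A" "X' = t [^]\<^bsub>\<Gamma>\<^esub> (k::int) \<otimes>\<^bsub>\<Gamma>\<^esub> base x" using cent Y by blast
    have xc: "x \<in> carrier G" using x subset_A by auto
    \<comment> \<open>A conjugate of \<open>base a\<close> fixes a vertex, so it shifts no heights.\<close>
    define w where "w = vertex_act (inv\<^bsub>\<Gamma>\<^esub> Y) []"
    have w: "vertex w" "vertex_act Y w = []"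
      using Y vertex_act_closed act_inv_cancel(2)[OF Y(1), of "[]"] by (auto simp: w_def)
    have "vertex_act X' w = w"
      using commuting_fixes[OF base_closed[OF ac] Y(1,2,3), of w] w base_fixes_root[OF ac] by simp
    moreover have "vertex_act X' [] = axis k"
      using x xc vertex_act_mult[of "t [^]\<^bsub>\<Gamma>\<^esub> k" "base x" "[]"] base_fixes_root[OF xc] by (simp add: axis_def)
    ultimately have "k = 0" using height_act[OF Y(2), of "[]" w] w(1) axis_height[of k] by simp
    then have X': "X' = base x" using x xc by simp
    have "vertex_act (base a) (vertex_act Y []) = vertex_act Y []"
      using commuting_fixes[OF base_closed[OF ac] Y(1,2,3), of "[]"] base_fixes_root[OF xc] X' by simp
    then obtain l where "vertex_act Y [] = axis l"
      using axis_of_fixed[OF a] vertex_act_closed Y(1) by fastforce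
    then obtain y where y: "y \<in> carrier G" "Y = t [^]\<^bsub>\<Gamma>\<^esub> l \<otimes>\<^bsub>\<Gamma>\<^esub> base y"
      using decompose_axis_mover[OF Y(1)] by blast
    have "y \<otimes> x = a \<otimes> y" using twisted_eq_iff[OF a(1) y(1) xc, of l] Y(3) y(2) X' by simp
    then have "y \<in> A" using A_malnormal[OF a(1) x(1) a(2) y(1)] by blast
    then have "y \<otimes> a = a \<otimes> y" using edge_group_comm[of y True a] a by (simp add: edge_group_def)
    then show "base a \<otimes>\<^bsub>\<Gamma>\<^esub> Y = Y \<otimes>\<^bsub>\<Gamma>\<^esub> base a"
      using twisted_eq_iff[OF a(1) y(1) ac, of l] y(2) by simp
  qed
qed

text \<open>An element of \<open>G\<close> that is not conjugate into \<open>A\<close>, hence not into \<open>B\<close> either, fixes no edge at the root; so the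
  root is its only fixed vertex.\<close>

lemma base_element_csa:
  assumes g: "g \<in> carrier G" "g \<noteq> \<one>"
  shows "csa_element \<Gamma> (base g)"
proof (cases "\<exists>c\<in>carrier G. conj_by c g \<in> A")
  case True
  then obtain c where c: "c \<in> carrier G" "conj_by c g \<in> A" by blast
  have "conj_by c g \<noteq> \<one>" using conj_by_one_iff c g by simp
  then have "csa_element \<Gamma> (base (conj_by c g))" using A_element_csa c by blast
  moreover have "base (conj_by c g) = \<Gamma>.conj_by (base c) (base g)"
    using c g by (simp add: conj_by_def \<Gamma>.conj_by_def base_mult base_inv)
  ultimately show ?thesis using \<Gamma>.csa_element_conj_by[of "base c" "base g"] c g by simp
next
  case False
  have only: "w = []" if w: "vertex w" "vertex_act (base g) w = w" for w
  proof (rule ccontr)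
    assume "w \<noteq> []"
    then obtain b where b: "vertex b" "tree_dist [] b = 1" "tree_dist b w = tree_dist [] w - 1"
      using dist_step[of "[]" w] w by auto
    have "vertex_act (base g) b = b"
      by (rule fixes_between[of _ "[]" w]) (use w b g base_fixes_root in auto)
    moreover obtain c e where c: "b = [(c, e)]" "c \<in> carrier G" "rep e c = c"
      using neighbor_of_root[OF b(1,2)] by metis
    ultimately have ce: "conj_by c g \<in> edge_group e" using base_fixes_neighbor_iff g by (simp add: conj_by_def)
    have "\<exists>c\<in>carrier G. conj_by c g \<in> A"
    proof (cases e)
      case True
      then show ?thesis using c ce by (auto simp: edge_group_def)
    next
      case e: False
      then have "conj_by c g \<in> B" using ce by (simp add: edge_group_def)
      then have "s \<otimes> conj_by c g \<otimes> inv s \<in> A"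
        using mem_conjugate_set[OF subset_A s_closed] B_conj by blast
      moreover have "conj_by (c \<otimes> inv s) g = s \<otimes> conj_by c g \<otimes> inv s"
        using c g s_closed by (simp add: conj_by_def m_assoc inv_mult_group)
      ultimately show ?thesis using c s_closed by (intro bexI[of _ "c \<otimes> inv s"]) auto
    qed
    then show False using False by blast
  qed
  have ne: "base g \<noteq> \<one>\<^bsub>\<Gamma>\<^esub>" using base_inj[OF g(1) one_closed] g(2) base_one by auto
  note bg = base_closed[OF g(1)]
  have cent: "vertex_act Y [] = []" if Y: "Y \<in> carrier \<Gamma>" "base g \<otimes>\<^bsub>\<Gamma>\<^esub> Y = Y \<otimes>\<^bsub>\<Gamma>\<^esub> base g" for Y
    using commuting_fixes[OF bg Y(1) bg Y(2)[symmetric], of "[]"] base_fixes_root[OF g(1)]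
      only[of "vertex_act Y []"] vertex_act_closed[OF Y(1), of "[]"] by simp
  show ?thesis
  proof (rule csa_element_of_center[OF bg ne _ cent])
    show "vertex []" by simp
    fix Y X' assume Y: "Y \<in> carrier \<Gamma>" "X' \<in> carrier \<Gamma>" "Y \<otimes>\<^bsub>\<Gamma>\<^esub> X' = base g \<otimes>\<^bsub>\<Gamma>\<^esub> Y"
      "base g \<otimes>\<^bsub>\<Gamma>\<^esub> X' = X' \<otimes>\<^bsub>\<Gamma>\<^esub> base g"
    then show "vertex_act Y [] = []"
      using commuting_fixes[OF bg Y(1,2,3), of "[]"] cent[OF Y(2,4)]
        only[of "vertex_act Y []"] vertex_act_closed[OF Y(1), of "[]"] by simp
  qed
qed

theorem csa_star_centralizer: "csa_star_group \<Gamma>"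
proof (rule csa_star_if_elliptic)
  fix X v assume X: "X \<in> carrier \<Gamma>" "X \<noteq> \<one>\<^bsub>\<Gamma>\<^esub>" and v: "vertex v" "vertex_act X v = v"
  obtain W where W: "W \<in> carrier \<Gamma>" "vertex_act W [] = v" using transitive v(1) by blast
  obtain g where g: "g \<in> carrier G" "\<Gamma>.conj_by W X = base g" using stabilizer_conj_base[OF W(1) X(1)] v W by auto
  have "g \<noteq> \<one>" using \<Gamma>.conj_by_one_iff[OF W(1) X(1)] g X(2) base_one by auto
  then show "csa_element \<Gamma> X"
    using base_element_csa[OF g(1)] \<Gamma>.csa_element_conj_by[OF W(1) X(1)] g(2) by simp
qed

end

lemma (in csa_hnn_extension) csa_star_separated:
  assumes "\<And>g x. \<lbrakk>g \<in> carrier G; x \<in> A; g \<otimes> x \<otimes> inv g \<in> B\<rbrakk> \<Longrightarrow> x = \<one>"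
  shows "csa_star_group \<Gamma>"
proof (rule csa_star_if_elliptic)
  fix X v assume "X \<in> carrier \<Gamma>" "X \<noteq> \<one>\<^bsub>\<Gamma>\<^esub>" "vertex v" "vertex_act X v = v"
  then show "csa_element \<Gamma> X" by (rule separated_elliptic_csa[rotated 1]) (rule assms)
qed

text \<open>Put \<open>Y = tg\<close>, with \<open>t\<close> the stable letter. The hypothesis says that \<open>Y\<close> conjugates \<open>a\<close> to
  \<open>x\<close>, which commutes with \<open>a\<close>. By the CSA property \<open>Y\<close> commutes with \<open>a\<close>, hence with everything that commutes with
  \<open>a\<close>, in particular with \<open>c\<close>; and \<open>c\<close> commutes with \<open>tg\<close> only if \<open>\<phi> c\<close> is the conjugate of \<open>c\<close> by \<open>g\<close>.\<close>

lemma (in hnn_extension) conjugator_if_csa: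
  assumes csa: "csa_element \<Gamma> (base a)" and a: "a \<in> A"
    and g: "g \<in> carrier G" "x \<in> A" "g \<otimes> x = \<phi> a \<otimes> g"
    and comm: "\<And>c. c \<in> A \<Longrightarrow> a \<otimes> c = c \<otimes> a"
    and c: "c \<in> A"
  shows "\<phi> c = g \<otimes> c \<otimes> inv g"
proof -
  define Y where "Y = stable True \<otimes>\<^bsub>\<Gamma>\<^esub> base g"
  have Y: "Y \<in> carrier \<Gamma>" using g by (simp add: Y_def)
  have car: "z \<in> carrier G \<and> \<phi> z \<in> carrier G" if "z \<in> A" for z
    using that subset_A subset_phi by auto
  have bY: "base z \<otimes>\<^bsub>\<Gamma>\<^esub> Y = stable True \<otimes>\<^bsub>\<Gamma>\<^esub> base (\<phi> z \<otimes> g)" if "z \<in> A" for z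
  proof -
    have "base z \<otimes>\<^bsub>\<Gamma>\<^esub> Y = base z \<otimes>\<^bsub>\<Gamma>\<^esub> stable True \<otimes>\<^bsub>\<Gamma>\<^esub> base g"
      using car[OF that] g by (simp add: Y_def \<Gamma>.m_assoc)
    then show ?thesis
      unfolding stable_conj_True[OF that] using car[OF that] g by (simp add: \<Gamma>.m_assoc base_mult)
  qed
  have Yb: "Y \<otimes>\<^bsub>\<Gamma>\<^esub> base z = stable True \<otimes>\<^bsub>\<Gamma>\<^esub> base (g \<otimes> z)" if "z \<in> A" for z
    using car[OF that] g by (simp add: Y_def \<Gamma>.m_assoc base_mult)
  have bcomm: "base a \<otimes>\<^bsub>\<Gamma>\<^esub> base z = base z \<otimes>\<^bsub>\<Gamma>\<^esub> base a" if "z \<in> A" for z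
    using comm[OF that] car[OF a] car[OF that] by (simp add: base_mult[symmetric])
  have "base a \<otimes>\<^bsub>\<Gamma>\<^esub> Y = Y \<otimes>\<^bsub>\<Gamma>\<^esub> base a"
  proof (rule csa_element_conjugate[OF csa Y])
    show "base x \<in> carrier \<Gamma>" using car[OF g(2)] by simp
    show "Y \<otimes>\<^bsub>\<Gamma>\<^esub> base x = base a \<otimes>\<^bsub>\<Gamma>\<^esub> Y" unfolding bY[OF a] Yb[OF g(2)] g(3) ..
    show "base a \<otimes>\<^bsub>\<Gamma>\<^esub> base x = base x \<otimes>\<^bsub>\<Gamma>\<^esub> base a" by (rule bcomm[OF g(2)])
  qed
  moreover have bc: "base c \<in> carrier \<Gamma>" using car[OF c] by simp
  ultimately have "Y \<otimes>\<^bsub>\<Gamma>\<^esub> base c = base c \<otimes>\<^bsub>\<Gamma>\<^esub> Y"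
    using csa_element_centralizer[OF csa Y bc _ bcomm[OF c]] by blast
  then have eq: "stable True \<otimes>\<^bsub>\<Gamma>\<^esub> base (g \<otimes> c) = stable True \<otimes>\<^bsub>\<Gamma>\<^esub> base (\<phi> c \<otimes> g)"
    unfolding bY[OF c] Yb[OF c] .
  have gc: "g \<otimes> c \<in> carrier G" "\<phi> c \<otimes> g \<in> carrier G" using car[OF c] g(1) by auto
  have "base (g \<otimes> c) = base (\<phi> c \<otimes> g)"
    using \<Gamma>.Units_l_cancel[of "stable True" "base (g \<otimes> c)" "base (\<phi> c \<otimes> g)"] eq gc
    by (metis \<Gamma>.Units_eq base_closed stable_closed)
  then have "g \<otimes> c = \<phi> c \<otimes> g" using base_inj gc by blast
  then show ?thesis using inv_solve_right[of "\<phi> c" "g \<otimes> c" g] car[OF c] g(1) m_closed by blast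
qed

section \<open>The characterization\<close>

theorem theorem5:
  fixes G (structure) and A B :: "'a set" and \<phi> :: "'a \<Rightarrow> 'a"
  assumes "csa_star_group G"
    and "commutative_subgroup A G" and "commutative_subgroup B G"
    and "\<phi> \<in> iso (G\<lparr>carrier := A\<rparr>) (G\<lparr>carrier := B\<rparr>)"
    and "maximal_commutative_subgroup A G"
  shows "csa_star_group (HNN G A \<phi>) \<longleftrightarrow>
    separated_HNN G A B \<or>
    (\<exists>s \<in> carrier G. B = conjugate_set G A s \<and> (\<forall>a \<in> A. \<phi> a = inv s \<otimes> a \<otimes> s))"
proof -
  interpret csa_star_group G by fact
  have AB: "subgroup A G" "subgroup B G" "\<And>x y. x \<in> A \<Longrightarrow> y \<in> A \<Longrightarrow> x \<otimes> y = y \<otimes> x"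
    "\<And>x y. x \<in> B \<Longrightarrow> y \<in> B \<Longrightarrow> x \<otimes> y = y \<otimes> x"
    using assms(2,3) by (auto simp: commutative_subgroup_iff)
  interpret hnn_extension G A B \<phi> 
    by (intro hnn_extension.intro hnn_extension_axioms.intro is_group AB assms(4))
  have elt: "csa_element G g" "g \<otimes> g \<noteq> \<one>" if "g \<in> carrier G" "g \<noteq> \<one>" for g
    using assms(1) that by (auto simp: csa_star_group_iff)
  have memA: "z \<in> conjugate_set G A y \<longleftrightarrow> z \<in> carrier G \<and> y \<otimes> z \<otimes> inv y \<in> A"
    and memB: "z \<in> conjugate_set G B y \<longleftrightarrow> z \<in> carrier G \<and> y \<otimes> z \<otimes> inv y \<in> B"
    if "y \<in> carrier G" for y z
    using mem_conjugate_set that subgroup.subset[OF AB(1)] subgroup.subset[OF AB(2)] by auto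
  have mal: "y \<in> A" if xA: "x \<in> A" "x' \<in> A" and x: "x \<noteq> \<one>" and y: "y \<in> carrier G" "y \<otimes> x' = x \<otimes> y" for x x' y
  proof (rule ccontr)
    assume "y \<notin> A"
    then have "A \<inter> conjugate_set G A y = {\<one>}"
      using malnormal_if_maximal[OF assms(5)] y by (auto simp: malnormal_def)
    moreover have c: "x \<in> carrier G" "x' \<in> carrier G" using xA subset_A by auto
    then have "y \<otimes> x' \<otimes> inv y = x" using y inv_solve_right[of x "y \<otimes> x'" y] by auto
    then have "x' \<in> conjugate_set G A y" using memA y c xA by simp
    ultimately have "x' = \<one>" using xA by auto
    then have "y = x \<otimes> y" using y by simp
    then show False using x y(1) c(1) r_cancel_one' by blast
  qed
  interpret csa_hnn_extension G A B \<phi>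
  proof
    show "x \<otimes> y = y \<otimes> x" if "x \<in> edge_group e" "y \<in> edge_group e" for x y e
      using that AB(3,4) unfolding edge_group_def by (cases e) (simp_all only: if_True if_False)
  qed (use elt mal in blast)+
  have sep: "separated_HNN G A B \<longleftrightarrow> (\<forall>g \<in> carrier G. \<forall>x \<in> A. g \<otimes> x \<otimes> inv g \<in> B \<longrightarrow> x = \<one>)"
  proof -
    have "\<one> \<in> A \<inter> conjugate_set G B g" if "g \<in> carrier G" for g
      using that memB[OF that, of \<one>] subgroup.one_closed[OF AB(1)] subgroup.one_closed[OF AB(2)] by simp
    moreover have "x \<in> A \<inter> conjugate_set G B g \<longleftrightarrow> x \<in> A \<and> g \<otimes> x \<otimes> inv g \<in> B" if "g \<in> carrier G" for g x
      using memB[OF that, of x] subset_A by blast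
    ultimately show ?thesis unfolding separated_HNN_def by blast
  qed
  show ?thesis
  proof
    assume csa: "csa_star_group \<Gamma>"
    show "separated_HNN G A B \<or>
      (\<exists>s \<in> carrier G. B = conjugate_set G A s \<and> (\<forall>a \<in> A. \<phi> a = inv s \<otimes> a \<otimes> s))"
    proof (subst disj_commute, rule disjCI)
      assume "\<not> separated_HNN G A B"
      then obtain g x where g: "g \<in> carrier G" "x \<in> A" "g \<otimes> x \<otimes> inv g \<in> B" "x \<noteq> \<one>"
        using sep by blast
      then obtain a where a: "a \<in> A" "\<phi> a = g \<otimes> x \<otimes> inv g" using phi_image by (metis imageE)
      have car: "x \<in> carrier G" "a \<in> carrier G" using g a subset_A by auto
      have gx: "g \<otimes> x = \<phi> a \<otimes> g" unfolding a(2) using g(1) car by (simp add: m_assoc)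
      have "a \<noteq> \<one>"
      proof
        assume "a = \<one>"
        then have "\<phi> a = \<one>" using twist_one[of True] by (simp add: twist_def)
        then have "g \<otimes> x = g" using gx g(1) by simp
        then show False using g(1,4) car l_cancel_one by blast
      qed
      then have "base a \<noteq> \<one>\<^bsub>\<Gamma>\<^esub>" using base_inj[OF car(2) one_closed] base_one by auto
      then have "csa_element \<Gamma> (base a)" using csa car by (simp add: \<Gamma>.csa_star_group_iff)
      then have phi: "\<phi> c = g \<otimes> c \<otimes> inv g" if "c \<in> A" for c
        by (rule conjugator_if_csa[OF _ a(1) g(1,2) gx AB(3)[OF a(1)] that])
      have "z \<in> B \<longleftrightarrow> z \<in> conjugate_set G A (inv g)" for z
      proof
        assume "z \<in> B"
        then obtain c where "c \<in> A" "z = \<phi> c" using phi_image by blast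
        then have c: "c \<in> A" "z = g \<otimes> c \<otimes> inv g" using phi by simp_all
        then have "c \<in> carrier G" using subset_A by auto
        then show "z \<in> conjugate_set G A (inv g)"
          using memA[of "inv g" z] c g(1) by (simp add: m_assoc inv_cancel_left)
      next
        assume "z \<in> conjugate_set G A (inv g)"
        then have z: "z \<in> carrier G" "inv g \<otimes> z \<otimes> g \<in> A" using memA[of "inv g" z] g(1) by simp_all
        then have "\<phi> (inv g \<otimes> z \<otimes> g) = z" using phi[OF z(2)] g(1) by (simp add: m_assoc inv_cancel_left)
        then show "z \<in> B" using phi_image z(2) imageI by metis
      qed
      then have "B = conjugate_set G A (inv g)" by blast
      then show "\<exists>s \<in> carrier G. B = conjugate_set G A s \<and> (\<forall>a \<in> A. \<phi> a = inv s \<otimes> a \<otimes> s)"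
        using phi g(1) by (intro bexI[of _ "inv g"]) simp_all
    qed
  next
    assume "separated_HNN G A B \<or>
      (\<exists>s \<in> carrier G. B = conjugate_set G A s \<and> (\<forall>a \<in> A. \<phi> a = inv s \<otimes> a \<otimes> s))"
    then show "csa_star_group \<Gamma>"
    proof
      assume "separated_HNN G A B"
      then show ?thesis using csa_star_separated sep by blast
    next
      assume "\<exists>s \<in> carrier G. B = conjugate_set G A s \<and> (\<forall>a \<in> A. \<phi> a = inv s \<otimes> a \<otimes> s)"
      then obtain s where s: "s \<in> carrier G" "B = conjugate_set G A s" "\<And>a. a \<in> A \<Longrightarrow> \<phi> a = inv s \<otimes> a \<otimes> s"
        by blast
      interpret centralizer_extension G A B \<phi> s using s by unfold_locales
      show ?thesis by (rule csa_star_centralizer)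
    qed
  qed
qed

end
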